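(* (a) $\Delta_2(\mathcal C)$ is isomorphic to $\ell_g^*$. (b) $\langle\Delta_1,\Delta_2\rangle(\mathcal C)$ is isomorphic to $\bigcirc^*$, the dual of $\bigcirc=\langle\Delta_0,\Delta_1\rangle(\ker\Delta_2)$.
   Context: All spaces are complex. For the couple $(X_0,X_1)=(\ell_\infty,\ell_1)$ put $\Sigma=\ell_\infty+\ell_1$. The Calderón space $\mathcal C$ of the couple is the Banach space of bounded continuous functions $F:\{z\in\mathbb C:0\le \mathrm{Re}\,z\le 1\}\to\Sigma$, analytic on the open strip, such that for $j=0,1$ the map $t\mapsto F(j+it)$ is continuous from $\mathbb R$ into $X_j$ and tends to $0$ as $|t|\to\infty$, with norm $\|F\|=\max_{j=0,1}\sup_{t}\|F(j+it)\|_{X_j}$. For $k=0,1,2$ let $\Delta_k:\mathcal C\to\Sigma$, $\Delta_k(F)=F^{(k)}(1/2)/k!$, and for distinct indices $\langle\Delta_a,\Delta_b\rangle(F)=(\Delta_aF,\Delta_bF)$. For a closed subspace $K\subset\mathcal C$ and one of these maps $T$, the space $T(K)$ carries the quotient norm $\|x\|=\inf\{\|F\|:F\in K,\ TF=x\}$. $\ell_g$ is the Orlicz sequence space of the Orlicz function which near $0$ is $g(t)=t^2\log^4t$; that is, $\ell_g=\{x\in\ell_2:x\log^2|x|\in\ell_2\}$. *)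

theory Defs
  imports "HOL-Analysis.Analysis" "HOL-Library.Function_Algebras"
begin

section \<open>Complex vector spaces and normed spaces on a carrier\<close>

class complex_vector = ab_group_add +
  fixes scaleC :: "complex \<Rightarrow> 'a \<Rightarrow> 'a" (infixr "*\<^sub>C" 75)
  assumes scaleC_add_right: "c *\<^sub>C (x + y) = c *\<^sub>C x + c *\<^sub>C y"
    and scaleC_add_left: "(c + d) *\<^sub>C x = c *\<^sub>C x + d *\<^sub>C x"
    and scaleC_scaleC: "c *\<^sub>C (d *\<^sub>C x) = (c * d) *\<^sub>C x"
    and scaleC_one: "1 *\<^sub>C x = x"

instantiation complex :: complex_vector
begin
definition scaleC_complex_def: "c *\<^sub>C (x :: complex) = c * x"
instance by standard (simp_all add: scaleC_complex_def algebra_simps)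
end

instantiation "fun" :: (type, complex_vector) complex_vector
begin
definition scaleC_fun_def: "c *\<^sub>C f = (\<lambda>x. c *\<^sub>C f x)"
instance
  by standard (simp_all add: scaleC_fun_def fun_eq_iff scaleC_add_right scaleC_add_left
      scaleC_scaleC scaleC_one)
end

instantiation prod :: (complex_vector, complex_vector) complex_vector
begin
definition scaleC_prod_def: "c *\<^sub>C p = (c *\<^sub>C fst p, c *\<^sub>C snd p)"
instance
  by standard (simp_all add: scaleC_prod_def prod_eq_iff scaleC_add_right scaleC_add_left
      scaleC_scaleC scaleC_one)
end

text \<open>A normed space is given by a linear subspace \<open>carr\<close> of a complex vector space and a
  norm \<open>nrm\<close>, whose values outside \<open>carr\<close> are irrelevant.\<close>

record 'a nspace =
  carr :: "'a set"
  nrm :: "'a \<Rightarrow> real"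

definition clinear_on :: "'a::complex_vector set \<Rightarrow> ('a \<Rightarrow> 'b::complex_vector) \<Rightarrow> bool" where
  "clinear_on V T \<longleftrightarrow>
     (\<forall>x\<in>V. \<forall>y\<in>V. T (x + y) = T x + T y) \<and> (\<forall>c. \<forall>x\<in>V. T (c *\<^sub>C x) = c *\<^sub>C T x)"

definition isomorphic :: "'a::complex_vector nspace \<Rightarrow> 'b::complex_vector nspace \<Rightarrow> bool" where
  "isomorphic X Y \<longleftrightarrow>
     (\<exists>T. bij_betw T (carr X) (carr Y) \<and> clinear_on (carr X) T \<and>
        (\<exists>c>0. \<exists>C>0. \<forall>x\<in>carr X. c * nrm X x \<le> nrm Y (T x) \<and> nrm Y (T x) \<le> C * nrm X x))"

text \<open>Functionals on \<open>X\<close> are total functions, so they are normalised to vanish off \<open>carr X\<close>.\<close>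

definition dual :: "'a::complex_vector nspace \<Rightarrow> ('a \<Rightarrow> complex) nspace" where
  "dual X =
     \<lparr>carr = {f. clinear_on (carr X) f \<and> (\<exists>B. \<forall>x\<in>carr X. cmod (f x) \<le> B * nrm X x) \<and>
                 (\<forall>x. x \<notin> carr X \<longrightarrow> f x = 0)},
      nrm = (\<lambda>f. Sup {cmod (f x) | x. x \<in> carr X \<and> nrm X x \<le> 1})\<rparr>"

definition sum_space :: "'a::complex_vector nspace \<Rightarrow> 'a nspace \<Rightarrow> 'a nspace" where
  "sum_space X Y =
     \<lparr>carr = {x + y | x y. x \<in> carr X \<and> y \<in> carr Y},
      nrm = (\<lambda>s. Inf {nrm X x + nrm Y y | x y. x \<in> carr X \<and> y \<in> carr Y \<and> s = x + y})\<rparr>"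

text \<open>The space \<open>T ` K\<close> with the quotient norm, for \<open>K\<close> a subspace of \<open>X\<close>.\<close>

definition quotient_image ::
    "'a::complex_vector nspace \<Rightarrow> ('a \<Rightarrow> 'b::complex_vector) \<Rightarrow> 'a set \<Rightarrow> 'b nspace" where
  "quotient_image X T K =
     \<lparr>carr = T ` K, nrm = (\<lambda>x. Inf {nrm X F | F. F \<in> K \<and> T F = x})\<rparr>"

section \<open>Sequence spaces\<close>

definition linfty :: "(nat \<Rightarrow> complex) nspace" where
  "linfty = \<lparr>carr = {x. bounded (range x)}, nrm = (\<lambda>x. SUP n. cmod (x n))\<rparr>"

definition lone :: "(nat \<Rightarrow> complex) nspace" where
  "lone = \<lparr>carr = {x. summable (\<lambda>n. cmod (x n))}, nrm = (\<lambda>x. \<Sum>n. cmod (x n))\<rparr>"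

definition orlicz_function :: "(real \<Rightarrow> real) \<Rightarrow> bool" where
  "orlicz_function g \<longleftrightarrow> g 0 = 0 \<and> convex_on {0..} g \<and> continuous_on {0..} g \<and>
     mono_on {0..} g \<and> filterlim g at_top at_top"

text \<open>The Orlicz sequence space with the Luxemburg norm.\<close>

definition orlicz_space :: "(real \<Rightarrow> real) \<Rightarrow> (nat \<Rightarrow> complex) nspace" where
  "orlicz_space g =
     \<lparr>carr = {x. \<exists>r>0. summable (\<lambda>n. g (cmod (x n) / r))},
      nrm = (\<lambda>x. Inf {r. r > 0 \<and> summable (\<lambda>n. g (cmod (x n) / r)) \<and>
                          (\<Sum>n. g (cmod (x n) / r)) \<le> 1})\<rparr>"

section \<open>Vector-valued analytic functions\<close>

definition tendsto_nrm ::
    "'a::complex_vector nspace \<Rightarrow> ('b \<Rightarrow> 'a) \<Rightarrow> 'a \<Rightarrow> 'b filter \<Rightarrow> bool" where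
  "tendsto_nrm X f l A \<longleftrightarrow> ((\<lambda>w. nrm X (f w - l)) \<longlongrightarrow> 0) A"

definition continuous_on_into ::
    "'a::complex_vector nspace \<Rightarrow> 'b::topological_space set \<Rightarrow> ('b \<Rightarrow> 'a) \<Rightarrow> bool" where
  "continuous_on_into X S f \<longleftrightarrow>
     f ` S \<subseteq> carr X \<and> (\<forall>z\<in>S. tendsto_nrm X f (f z) (at z within S))"

definition has_deriv_into ::
    "'a::complex_vector nspace \<Rightarrow> (complex \<Rightarrow> 'a) \<Rightarrow> 'a \<Rightarrow> complex \<Rightarrow> bool" where
  "has_deriv_into X f D z \<longleftrightarrow>
     D \<in> carr X \<and> tendsto_nrm X (\<lambda>w. inverse (w - z) *\<^sub>C (f w - f z)) D (at z)"

definition analytic_into ::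
    "'a::complex_vector nspace \<Rightarrow> complex set \<Rightarrow> (complex \<Rightarrow> 'a) \<Rightarrow> bool" where
  "analytic_into X S f \<longleftrightarrow> f ` S \<subseteq> carr X \<and> (\<forall>z\<in>S. \<exists>D. has_deriv_into X f D z)"

definition deriv_into ::
    "'a::complex_vector nspace \<Rightarrow> (complex \<Rightarrow> 'a) \<Rightarrow> complex \<Rightarrow> 'a" where
  "deriv_into X f z = (THE D. has_deriv_into X f D z)"

section \<open>The Calderon space\<close>

definition strip :: "complex set" where
  "strip = {z. 0 \<le> Re z \<and> Re z \<le> 1}"

definition open_strip :: "complex set" where
  "open_strip = {z. 0 < Re z \<and> Re z < 1}"

definition boundary_condition ::
    "'a::complex_vector nspace \<Rightarrow> (real \<Rightarrow> 'a) \<Rightarrow> bool" where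
  "boundary_condition X f \<longleftrightarrow> continuous_on_into X UNIV f \<and> tendsto_nrm X f 0 at_infinity"

text \<open>Elements are functions on the closed strip, represented by their extension by zero to the
  whole plane.\<close>

definition calderon ::
    "'a::complex_vector nspace \<Rightarrow> 'a nspace \<Rightarrow> (complex \<Rightarrow> 'a) nspace" where
  "calderon X0 X1 =
     \<lparr>carr = {F. continuous_on_into (sum_space X0 X1) strip F \<and>
                 (\<exists>B. \<forall>z\<in>strip. nrm (sum_space X0 X1) (F z) \<le> B) \<and>
                 analytic_into (sum_space X0 X1) open_strip F \<and>
                 boundary_condition X0 (\<lambda>t. F (Complex 0 t)) \<and>
                 boundary_condition X1 (\<lambda>t. F (Complex 1 t)) \<and>
                 (\<forall>z. z \<notin> strip \<longrightarrow> F z = 0)},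
      nrm = (\<lambda>F. max (SUP t. nrm X0 (F (Complex 0 t))) (SUP t. nrm X1 (F (Complex 1 t))))\<rparr>"

abbreviation \<C> :: "(complex \<Rightarrow> nat \<Rightarrow> complex) nspace" where
  "\<C> \<equiv> calderon linfty lone"

definition \<Delta> :: "nat \<Rightarrow> (complex \<Rightarrow> nat \<Rightarrow> complex) \<Rightarrow> nat \<Rightarrow> complex" where
  "\<Delta> k F = (1 / fact k) *\<^sub>C (deriv_into (sum_space linfty lone) ^^ k) F (1/2)"

definition \<Delta>_pair :: "nat \<Rightarrow> nat \<Rightarrow> (complex \<Rightarrow> nat \<Rightarrow> complex) \<Rightarrow>
    (nat \<Rightarrow> complex) \<times> (nat \<Rightarrow> complex)" where
  "\<Delta>_pair a b F = (\<Delta> a F, \<Delta> b F)"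

definition ker_\<Delta> :: "nat \<Rightarrow> (complex \<Rightarrow> nat \<Rightarrow> complex) set" where
  "ker_\<Delta> k = {F \<in> carr \<C>. \<Delta> k F = 0}"

end

(*
  Since l_1 embeds contractively into l_infinity, the sum space is l_infinity isometrically, and Delta_k is a
  coordinatewise Taylor coefficient at 1/2.  For F, G in the Calderon space the scalar function
  h(z) = sum_n u_n F_n(z) G_n(1 - z) with unimodular u_n is bounded on the strip by the product of the norms,
  so its second Taylor coefficient gives an absolutely convergent bounded pairing
    <F, G> = sum_n (F_2 G_0 - F_1 G_1 + F_0 G_2)(n),  F_k = Delta_k F.
  Explicit functions built from exp(L_n w + w^2), w = z - 1/2, realise every square-summable sequence as a
  lowest nonvanishing coefficient.  Together with the pairing and the self-duality of the
  square-summable sequences this shows, one coefficient after the other, that every bounded functional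
  vanishing where F_0 = F_1 = F_2 = 0 is <., G> for some G.  Both isomorphisms follow: a functional on the image
  of a subspace K is pulled back to K, extended by Hahn-Banach and represented by some G, of which only
  the coefficients seen by K matter.  In (b), K is the kernel of Delta_2.  In (a), K is the common kernel of
  Delta_1 and Delta_2, and its image under Delta_0 is the Orlicz space.
*)
theory Submission
  imports Defs "HOL-Complex_Analysis.Complex_Analysis"
begin

text \<open>The reflection \<open>1 - z\<close> exchanges the edges of the strip, so on either edge
  one factor is summable and the other bounded, and Hoelder's inequality applies. The pairing is
  graded: if F starts at level j and G at level 2 - j, a single product survives. Bounding it and
  lifting l_2 sequences are therefore dual statements, which is why the leading coefficient is an
  l_2 sequence at every level. The frequency \<open>L_n\<close> is about \<open>2 ln |x_n|\<close>
  for a normalised sequence: it turns the modulus |x_n| on the middle line into about 1 on the left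
  edge and |x_n|^2 on the right edge. The same frequency creates the Orlicz function: the next two
  coefficients have size \<open>x_n L_n\<close> and \<open>x_n L_n^2\<close>, and cancelling them,
  as the common kernel of Delta_1 and Delta_2 demands, costs a factor log^2 |x_n|. Hence x log^2 |x|
  has to be square-summable. Two obstacles shape the details: the \<open>L_n\<close> are unbounded
  although boundary values must be norm continuous, and the Orlicz function is prescribed only near
  0.\<close>

section \<open>Seminormed spaces on a carrier\<close>

lemma scaleC_0_left [simp]: "0 *\<^sub>C (x :: 'a::complex_vector) = 0"
  using scaleC_add_left[of 0 0 x] by simp

lemma scaleC_0_right [simp]: "c *\<^sub>C (0 :: 'a::complex_vector) = 0"
  using scaleC_add_right[of c 0 "0 :: 'a"] by simp

lemma scaleC_minus1: "(-1) *\<^sub>C (x :: 'a::complex_vector) = - x"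
  using scaleC_add_left[of "-1" 1 x]
  by (simp add: scaleC_one eq_neg_iff_add_eq_0)

lemma scaleC_minus_right: "c *\<^sub>C (- x :: 'a::complex_vector) = - (c *\<^sub>C x)"
  using scaleC_add_right[of c "-x" x] by (simp add: eq_neg_iff_add_eq_0)

lemma scaleC_diff_right: "c *\<^sub>C (x - y :: 'a::complex_vector) = c *\<^sub>C x - c *\<^sub>C y"
  using scaleC_add_right[of c x "-y"] by (simp add: scaleC_minus_right)

lemma scaleC_fun_apply [simp]: "(c *\<^sub>C f) x = c *\<^sub>C f x"
  by (simp add: scaleC_fun_def)

lemma scaleC_complex [simp]: "c *\<^sub>C (x :: complex) = c * x"
  by (simp add: scaleC_complex_def)

definition csubspace :: "'a::complex_vector set \<Rightarrow> bool" where
  "csubspace V \<longleftrightarrow>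
     0 \<in> V \<and> (\<forall>x\<in>V. \<forall>y\<in>V. x + y \<in> V) \<and> (\<forall>c. \<forall>x\<in>V. c *\<^sub>C x \<in> V)"

lemma csubspace_diff: "csubspace V \<Longrightarrow> x \<in> V \<Longrightarrow> y \<in> V \<Longrightarrow> x - y \<in> V"
  unfolding csubspace_def by (metis scaleC_minus1 diff_conv_add_uminus)

text \<open>A seminorm and not a norm, because the Hahn-Banach argument also uses the rescaled
  functional \<open>N * nrm X x\<close>, where \<open>N\<close> may be 0.\<close>

definition seminormed :: "'a::complex_vector nspace \<Rightarrow> bool" where
  "seminormed X \<longleftrightarrow> csubspace (carr X) \<and>
     (\<forall>x\<in>carr X. \<forall>y\<in>carr X. nrm X (x + y) \<le> nrm X x + nrm X y) \<and>
     (\<forall>c. \<forall>x\<in>carr X. nrm X (c *\<^sub>C x) = cmod c * nrm X x)"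

lemma continuous_on_into_ev:
  "continuous_on_into X S f \<Longrightarrow> \<forall>\<^sub>F w in at z within S. f w \<in> carr X"
  unfolding continuous_on_into_def eventually_at_filter by (simp add: image_subset_iff)

lemma continuous_on_into_carr:
  "continuous_on_into X S f \<Longrightarrow> z \<in> S \<Longrightarrow> f z \<in> carr X"
  unfolding continuous_on_into_def by blast

context
  fixes X :: "'a::complex_vector nspace"
  assumes X: "seminormed X"
begin

lemma sn_zero: "0 \<in> carr X"
  and sn_add: "x \<in> carr X \<Longrightarrow> y \<in> carr X \<Longrightarrow> x + y \<in> carr X"
  and sn_scale: "x \<in> carr X \<Longrightarrow> c *\<^sub>C x \<in> carr X"
  and sn_diff: "x \<in> carr X \<Longrightarrow> y \<in> carr X \<Longrightarrow> x - y \<in> carr X"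
  and sn_tri: "x \<in> carr X \<Longrightarrow> y \<in> carr X \<Longrightarrow> nrm X (x + y) \<le> nrm X x + nrm X y"
  and sn_hom: "x \<in> carr X \<Longrightarrow> nrm X (c *\<^sub>C x) = cmod c * nrm X x"
  using X csubspace_diff unfolding seminormed_def csubspace_def by blast+

lemma sn_nrm_zero: "nrm X 0 = 0"
  using sn_hom[OF sn_zero, of 0] by simp

lemma sn_minus: "x \<in> carr X \<Longrightarrow> nrm X (- x) = nrm X x"
  using sn_hom[of x "-1"] by (simp add: scaleC_minus1)

lemma sn_uminus: "x \<in> carr X \<Longrightarrow> - x \<in> carr X"
  using sn_diff[OF sn_zero, of x] by simp

lemma sn_nonneg: "x \<in> carr X \<Longrightarrow> 0 \<le> nrm X x"
  using sn_tri[of x "-x"] sn_uminus[of x] sn_minus[of x] sn_nrm_zero by simp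

lemma sn_minus_commute: "x \<in> carr X \<Longrightarrow> y \<in> carr X \<Longrightarrow> nrm X (x - y) = nrm X (y - x)"
  using sn_minus[OF sn_diff, of x y] by simp

lemma sn_abs_diff:
  assumes "x \<in> carr X" "y \<in> carr X"
  shows "\<bar>nrm X x - nrm X y\<bar> \<le> nrm X (x - y)"
  using sn_tri[OF sn_diff, of x y y] sn_tri[OF sn_diff, of y x x] sn_minus_commute[of x y] assms
  by auto

section \<open>Limits, continuity and boundary conditions in a seminorm\<close>

lemma tendsto_nrm_add:
  assumes "tendsto_nrm X f l A" "tendsto_nrm X g m A"
    and "\<forall>\<^sub>F w in A. f w \<in> carr X" "\<forall>\<^sub>F w in A. g w \<in> carr X" "l \<in> carr X" "m \<in> carr X"
  shows "tendsto_nrm X (\<lambda>w. f w + g w) (l + m) A"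
  unfolding tendsto_nrm_def
proof (rule tendsto_sandwich)
  have *: "f w + g w - (l + m) = (f w - l) + (g w - m)" for w by (simp add: algebra_simps)
  show "\<forall>\<^sub>F w in A. 0 \<le> nrm X (f w + g w - (l + m))"
    using assms(3,4) by eventually_elim (intro sn_nonneg sn_diff sn_add assms)
  show "\<forall>\<^sub>F w in A. nrm X (f w + g w - (l + m)) \<le> nrm X (f w - l) + nrm X (g w - m)"
    using assms(3,4) unfolding * by eventually_elim (intro sn_tri sn_diff assms)
  show "((\<lambda>w. nrm X (f w - l) + nrm X (g w - m)) \<longlongrightarrow> 0) A"
    using tendsto_add[OF assms(1,2)[unfolded tendsto_nrm_def]] by simp
qed simp

lemma tendsto_nrm_scale:
  assumes "tendsto_nrm X f l A" and "\<forall>\<^sub>F w in A. f w \<in> carr X" "l \<in> carr X"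
  shows "tendsto_nrm X (\<lambda>w. c *\<^sub>C f w) (c *\<^sub>C l) A"
proof -
  have "\<forall>\<^sub>F w in A. cmod c * nrm X (f w - l) = nrm X (c *\<^sub>C f w - c *\<^sub>C l)"
    using assms(2)
  proof eventually_elim
    case (elim w)
    then show ?case using sn_hom[OF sn_diff, of "f w" l c] assms(3) by (simp add: scaleC_diff_right)
  qed
  moreover have "((\<lambda>w. cmod c * nrm X (f w - l)) \<longlongrightarrow> 0) A"
    using tendsto_mult_left[OF assms(1)[unfolded tendsto_nrm_def], of "cmod c"] by simp
  ultimately show ?thesis
    unfolding tendsto_nrm_def by (rule Lim_transform_eventually[rotated])
qed

lemma continuous_on_into_add:
  assumes "continuous_on_into X S f" "continuous_on_into X S g"
  shows "continuous_on_into X S (\<lambda>w. f w + g w)"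
proof -
  have "tendsto_nrm X (\<lambda>w. f w + g w) (f z + g z) (at z within S)" if "z \<in> S" for z
    using assms that
    by (intro tendsto_nrm_add continuous_on_into_ev continuous_on_into_carr[of _ S])
      (auto simp: continuous_on_into_def)
  then show ?thesis
    using assms sn_add unfolding continuous_on_into_def by (auto simp: image_subset_iff)
qed

lemma continuous_on_into_scale:
  assumes "continuous_on_into X S f"
  shows "continuous_on_into X S (\<lambda>w. c *\<^sub>C f w)"
proof -
  have "tendsto_nrm X (\<lambda>w. c *\<^sub>C f w) (c *\<^sub>C f z) (at z within S)" if "z \<in> S" for z
    using assms that
    by (intro tendsto_nrm_scale continuous_on_into_ev continuous_on_into_carr[of _ S])
      (auto simp: continuous_on_into_def)
  then show ?thesis
    using assms sn_scale unfolding continuous_on_into_def by (auto simp: image_subset_iff)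
qed

lemma boundary_condition_add:
  assumes "boundary_condition X f" "boundary_condition X g"
  shows "boundary_condition X (\<lambda>t. f t + g t)"
  using tendsto_nrm_add[of f 0 at_infinity g 0] sn_zero continuous_on_into_add[of UNIV f g] assms
  by (auto simp: boundary_condition_def continuous_on_into_def image_subset_iff)

lemma boundary_condition_scale:
  assumes "boundary_condition X f"
  shows "boundary_condition X (\<lambda>t. c *\<^sub>C f t)"
  using tendsto_nrm_scale[of f 0 at_infinity c] sn_zero continuous_on_into_scale[of UNIV f c] assms
  by (auto simp: boundary_condition_def continuous_on_into_def image_subset_iff)

text \<open>The norm of a boundary function is continuous and tends to 0 at infinity, so it is
  bounded on a compact interval and below 1 outside. The suprema in the norm of
  \<open>calderon\<close> are thereby genuine upper bounds and not an unspecified value of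
  \<open>Sup\<close> on an unbounded set.\<close>

lemma boundary_condition_bdd:
  assumes "boundary_condition X f"
  shows "bdd_above (range (\<lambda>t. nrm X (f t)))"
proof -
  have c: "f t \<in> carr X" for t
    using assms by (auto simp: boundary_condition_def continuous_on_into_def)
  have "((\<lambda>w. nrm X (f w)) \<longlongrightarrow> nrm X (f z)) (at z)" for z
  proof (rule LIM_zero_cancel, rule Lim_null_comparison)
    show "\<forall>\<^sub>F w in at z. norm (nrm X (f w) - nrm X (f z)) \<le> nrm X (f w - f z)"
      by (simp add: sn_abs_diff c)
    show "((\<lambda>w. nrm X (f w - f z)) \<longlongrightarrow> 0) (at z)"
      using assms by (auto simp: boundary_condition_def continuous_on_into_def tendsto_nrm_def)
  qed
  then have cont: "continuous_on UNIV (\<lambda>w. nrm X (f w))"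
    by (simp add: continuous_on_def)
  have "\<forall>\<^sub>F t in at_infinity. nrm X (f t) < 1"
    using assms order_tendstoD(2)[of "\<lambda>t. nrm X (f t)" 0 at_infinity 1]
    by (simp add: boundary_condition_def tendsto_nrm_def)
  then obtain b where b: "\<And>t. b \<le> norm t \<Longrightarrow> nrm X (f t) < 1"
    by (auto simp: eventually_at_infinity)
  have "compact ((\<lambda>w. nrm X (f w)) ` {-\<bar>b\<bar>..\<bar>b\<bar>})"
    by (intro compact_continuous_image continuous_on_subset[OF cont]) auto
  then obtain B where B: "\<And>t. t \<in> {-\<bar>b\<bar>..\<bar>b\<bar>} \<Longrightarrow> nrm X (f t) \<le> B"
    using compact_imp_bounded bounded_imp_bdd_above unfolding bdd_above_def by (metis imageI)
  have "nrm X (f t) \<le> max B 1" for t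
  proof (cases "b \<le> norm t")
    case True
    then show ?thesis using b[of t] by auto
  next
    case False
    then have "t \<in> {-\<bar>b\<bar>..\<bar>b\<bar>}" by auto
    then show ?thesis using B[of t] by auto
  qed
  then show ?thesis by (auto simp: bdd_above_def)
qed

end

section \<open>The couple of bounded and summable sequences\<close>

lemma carr_linfty: "x \<in> carr linfty \<longleftrightarrow> (\<exists>B. \<forall>n. cmod (x n) \<le> B)"
  by (auto simp: linfty_def bounded_iff)

lemma nrm_linfty_upper: "x \<in> carr linfty \<Longrightarrow> cmod (x n) \<le> nrm linfty x"
  unfolding linfty_def by (auto intro!: cSUP_upper bdd_aboveI simp: bounded_iff)

lemma nrm_linfty_least: "(\<And>n. cmod (x n) \<le> B) \<Longrightarrow> nrm linfty x \<le> B"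
  unfolding linfty_def by (auto intro!: cSUP_least)

lemma seminormed_linfty: "seminormed linfty"
  unfolding seminormed_def csubspace_def
proof (intro conjI ballI allI)
  show "0 \<in> carr linfty" by (auto simp: carr_linfty intro!: exI[of _ 0])
next
  fix x y assume xy: "x \<in> carr linfty" "y \<in> carr linfty"
  have *: "cmod ((x + y) n) \<le> nrm linfty x + nrm linfty y" for n
    using xy[THEN nrm_linfty_upper, of n] norm_triangle_ineq[of "x n" "y n"] by simp
  show "x + y \<in> carr linfty" using * by (auto simp: carr_linfty)
  show "nrm linfty (x + y) \<le> nrm linfty x + nrm linfty y"
    using * by (rule nrm_linfty_least)
next
  fix c x assume x: "x \<in> carr linfty"
  have *: "cmod ((c *\<^sub>C x) n) \<le> cmod c * nrm linfty x" for n c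
    using x nrm_linfty_upper[of x n] by (simp add: norm_mult mult_left_mono)
  show cx: "c *\<^sub>C x \<in> carr linfty" using * by (auto simp: carr_linfty)
  show "nrm linfty (c *\<^sub>C x) = cmod c * nrm linfty x"
  proof (rule antisym)
    show "nrm linfty (c *\<^sub>C x) \<le> cmod c * nrm linfty x"
      using * by (rule nrm_linfty_least)
    show "cmod c * nrm linfty x \<le> nrm linfty (c *\<^sub>C x)"
    proof (cases "c = 0")
      case True
      then show ?thesis by (simp add: linfty_def)
    next
      case False
      have "nrm linfty x \<le> nrm linfty (c *\<^sub>C x) / cmod c"
      proof (rule nrm_linfty_least)
        show "cmod (x n) \<le> nrm linfty (c *\<^sub>C x) / cmod c" for n
          using nrm_linfty_upper[OF cx, of n] False by (simp add: norm_mult field_simps)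
      qed
      then show ?thesis using False by (simp add: field_simps)
    qed
  qed
qed

lemma carr_lone: "x \<in> carr lone \<longleftrightarrow> summable (\<lambda>n. cmod (x n))"
  by (simp add: lone_def)

lemma nrm_lone: "nrm lone x = (\<Sum>n. cmod (x n))"
  by (simp add: lone_def)

lemma seminormed_lone: "seminormed lone"
  unfolding seminormed_def csubspace_def
proof (intro conjI ballI allI)
  show "0 \<in> carr lone" by (simp add: carr_lone)
next
  fix x y assume "x \<in> carr lone" "y \<in> carr lone"
  then have s: "summable (\<lambda>n. cmod (x n) + cmod (y n))"
    "(\<Sum>n. cmod (x n)) + (\<Sum>n. cmod (y n)) = (\<Sum>n. cmod (x n) + cmod (y n))"
    by (auto simp: carr_lone intro: summable_add suminf_add)
  show *: "x + y \<in> carr lone"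
    unfolding carr_lone by (rule summable_comparison_test'[OF s(1)]) (simp add: norm_triangle_ineq)
  show "nrm lone (x + y) \<le> nrm lone x + nrm lone y"
    unfolding nrm_lone s(2) using * s(1)
    by (intro suminf_le) (simp_all add: norm_triangle_ineq carr_lone)
next
  fix c x assume x: "x \<in> carr lone"
  show "c *\<^sub>C x \<in> carr lone"
    using x summable_mult[of _ "cmod c"] by (simp add: carr_lone norm_mult)
  show "nrm lone (c *\<^sub>C x) = cmod c * nrm lone x"
    using x by (simp add: carr_lone nrm_lone norm_mult suminf_mult)
qed

lemma lone_cmod_le: "x \<in> carr lone \<Longrightarrow> cmod (x n) \<le> nrm lone x"
  using sum_le_suminf[of "\<lambda>n. cmod (x n)" "{n}"] by (simp add: carr_lone nrm_lone)

lemma lone_sum_le: "x \<in> carr lone \<Longrightarrow> finite A \<Longrightarrow> (\<Sum>n\<in>A. cmod (x n)) \<le> nrm lone x"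
  using sum_le_suminf[of "\<lambda>n. cmod (x n)" A] by (simp add: carr_lone nrm_lone)

lemma lone_subset_linfty: "x \<in> carr lone \<Longrightarrow> x \<in> carr linfty"
  using lone_cmod_le by (auto simp: carr_linfty)

abbreviation \<Sigma> :: "(nat \<Rightarrow> complex) nspace" where
  "\<Sigma> \<equiv> sum_space linfty lone"

lemma carr_\<Sigma>: "carr \<Sigma> = carr linfty"
proof -
  have "x + y \<in> carr linfty" if "x \<in> carr linfty" "y \<in> carr lone" for x y
    using that sn_add[OF seminormed_linfty] lone_subset_linfty by blast
  moreover have "\<exists>u v. x = u + v \<and> u \<in> carr linfty \<and> v \<in> carr lone" if "x \<in> carr linfty" for x
    by (rule exI[of _ x], rule exI[of _ 0]) (simp add: that sn_zero[OF seminormed_lone])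
  ultimately show ?thesis
    unfolding sum_space_def by auto
qed

lemma nrm_\<Sigma>:
  assumes "x \<in> carr linfty"
  shows "nrm \<Sigma> x = nrm linfty x"
proof -
  let ?S = "{nrm linfty u + nrm lone v | u v. u \<in> carr linfty \<and> v \<in> carr lone \<and> x = u + v}"
  have "Inf ?S = nrm linfty x"
  proof (rule cInf_eq_minimum)
    show "nrm linfty x \<in> ?S"
      by (rule CollectI, rule exI[of _ x], rule exI[of _ 0])
        (simp add: assms sn_zero[OF seminormed_lone] sn_nrm_zero[OF seminormed_lone])
    fix r assume "r \<in> ?S"
    then obtain u v where uv: "r = nrm linfty u + nrm lone v" "u \<in> carr linfty" "v \<in> carr lone"
      "x = u + v" by auto
    have "nrm linfty x \<le> nrm linfty u + nrm linfty v"
      using uv sn_tri[OF seminormed_linfty] lone_subset_linfty by auto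
    also have "nrm linfty v \<le> nrm lone v"
      using uv by (intro nrm_linfty_least lone_cmod_le)
    finally show "nrm linfty x \<le> r" using uv by simp
  qed
  then show ?thesis by (simp add: sum_space_def)
qed

lemma seminormed_\<Sigma>: "seminormed \<Sigma>"
  using seminormed_linfty unfolding seminormed_def csubspace_def
  by (simp add: carr_\<Sigma> nrm_\<Sigma>)

lemma nrm_\<Sigma>_upper: "x \<in> carr \<Sigma> \<Longrightarrow> cmod (x n) \<le> nrm \<Sigma> x"
  using nrm_linfty_upper by (simp add: carr_\<Sigma> nrm_\<Sigma>)

lemma nrm_\<Sigma>_least:
  assumes "\<And>n. cmod (x n) \<le> B"
  shows "x \<in> carr \<Sigma> \<and> nrm \<Sigma> x \<le> B"
proof -
  have "x \<in> carr linfty" using assms by (auto simp: carr_linfty)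
  then show ?thesis using nrm_linfty_least[of x B] assms by (simp add: carr_\<Sigma> nrm_\<Sigma>)
qed

lemma tendsto_\<Sigma>_coord:
  assumes "tendsto_nrm \<Sigma> f l A" "\<forall>\<^sub>F w in A. f w \<in> carr \<Sigma>" "l \<in> carr \<Sigma>"
  shows "((\<lambda>w. f w n) \<longlongrightarrow> l n) A"
proof (rule Lim_null_comparison[THEN Lim_null[THEN iffD2]])
  show "((\<lambda>w. nrm \<Sigma> (f w - l)) \<longlongrightarrow> 0) A" using assms(1) by (simp add: tendsto_nrm_def)
  show "\<forall>\<^sub>F w in A. cmod (f w n - l n) \<le> nrm \<Sigma> (f w - l)"
    using assms(2)
  proof eventually_elim
    case (elim w)
    then show ?case
      using nrm_\<Sigma>_upper[OF sn_diff[OF seminormed_\<Sigma>], of "f w" l n] assms(3) by simp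
  qed
qed

lemma tendsto_\<Sigma>I:
  assumes "(b \<longlongrightarrow> 0) A" "\<forall>\<^sub>F w in A. \<forall>n. cmod (f w n - l n) \<le> b w"
  shows "tendsto_nrm \<Sigma> f l A"
  unfolding tendsto_nrm_def
proof (rule tendsto_sandwich[OF _ _ tendsto_const assms(1)])
  have *: "\<forall>\<^sub>F w in A. f w - l \<in> carr \<Sigma> \<and> nrm \<Sigma> (f w - l) \<le> b w"
    using assms(2) by eventually_elim (rule nrm_\<Sigma>_least, simp)
  then show "\<forall>\<^sub>F w in A. nrm \<Sigma> (f w - l) \<le> b w" by eventually_elim simp
  show "\<forall>\<^sub>F w in A. 0 \<le> nrm \<Sigma> (f w - l)"
    using * by eventually_elim (simp add: sn_nonneg[OF seminormed_\<Sigma>])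
qed

section \<open>Analytic functions with values in the sum space\<close>

lemma has_deriv_into_coord:
  assumes "has_deriv_into \<Sigma> f D z" "\<forall>\<^sub>F w in at z. f w \<in> carr \<Sigma>" "f z \<in> carr \<Sigma>"
  shows "((\<lambda>w. f w n) has_field_derivative D n) (at z)"
proof -
  have "\<forall>\<^sub>F w in at z. inverse (w - z) *\<^sub>C (f w - f z) \<in> carr \<Sigma>"
    using assms(2)
    by eventually_elim (intro sn_scale[OF seminormed_\<Sigma>] sn_diff[OF seminormed_\<Sigma>] assms(3))
  then have "((\<lambda>w. (inverse (w - z) *\<^sub>C (f w - f z)) n) \<longlongrightarrow> D n) (at z)"
    using assms(1) unfolding has_deriv_into_def by (intro tendsto_\<Sigma>_coord) blast+
  then show ?thesis
    by (simp add: has_field_derivative_iff divide_inverse mult.commute)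
qed

lemma has_deriv_into_unique:
  assumes "has_deriv_into \<Sigma> f D z" "has_deriv_into \<Sigma> f E z"
    and "\<forall>\<^sub>F w in at z. f w \<in> carr \<Sigma>" "f z \<in> carr \<Sigma>"
  shows "D = E"
  using has_deriv_into_coord[OF assms(1,3,4)] has_deriv_into_coord[OF assms(2,3,4)]
  by (auto simp: fun_eq_iff intro: DERIV_unique)

lemma cmod_higher_deriv_le:
  assumes "f holomorphic_on ball z r" "\<And>w. w \<in> ball z r \<Longrightarrow> cmod (f w) \<le> B" "0 < s" "s < r"
  shows "cmod ((deriv ^^ k) f z) \<le> fact k * B / s ^ k"
proof (rule Cauchy_inequality)
  show "f holomorphic_on ball z s" using assms by (auto intro: holomorphic_on_subset)
  show "continuous_on (cball z s) f"
    using assms by (auto intro: holomorphic_on_imp_continuous_on[THEN continuous_on_subset])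
  show "cmod (f x) \<le> B" if "cmod (z - x) = s" for x
    using that assms by (intro assms(2)) (simp add: dist_norm)
qed fact

text \<open>The estimate depends on \<open>f\<close> only through \<open>B\<close>, so it is uniform
  over a whole family of coordinates; this turns coordinatewise derivatives into norm derivatives.
  It is the first-order Taylor remainder, with the second derivative bounded by Cauchy's inequality
  on a circle of radius \<open>r/4\<close>, whence \<open>2 * 16 = 32\<close>.\<close>

lemma difference_quotient_bound:
  assumes hol: "f holomorphic_on ball z r" and B: "\<And>w. w \<in> ball z r \<Longrightarrow> cmod (f w) \<le> B"
    and r: "0 < r" and w: "w \<in> ball z (r/2)" "w \<noteq> z"
  shows "cmod (inverse (w - z) * (f w - f z) - deriv f z) \<le> 32 * B / r\<^sup>2 * cmod (w - z)"
proof -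
  have d2: "cmod ((deriv ^^ 2) f x) \<le> 32 * B / r\<^sup>2" if "x \<in> ball z (r/2)" for x
  proof -
    have sub: "ball x (r/2) \<subseteq> ball z r"
    proof
      fix y assume "y \<in> ball x (r/2)"
      then show "y \<in> ball z r"
        using that dist_triangle[of z y x] by (simp add: dist_commute)
    qed
    have "cmod ((deriv ^^ 2) f x) \<le> fact 2 * B / (r/4)^2"
      by (rule cmod_higher_deriv_le[where r = "r/2"])
        (use sub r B in \<open>auto intro: holomorphic_on_subset[OF hol]\<close>)
    then show ?thesis using r by (simp add: power_divide field_simps)
  qed
  have "cmod ((deriv ^^ 0) f w - (\<Sum>i\<le>1. (deriv ^^ i) f z * (w - z) ^ i / fact i))
      \<le> 32 * B / r\<^sup>2 * cmod (w - z) ^ Suc 1 / fact 1"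
  proof (rule complex_Taylor[where S = "ball z (r/2)"])
    fix i x assume x: "x \<in> ball z (r/2)"
    then have x': "x \<in> ball z r" using r by simp
    have "((deriv ^^ i) f) holomorphic_on ball z r"
      by (rule holomorphic_higher_deriv[OF hol]) simp
    then have "((deriv ^^ i) f has_field_derivative deriv ((deriv ^^ i) f) x) (at x)"
      using x' by (intro holomorphic_derivI[where S = "ball z r"]) auto
    then show "((deriv ^^ i) f has_field_derivative (deriv ^^ Suc i) f x) (at x within ball z (r/2))"
      by (simp add: has_field_derivative_at_within)
  next
    show "cmod ((deriv ^^ Suc 1) f x) \<le> 32 * B / r\<^sup>2" if "x \<in> ball z (r/2)" for x
      using d2[OF that] by (simp add: numeral_2_eq_2)
  qed (use r w in auto)
  then have *: "cmod (f w - (f z + deriv f z * (w - z))) \<le> 32 * B / r\<^sup>2 * (cmod (w - z))\<^sup>2"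
    by (simp add: power2_eq_square)
  have "inverse (w - z) * (f w - f z) - deriv f z = inverse (w - z) * (f w - (f z + deriv f z * (w - z)))"
    using w(2) by (simp add: field_simps)
  then have "cmod (inverse (w - z) * (f w - f z) - deriv f z) =
      inverse (cmod (w - z)) * cmod (f w - (f z + deriv f z * (w - z)))"
    by (simp only: norm_mult norm_inverse)
  also have "\<dots> \<le> inverse (cmod (w - z)) * (32 * B / r\<^sup>2 * (cmod (w - z))\<^sup>2)"
    using * by (intro mult_left_mono) auto
  also have "\<dots> = 32 * B / r\<^sup>2 * cmod (w - z)"
    using w(2) by (simp add: power2_eq_square field_simps)
  finally show ?thesis .
qed

text \<open>A uniform bound on the coordinates upgrades coordinatewise differentiability to
  differentiability in the supremum norm.\<close>

lemma has_deriv_intoI: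
  assumes hol: "\<And>n. (\<lambda>w. f w n) holomorphic_on ball z r"
    and B: "\<And>w n. w \<in> ball z r \<Longrightarrow> cmod (f w n) \<le> B" and r: "0 < r"
  shows "has_deriv_into \<Sigma> f (\<lambda>n. deriv (\<lambda>w. f w n) z) z"
  unfolding has_deriv_into_def
proof
  have "cmod ((deriv ^^ 1) (\<lambda>w. f w n) z) \<le> fact 1 * B / (r/2) ^ 1" for n
    using B r by (intro cmod_higher_deriv_le[OF hol]) auto
  then show "(\<lambda>n. deriv (\<lambda>w. f w n) z) \<in> carr \<Sigma>"
    by (intro nrm_\<Sigma>_least[THEN conjunct1]) simp
  show "tendsto_nrm \<Sigma> (\<lambda>w. inverse (w - z) *\<^sub>C (f w - f z)) (\<lambda>n. deriv (\<lambda>w. f w n) z) (at z)"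
  proof (rule tendsto_\<Sigma>I)
    show "((\<lambda>w. 32 * B / r\<^sup>2 * cmod (w - z)) \<longlongrightarrow> 0) (at z)"
      by (intro tendsto_mult_right_zero tendsto_norm_zero LIM_zero tendsto_ident_at)
    have "\<forall>\<^sub>F w in at z. w \<in> ball z (r/2) - {z}"
      using r by (intro eventually_at_in_open) auto
    then show "\<forall>\<^sub>F w in at z. \<forall>n. cmod ((inverse (w - z) *\<^sub>C (f w - f z)) n - deriv (\<lambda>w. f w n) z)
        \<le> 32 * B / r\<^sup>2 * cmod (w - z)"
      by eventually_elim (use difference_quotient_bound[OF hol B r] in auto)
  qed
qed

lemma deriv_into_\<Sigma>:
  assumes "\<And>n. (\<lambda>w. f w n) holomorphic_on ball z r"
    and "\<And>w n. w \<in> ball z r \<Longrightarrow> cmod (f w n) \<le> B" and r: "0 < r"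
  shows "deriv_into \<Sigma> f z = (\<lambda>n. deriv (\<lambda>w. f w n) z)"
  unfolding deriv_into_def
proof (rule the_equality)
  have c: "f w \<in> carr \<Sigma>" if "w \<in> ball z r" for w
    using nrm_\<Sigma>_least[of "f w" B] assms(2)[OF that] by blast
  have ev: "\<forall>\<^sub>F w in at z. f w \<in> carr \<Sigma>"
    using eventually_at_in_open[of "ball z r" z] r by (auto elim!: eventually_mono intro: c)
  show *: "has_deriv_into \<Sigma> f (\<lambda>n. deriv (\<lambda>w. f w n) z) z"
    by (rule has_deriv_intoI[OF assms])
  show "D = (\<lambda>n. deriv (\<lambda>w. f w n) z)" if "has_deriv_into \<Sigma> f D z" for D
    using has_deriv_into_unique[OF that * ev] c r by simp
qed

lemma open_open_strip: "open open_strip"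
  unfolding open_strip_def
  by (intro open_Collect_conj open_Collect_less continuous_intros)

lemma open_strip_subset: "open_strip \<subseteq> strip"
  by (auto simp: open_strip_def strip_def)

lemma half_ball: "ball (1/2) (1/2) \<subseteq> open_strip"
proof
  fix w :: complex assume "w \<in> ball (1/2) (1/2)"
  then have "\<bar>Re (1/2 - w)\<bar> < 1/2"
    using abs_Re_le_cmod[of "1/2 - w"] unfolding mem_ball dist_norm by linarith
  then have "\<bar>1/2 - Re w\<bar> < 1/2" by simp
  then have "0 < Re w \<and> Re w < 1" by linarith
  then show "w \<in> open_strip" by (simp add: open_strip_def)
qed

text \<open>Under a uniform bound, norm differentiability is the same as analyticity of each
  coordinate. From here on scalar complex analysis suffices.\<close>

lemma analytic_into_\<Sigma>_iff:
  assumes B: "\<And>z n. z \<in> open_strip \<Longrightarrow> cmod (F z n) \<le> B"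
  shows "analytic_into \<Sigma> open_strip F \<longleftrightarrow> (\<forall>n. (\<lambda>z. F z n) holomorphic_on open_strip)"
proof
  assume *: "analytic_into \<Sigma> open_strip F"
  show "\<forall>n. (\<lambda>z. F z n) holomorphic_on open_strip"
  proof
    fix n
    have "\<exists>D. ((\<lambda>z. F z n) has_field_derivative D) (at z within open_strip)"
      if z: "z \<in> open_strip" for z
    proof -
      obtain D where D: "has_deriv_into \<Sigma> F D z" using * z by (auto simp: analytic_into_def)
      have "\<forall>\<^sub>F w in at z. F w \<in> carr \<Sigma>"
        using eventually_at_in_open[OF open_open_strip z] *
        by (auto elim!: eventually_mono simp: analytic_into_def)
      then show ?thesis
        using has_deriv_into_coord[OF D] * z has_field_derivative_at_within
        by (auto simp: analytic_into_def) blast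
    qed
    then show "(\<lambda>z. F z n) holomorphic_on open_strip"
      unfolding holomorphic_on_def field_differentiable_def by blast
  qed
next
  assume hol: "\<forall>n. (\<lambda>z. F z n) holomorphic_on open_strip"
  have "\<exists>D. has_deriv_into \<Sigma> F D z" if z: "z \<in> open_strip" for z
  proof -
    obtain r where "r > 0" "ball z r \<subseteq> open_strip"
      using openE[OF open_open_strip z] by blast
    then show ?thesis
      using hol B by - (rule exI, rule has_deriv_intoI[where r = r and B = B],
        auto intro: holomorphic_on_subset)
  qed
  then show "analytic_into \<Sigma> open_strip F"
    unfolding analytic_into_def using nrm_\<Sigma>_least[of _ B] B by (auto simp: image_subset_iff)
qed

section \<open>The Calderon space as a seminormed space\<close>

lemma cal_cont_into: "F \<in> carr \<C> \<Longrightarrow> continuous_on_into \<Sigma> strip F"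
  and cal_analytic: "F \<in> carr \<C> \<Longrightarrow> analytic_into \<Sigma> open_strip F"
  and cal_bc0: "F \<in> carr \<C> \<Longrightarrow> boundary_condition linfty (\<lambda>t. F (Complex 0 t))"
  and cal_bc1: "F \<in> carr \<C> \<Longrightarrow> boundary_condition lone (\<lambda>t. F (Complex 1 t))"
  and cal_outside: "F \<in> carr \<C> \<Longrightarrow> z \<notin> strip \<Longrightarrow> F z = 0"
  by (simp_all add: calderon_def)

lemma cal_bdd:
  assumes "F \<in> carr \<C>"
  obtains B where "\<And>z n. cmod (F z n) \<le> B"
proof -
  obtain B where B: "\<And>z. z \<in> strip \<Longrightarrow> nrm \<Sigma> (F z) \<le> B"
    using assms by (auto simp: calderon_def)
  have "cmod (F z n) \<le> max B 0" for z n
  proof (cases "z \<in> strip")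
    case True
    then have "cmod (F z n) \<le> nrm \<Sigma> (F z)"
      using cal_cont_into[OF assms] by (intro nrm_\<Sigma>_upper continuous_on_into_carr[of _ strip])
    then show ?thesis using B[OF True] by simp
  qed (simp add: cal_outside[OF assms])
  then show ?thesis using that by blast
qed

lemma cal_hol:
  assumes "F \<in> carr \<C>"
  shows "(\<lambda>z. F z n) holomorphic_on open_strip"
proof -
  obtain B where "\<And>z n. cmod (F z n) \<le> B" using cal_bdd[OF assms] by blast
  then show ?thesis using analytic_into_\<Sigma>_iff[of F B] cal_analytic[OF assms] by blast
qed

lemma cal_cont:
  assumes "F \<in> carr \<C>"
  shows "continuous_on strip (\<lambda>z. F z n)"
  unfolding continuous_on_def
proof
  fix z assume "z \<in> strip"
  then show "((\<lambda>z. F z n) \<longlongrightarrow> F z n) (at z within strip)"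
    using cal_cont_into[OF assms]
    by (intro tendsto_\<Sigma>_coord continuous_on_into_ev continuous_on_into_carr[of _ strip])
      (auto simp: continuous_on_into_def)
qed

lemma calderonI:
  assumes "continuous_on_into \<Sigma> strip F" "\<And>z n. z \<in> strip \<Longrightarrow> cmod (F z n) \<le> B"
    and "\<And>n. (\<lambda>z. F z n) holomorphic_on open_strip"
    and "boundary_condition linfty (\<lambda>t. F (Complex 0 t))"
    and "boundary_condition lone (\<lambda>t. F (Complex 1 t))"
    and "\<And>z. z \<notin> strip \<Longrightarrow> F z = 0"
  shows "F \<in> carr \<C>"
proof -
  have "analytic_into \<Sigma> open_strip F"
    using analytic_into_\<Sigma>_iff[of F B] assms(2,3) open_strip_subset by blast
  moreover have "\<forall>z\<in>strip. nrm \<Sigma> (F z) \<le> B"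
    using nrm_\<Sigma>_least assms(2) by blast
  ultimately show ?thesis
    using assms by (auto simp: calderon_def)
qed

lemma nrm_cal:
  "nrm \<C> F = max (SUP t. nrm linfty (F (Complex 0 t))) (SUP t. nrm lone (F (Complex 1 t)))"
  by (simp add: calderon_def)

lemma nrm_cal_le:
  assumes "\<And>t. nrm linfty (F (Complex 0 t)) \<le> B" "\<And>t. nrm lone (F (Complex 1 t)) \<le> B"
  shows "nrm \<C> F \<le> B"
  unfolding nrm_cal using assms by (auto intro!: cSUP_least)

lemma nrm_cal_ge0:
  assumes "F \<in> carr \<C>"
  shows "nrm linfty (F (Complex 0 t)) \<le> nrm \<C> F"
  using cSUP_upper[OF _ boundary_condition_bdd[OF seminormed_linfty cal_bc0[OF assms]], of t]
  by (simp add: nrm_cal)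

lemma nrm_cal_ge1:
  assumes "F \<in> carr \<C>"
  shows "nrm lone (F (Complex 1 t)) \<le> nrm \<C> F"
  using cSUP_upper[OF _ boundary_condition_bdd[OF seminormed_lone cal_bc1[OF assms]], of t]
  by (simp add: nrm_cal)

lemma bc_carr: "boundary_condition X f \<Longrightarrow> f t \<in> carr X"
  by (auto simp: boundary_condition_def continuous_on_into_def)

lemma cal_add:
  assumes F: "F \<in> carr \<C>" and G: "G \<in> carr \<C>"
  shows "F + G \<in> carr \<C>"
proof -
  obtain B C where B: "\<And>z n. cmod (F z n) \<le> B" and C: "\<And>z n. cmod (G z n) \<le> C"
    using cal_bdd[OF F] cal_bdd[OF G] by metis
  show ?thesis
  proof (rule calderonI)
    show "cmod ((F + G) z n) \<le> B + C" for z n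
      using norm_triangle_ineq[of "F z n" "G z n"] B[of z n] C[of z n] by simp
    show "(\<lambda>z. (F + G) z n) holomorphic_on open_strip" for n
      using holomorphic_on_add[OF cal_hol[OF F] cal_hol[OF G]] by simp
    show "continuous_on_into \<Sigma> strip (F + G)"
      using continuous_on_into_add[OF seminormed_\<Sigma> cal_cont_into[OF F] cal_cont_into[OF G]]
      by (simp add: plus_fun_def)
    show "boundary_condition linfty (\<lambda>t. (F + G) (Complex 0 t))"
      using boundary_condition_add[OF seminormed_linfty cal_bc0[OF F] cal_bc0[OF G]] by simp
    show "boundary_condition lone (\<lambda>t. (F + G) (Complex 1 t))"
      using boundary_condition_add[OF seminormed_lone cal_bc1[OF F] cal_bc1[OF G]] by simp
    show "(F + G) z = 0" if "z \<notin> strip" for z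
      using that by (simp add: cal_outside[OF F] cal_outside[OF G])
  qed
qed

lemma cal_scale:
  assumes F: "F \<in> carr \<C>"
  shows "c *\<^sub>C F \<in> carr \<C>"
proof -
  obtain B where B: "\<And>z n. cmod (F z n) \<le> B"
    using cal_bdd[OF F] by metis
  show ?thesis
  proof (rule calderonI)
    show "cmod ((c *\<^sub>C F) z n) \<le> cmod c * B" for z n
      using B[of z n] by (simp add: norm_mult mult_left_mono)
    show "(\<lambda>z. (c *\<^sub>C F) z n) holomorphic_on open_strip" for n
      using holomorphic_on_mult[OF holomorphic_on_const cal_hol[OF F]] by simp
    show "continuous_on_into \<Sigma> strip (c *\<^sub>C F)"
      using continuous_on_into_scale[OF seminormed_\<Sigma> cal_cont_into[OF F]]
      by (simp add: scaleC_fun_def)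
    show "boundary_condition linfty (\<lambda>t. (c *\<^sub>C F) (Complex 0 t))"
      using boundary_condition_scale[OF seminormed_linfty cal_bc0[OF F]] by simp
    show "boundary_condition lone (\<lambda>t. (c *\<^sub>C F) (Complex 1 t))"
      using boundary_condition_scale[OF seminormed_lone cal_bc1[OF F]] by simp
    show "(c *\<^sub>C F) z = 0" if "z \<notin> strip" for z
      using that by (simp add: cal_outside[OF F])
  qed
qed

lemma cal_zero: "0 \<in> carr \<C>"
proof (rule calderonI[where B = 0])
  have "tendsto_nrm X (\<lambda>x. 0) 0 A" if "seminormed X" for X :: "(nat \<Rightarrow> complex) nspace" and A :: "'b filter"
    using sn_nrm_zero[OF that] by (simp add: tendsto_nrm_def)
  note * = this[OF seminormed_linfty] this[OF seminormed_lone] this[OF seminormed_\<Sigma>]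
    sn_zero[OF seminormed_linfty] sn_zero[OF seminormed_lone] sn_zero[OF seminormed_\<Sigma>]
  show "continuous_on_into \<Sigma> strip 0"
    "boundary_condition linfty (\<lambda>t. 0 (Complex 0 t))"
    "boundary_condition lone (\<lambda>t. 0 (Complex 1 t))"
    using * by (auto simp: continuous_on_into_def boundary_condition_def zero_fun_def)
qed auto

lemma nrm_cal_add:
  assumes F: "F \<in> carr \<C>" and G: "G \<in> carr \<C>"
  shows "nrm \<C> (F + G) \<le> nrm \<C> F + nrm \<C> G"
proof (rule nrm_cal_le)
  fix t
  show "nrm linfty ((F + G) (Complex 0 t)) \<le> nrm \<C> F + nrm \<C> G"
    using sn_tri[OF seminormed_linfty bc_carr[OF cal_bc0[OF F]] bc_carr[OF cal_bc0[OF G]], of t t]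
      nrm_cal_ge0[OF F, of t] nrm_cal_ge0[OF G, of t] by simp
  show "nrm lone ((F + G) (Complex 1 t)) \<le> nrm \<C> F + nrm \<C> G"
    using sn_tri[OF seminormed_lone bc_carr[OF cal_bc1[OF F]] bc_carr[OF cal_bc1[OF G]], of t t]
      nrm_cal_ge1[OF F, of t] nrm_cal_ge1[OF G, of t] by simp
qed

lemma nrm_cal_scale_le:
  assumes F: "F \<in> carr \<C>"
  shows "nrm \<C> (c *\<^sub>C F) \<le> cmod c * nrm \<C> F"
proof (rule nrm_cal_le)
  fix t
  show "nrm linfty ((c *\<^sub>C F) (Complex 0 t)) \<le> cmod c * nrm \<C> F"
    using sn_hom[OF seminormed_linfty bc_carr[OF cal_bc0[OF F]], of c t]
      nrm_cal_ge0[OF F, of t] by (simp add: mult_left_mono)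
  show "nrm lone ((c *\<^sub>C F) (Complex 1 t)) \<le> cmod c * nrm \<C> F"
    using sn_hom[OF seminormed_lone bc_carr[OF cal_bc1[OF F]], of c t]
      nrm_cal_ge1[OF F, of t] by (simp add: mult_left_mono)
qed

lemma seminormed_cal: "seminormed \<C>"
  unfolding seminormed_def csubspace_def
proof (intro conjI ballI allI)
  fix c :: complex and F assume F: "F \<in> carr \<C>"
  show "nrm \<C> (c *\<^sub>C F) = cmod c * nrm \<C> F"
  proof (cases "c = 0")
    case True
    have "nrm \<C> 0 = 0"
      using sn_nrm_zero[OF seminormed_linfty] sn_nrm_zero[OF seminormed_lone] by (simp add: nrm_cal)
    then show ?thesis using True by simp
  next
    case False
    have "nrm \<C> (inverse c *\<^sub>C c *\<^sub>C F) \<le> cmod (inverse c) * nrm \<C> (c *\<^sub>C F)"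
      by (intro nrm_cal_scale_le cal_scale F)
    moreover have "inverse c *\<^sub>C c *\<^sub>C F = F"
      using False by (simp add: scaleC_scaleC scaleC_one del: scaleC_fun_apply)
    ultimately have "cmod c * nrm \<C> F \<le> nrm \<C> (c *\<^sub>C F)"
      using False by (simp add: norm_divide field_simps)
    then show ?thesis using nrm_cal_scale_le[OF F, of c] by simp
  qed
qed (auto intro: cal_add cal_scale cal_zero nrm_cal_add)

lemma cal_left: "F \<in> carr \<C> \<Longrightarrow> cmod (F (Complex 0 t) n) \<le> nrm \<C> F"
  using nrm_cal_ge0[of F t] nrm_linfty_upper[OF bc_carr[OF cal_bc0], of F t n] by simp

lemma cal_right:
  "F \<in> carr \<C> \<Longrightarrow> finite A \<Longrightarrow> (\<Sum>n\<in>A. cmod (F (Complex 1 t) n)) \<le> nrm \<C> F"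
  using nrm_cal_ge1[of F t] lone_sum_le[OF bc_carr[OF cal_bc1], of F A t] by simp

text \<open>\<open>deriv_into\<close> is identified with the coordinatewise derivative only where
  the function is uniformly bounded on a ball. For \<open>k = 2\<close> it is applied to its own
  result, which must therefore first be bounded near 1/2; Cauchy's inequality does this.\<close>

lemma \<Delta>_eq:
  assumes F: "F \<in> carr \<C>" and k: "k \<le> 2"
  shows "\<Delta> k F n = (deriv ^^ k) (\<lambda>z. F z n) (1/2) / fact k"
proof -
  obtain B where B: "\<And>z n. cmod (F z n) \<le> B" using cal_bdd[OF F] by metis
  let ?D = "deriv_into \<Sigma>"
  have D1: "?D F w = (\<lambda>n. deriv (\<lambda>z. F z n) w)" if w: "w \<in> open_strip" for w
  proof -
    obtain r where "r > 0" "ball w r \<subseteq> open_strip"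
      using openE[OF open_open_strip w] by blast
    then show ?thesis
      using cal_hol[OF F] B by (intro deriv_into_\<Sigma>[where r = r and B = B])
        (auto intro: holomorphic_on_subset)
  qed
  have hol: "(\<lambda>z. deriv (\<lambda>z. F z n) z) holomorphic_on open_strip" for n
    using holomorphic_deriv[OF cal_hol[OF F] open_open_strip] .
  have D2: "?D (?D F) (1/2) n = (deriv ^^ 2) (\<lambda>z. F z n) (1/2)"
  proof -
    have b: "w \<in> open_strip" if "w \<in> ball (1/2) (1/4)" for w :: complex
      using that half_ball by auto
    have "?D (?D F) (1/2) = (\<lambda>n. deriv (\<lambda>w. ?D F w n) (1/2))"
    \<comment> \<open>Points within 1/4 of 1/2 have their own 1/4-ball inside the strip; Cauchy's
      inequality needs a strictly smaller radius, here 1/8.\<close>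
    proof (rule deriv_into_\<Sigma>[where r = "1/4" and B = "B / (1/8)"])
      show "(\<lambda>w. ?D F w n) holomorphic_on ball (1/2) (1/4)" for n
        using hol[of n] b by (subst holomorphic_cong[OF refl, where g = "deriv (\<lambda>z. F z n)"])
          (auto simp: D1 intro: holomorphic_on_subset)
      fix w :: complex and n assume w: "w \<in> ball (1/2) (1/4)"
      have "ball w (1/4) \<subseteq> ball (1/2) (1/2)"
      proof
        fix y assume "y \<in> ball w (1/4)"
        then show "y \<in> ball (1/2) (1/2)"
          using w dist_triangle[of "1/2" y w] by simp
      qed
      then have "cmod ((deriv ^^ 1) (\<lambda>z. F z n) w) \<le> fact 1 * B / (1/8)^1"
        using half_ball B
        by (intro cmod_higher_deriv_le[where r = "1/4"] holomorphic_on_subset[OF cal_hol[OF F]]) auto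
      then show "cmod (?D F w n) \<le> B / (1/8)" using D1[OF b[OF w]] by simp
    qed simp
    moreover have "deriv (\<lambda>w. ?D F w n) (1/2) = deriv (deriv (\<lambda>z. F z n)) (1/2)"
    proof (rule deriv_cong_ev)
      have "\<forall>\<^sub>F w in nhds (1/2). w \<in> open_strip"
        using open_open_strip half_ball by (intro eventually_nhds_in_open) auto
      then show "\<forall>\<^sub>F w in nhds (1/2). ?D F w n = deriv (\<lambda>z. F z n) w"
        by eventually_elim (simp add: D1)
    qed simp
    ultimately show ?thesis by (simp add: numeral_2_eq_2)
  qed
  have half: "1/2 \<in> open_strip" using half_ball by auto
  consider "k = 0" | "k = 1" | "k = 2" using k by linarith
  then show ?thesis
  proof cases
    case 3
    then show ?thesis using D2 by (simp add: \<Delta>_def numeral_2_eq_2)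
  qed (use D1[OF half] in \<open>simp_all add: \<Delta>_def\<close>)
qed

section \<open>The pairing\<close>

text \<open>Three lines argument. The factor \<open>exp (of_real e * (w\<^sup>2 - 1))\<close> has
  modulus at most \<open>exp (- e * (Im w)\<^sup>2)\<close> on the strip, so it forces decay at
  infinity and the maximum principle applies on a large rectangle; then \<open>e\<close> tends to
  0.\<close>

lemma strip_maximum_principle:
  assumes cont: "continuous_on strip h" and hol: "h holomorphic_on open_strip"
    and B: "\<And>z. z \<in> strip \<Longrightarrow> cmod (h z) \<le> B"
    and M0: "\<And>t. cmod (h (Complex 0 t)) \<le> M" and M1: "\<And>t. cmod (h (Complex 1 t)) \<le> M"
    and z: "z \<in> open_strip"
  shows "cmod (h z) \<le> M"
proof (rule field_le_epsilon)
  fix \<eta> :: real assume \<eta>: "0 < \<eta>"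
  have Mpos: "0 \<le> M" using M0[of 0] norm_ge_zero order_trans by blast
  have Bpos: "0 \<le> B" using B[of z] z open_strip_subset norm_ge_zero order_trans by blast
  \<comment> \<open>A strictly positive bound, since the height \<open>R\<close> of the rectangle
    below divides by \<open>N\<close>.\<close>
  define N where "N = M + \<eta>"
  have N: "N > 0" "M \<le> N" using Mpos \<eta> by (auto simp: N_def)
  have nrm_exp: "cmod (exp (of_real e * (w\<^sup>2 - 1))) = exp (e * ((Re w)\<^sup>2 - (Im w)\<^sup>2 - 1))" for e w
    by (simp add: power2_eq_square)
  have *: "cmod (h z) * exp (e * ((Re z)\<^sup>2 - (Im z)\<^sup>2 - 1)) \<le> N" if e: "e > 0" for e :: real
  proof -
    define k where "k = (\<lambda>w. h w * exp (of_real e * (w\<^sup>2 - 1)))"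
    \<comment> \<open>The quotient gives
      \<open>B \<le> e * N * R \<le> N * exp (e * R\<^sup>2)\<close>, which settles the horizontal
      sides; the summand 1 gives \<open>R \<le> R\<^sup>2\<close>, and the last summand puts
      \<open>z\<close> inside the rectangle.\<close>
    define R where "R = B / (e * N) + 1 + \<bar>Im z\<bar>"
    have "0 \<le> B / (e * N)" using Bpos N e by simp
    then have R: "R \<ge> 1" "\<bar>Im z\<bar> < R" "B / (e * N) \<le> R"
      unfolding R_def by linarith+
    define S where "S = box (Complex 0 (-R)) (Complex 1 R)"
    have ne: "S \<noteq> {}" using R by (auto simp: S_def box_ne_empty Basis_complex_def)
    have zS: "z \<in> S" using z R by (auto simp: S_def in_box_complex_iff open_strip_def)
    have cl: "closure S = cbox (Complex 0 (-R)) (Complex 1 R)"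
      using ne by (simp add: S_def)
    have cl_sub: "closure S \<subseteq> strip"
      by (auto simp: cl in_cbox_complex_iff strip_def)
    have k_le: "cmod (k w) \<le> cmod (h w) * exp (- e * (Im w)\<^sup>2)" if "w \<in> strip" for w
    proof -
      have "(Re w)\<^sup>2 \<le> 1" using that by (simp add: strip_def power_le_one)
      then have "e * ((Re w)\<^sup>2 - (Im w)\<^sup>2 - 1) \<le> e * (- (Im w)\<^sup>2)"
        using e by (intro mult_left_mono) auto
      then show ?thesis unfolding k_def norm_mult nrm_exp by (intro mult_left_mono) auto
    qed
    have "cmod (k z) \<le> N"
    proof (rule maximum_modulus_frontier[where S = S and f = k and \<xi> = z])
      have "interior S \<subseteq> open_strip"
        using interior_subset[of S] by (auto simp: S_def in_box_complex_iff open_strip_def)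
      then show "k holomorphic_on interior S"
        unfolding k_def using holomorphic_on_subset[OF hol] by (intro holomorphic_intros) auto
      show "continuous_on (closure S) k"
        unfolding k_def using continuous_on_subset[OF cont cl_sub] by (intro continuous_intros) auto
      show "bounded S" by (simp add: S_def)
      fix w assume w: "w \<in> frontier S"
      have ws: "w \<in> strip" using w cl_sub by (auto simp: frontier_def)
      consider "Re w = 0" | "Re w = 1" | "\<bar>Im w\<bar> = R"
        using w ne unfolding frontier_box S_def
        by (auto simp: in_box_complex_iff in_cbox_complex_iff frontier_box S_def split: if_splits)
      then show "cmod (k w) \<le> N"
      proof cases
        case 3
        have "B \<le> e * N * R" using R(3) e N by (simp add: field_simps)
        also have "\<dots> \<le> N * (e * R\<^sup>2)"
          using R(1) e N by (simp add: power2_eq_square)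
        also have "\<dots> \<le> N * exp (e * R\<^sup>2)"
          using N(1) exp_ge_add_one_self[of "e * R\<^sup>2"] by (intro mult_left_mono) linarith+
        finally have "B * exp (- e * R\<^sup>2) \<le> N" by (simp add: exp_minus field_simps)
        moreover have "cmod (h w) * exp (- e * (Im w)\<^sup>2) \<le> B * exp (- e * R\<^sup>2)"
          using 3 B[OF ws] by (metis mult_right_mono exp_ge_zero power2_abs)
        ultimately show ?thesis using k_le[OF ws] by simp
      next
        case 1
        then have "cmod (h w) \<le> M" using M0[of "Im w"] by (metis complex.collapse)
        moreover have "cmod (h w) * exp (- e * (Im w)\<^sup>2) \<le> cmod (h w) * 1"
          using e by (intro mult_left_mono) auto
        ultimately show ?thesis using k_le[OF ws] N by simp
      next
        case 2
        then have "cmod (h w) \<le> M" using M1[of "Im w"] by (metis complex.collapse)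
        moreover have "cmod (h w) * exp (- e * (Im w)\<^sup>2) \<le> cmod (h w) * 1"
          using e by (intro mult_left_mono) auto
        ultimately show ?thesis using k_le[OF ws] N by simp
      qed
    qed (rule zS)
    then show ?thesis unfolding k_def norm_mult nrm_exp .
  qed
  show "cmod (h z) \<le> M + \<eta>"
  proof (rule tendsto_upperbound)
    show "((\<lambda>e. cmod (h z) * exp (e * ((Re z)\<^sup>2 - (Im z)\<^sup>2 - 1))) \<longlongrightarrow> cmod (h z)) (at_right 0)"
      by (rule tendsto_eq_intros | simp)+
    show "\<forall>\<^sub>F e in at_right 0. cmod (h z) * exp (e * ((Re z)\<^sup>2 - (Im z)\<^sup>2 - 1)) \<le> M + \<eta>"
      using * by (auto simp: eventually_at_filter N_def)
  qed simp
qed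

definition pair_term ::
    "(complex \<Rightarrow> nat \<Rightarrow> complex) \<Rightarrow> (complex \<Rightarrow> nat \<Rightarrow> complex) \<Rightarrow> nat \<Rightarrow> complex" where
  "pair_term F G n = \<Delta> 2 F n * \<Delta> 0 G n - \<Delta> 1 F n * \<Delta> 1 G n + \<Delta> 0 F n * \<Delta> 2 G n"

lemma higher_deriv_sum:
  assumes "\<And>n. n \<in> A \<Longrightarrow> f n holomorphic_on S" "open S" "z \<in> S" "finite A"
  shows "(deriv ^^ k) (\<lambda>w. \<Sum>n\<in>A. f n w) z = (\<Sum>n\<in>A. (deriv ^^ k) (f n) z)"
  using assms(4,1)
proof (induction A rule: finite_induct)
  case empty
  then show ?case by simp
next
  case (insert a A)
  have "(deriv ^^ k) (\<lambda>w. f a w + (\<Sum>n\<in>A. f n w)) z =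
      (deriv ^^ k) (f a) z + (deriv ^^ k) (\<lambda>w. \<Sum>n\<in>A. f n w) z"
    using insert assms by (intro higher_deriv_add holomorphic_on_sum) auto
  then show ?case using insert by simp
qed

lemma half_open_strip: "1/2 \<in> open_strip"
  using half_ball by auto

lemma pair_term_deriv:
  assumes F: "F \<in> carr \<C>" and G: "G \<in> carr \<C>"
  shows "(\<lambda>z. F z n * G (1 - z) n) holomorphic_on open_strip"
    and "(deriv ^^ 2) (\<lambda>z. F z n * G (1 - z) n) (1/2) = 2 * pair_term F G n"
proof -
  have refl: "-1 * w + 1 \<in> open_strip" if "w \<in> open_strip" for w
    using that by (auto simp: open_strip_def)
  have holG: "(\<lambda>z. G (-1 * z + 1) n) holomorphic_on open_strip"
    using refl by (intro holomorphic_on_compose_gen[OF _ cal_hol[OF G, of n], unfolded o_def]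
        holomorphic_intros) auto
  then show "(\<lambda>z. F z n * G (1 - z) n) holomorphic_on open_strip"
    using cal_hol[OF F] by (intro holomorphic_on_mult) simp_all
  \<comment> \<open>Every derivative of the reflected factor contributes a sign; this is the origin
    of the minus in the middle term of \<open>pair_term\<close>.\<close>
  have dG: "(deriv ^^ i) (\<lambda>z. G (-1 * z + 1) n) (1/2) = (-1)^i * (deriv ^^ i) (\<lambda>z. G z n) (1/2)" for i
    using higher_deriv_compose_linear'[OF cal_hol[OF G] open_open_strip open_open_strip half_open_strip refl]
    by simp
  have "(deriv ^^ 2) (\<lambda>z. F z n * G (-1 * z + 1) n) (1/2) =
      (\<Sum>i = 0..2. of_nat (2 choose i) * (deriv ^^ i) (\<lambda>z. F z n) (1/2) *
        (deriv ^^ (2 - i)) (\<lambda>z. G (-1 * z + 1) n) (1/2))"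
    by (rule higher_deriv_mult[OF cal_hol[OF F] holG open_open_strip half_open_strip])
  also have "\<dots> = 2 * pair_term F G n"
    unfolding dG pair_term_def using F G
    by (simp add: \<Delta>_eq numeral_2_eq_2 algebra_simps)
  finally show "(deriv ^^ 2) (\<lambda>z. F z n * G (1 - z) n) (1/2) = 2 * pair_term F G n" by simp
qed

text \<open>On the left edge \<open>F\<close> is bounded while \<open>1 - z\<close> runs through the
  right edge, where \<open>G\<close> is summable; on the right edge the roles are exchanged. So
  Hoelder's inequality bounds \<open>h\<close> on both edges by the product of the norms, and the
  maximum principle carries the bound inside. Restricting to a finite set keeps \<open>h\<close> a
  finite sum, and the bound does not depend on that set.\<close>

lemma pair_term_sum_le:
  assumes F: "F \<in> carr \<C>" and G: "G \<in> carr \<C>" and A: "finite A"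
  shows "(\<Sum>n\<in>A. cmod (pair_term F G n)) \<le> 16 * (nrm \<C> F * nrm \<C> G)"
proof -
  \<comment> \<open>Constant factors, fitted at the midpoint only: \<open>h\<close> stays analytic
    while its second derivative at 1/2 adds up moduli.\<close>
  define u where "u n = cnj (sgn (pair_term F G n))" for n
  have u1: "cmod (u n) \<le> 1" for n by (simp add: u_def norm_sgn)
  have u2: "u n * pair_term F G n = of_real (cmod (pair_term F G n))" for n
    by (simp add: u_def sgn_div_norm scaleR_conv_of_real complex_norm_square[symmetric]
        mult.commute power2_eq_square field_simps)
  define h where "h = (\<lambda>z. \<Sum>n\<in>A. u n * (F z n * G (1 - z) n))"
  obtain B where B: "\<And>z n. cmod (F z n) \<le> B" using cal_bdd[OF F] by metis
  obtain C where C: "\<And>z n. cmod (G z n) \<le> C" using cal_bdd[OF G] by metis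
  have hol: "h holomorphic_on open_strip"
    unfolding h_def by (intro holomorphic_on_sum holomorphic_on_mult[OF holomorphic_on_const] pair_term_deriv F G)
  have h_le: "cmod (h z) \<le> (\<Sum>n\<in>A. cmod (F z n) * cmod (G (1 - z) n))" for z
    unfolding h_def
  proof (rule order_trans[OF norm_sum sum_mono])
    show "cmod (u n * (F z n * G (1 - z) n)) \<le> cmod (F z n) * cmod (G (1 - z) n)" for n
      using mult_right_mono[OF u1, of "cmod (F z n) * cmod (G (1 - z) n)" n] by (simp add: norm_mult)
  qed
  have hM: "cmod (h z) \<le> nrm \<C> F * nrm \<C> G" if "z \<in> open_strip" for z
  proof (rule strip_maximum_principle[OF _ hol _ _ _ that])
    have "continuous_on strip (\<lambda>z. G (1 - z) n)" for n
      by (rule continuous_on_compose2[OF cal_cont[OF G]])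
        (auto intro!: continuous_intros simp: strip_def)
    then show "continuous_on strip h"
      unfolding h_def by (intro continuous_intros cal_cont[OF F])
    \<comment> \<open>A crude bound depending on \<open>A\<close>; the maximum principle needs only
      some bound and replaces it by the boundary one.\<close>
    show "cmod (h z) \<le> (\<Sum>n\<in>A. B * C)" for z
      using h_le[of z] by (rule order_trans)
        (intro sum_mono mult_mono B C norm_ge_zero order_trans[OF norm_ge_zero B])
    fix t
    have "1 - Complex 0 t = Complex 1 (-t)" "1 - Complex 1 t = Complex 0 (-t)"
      by (simp_all add: complex_eq_iff)
    note eqs = this
    have "cmod (h (Complex 0 t)) \<le> (\<Sum>n\<in>A. nrm \<C> F * cmod (G (Complex 1 (-t)) n))"
      using h_le[of "Complex 0 t"] unfolding eqs by (rule order_trans)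
        (intro sum_mono mult_right_mono cal_left[OF F] norm_ge_zero)
    also have "\<dots> \<le> nrm \<C> F * nrm \<C> G"
      unfolding sum_distrib_left[symmetric]
      by (intro mult_left_mono cal_right G A sn_nonneg[OF seminormed_cal] F)
    finally show "cmod (h (Complex 0 t)) \<le> nrm \<C> F * nrm \<C> G" .
    have "cmod (h (Complex 1 t)) \<le> (\<Sum>n\<in>A. cmod (F (Complex 1 t) n) * nrm \<C> G)"
      using h_le[of "Complex 1 t"] unfolding eqs by (rule order_trans)
        (intro sum_mono mult_left_mono cal_left[OF G] norm_ge_zero)
    also have "\<dots> \<le> nrm \<C> F * nrm \<C> G"
      unfolding sum_distrib_right[symmetric]
      by (intro mult_right_mono cal_right G A sn_nonneg[OF seminormed_cal] F)
    finally show "cmod (h (Complex 1 t)) \<le> nrm \<C> F * nrm \<C> G" .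
  qed
  have "(deriv ^^ 2) h (1/2) = (\<Sum>n\<in>A. (deriv ^^ 2) (\<lambda>z. u n * (F z n * G (1 - z) n)) (1/2))"
    unfolding h_def
    by (intro higher_deriv_sum[OF _ open_open_strip half_open_strip A] holomorphic_on_mult[OF holomorphic_on_const]
        pair_term_deriv F G)
  also have "\<dots> = (\<Sum>n\<in>A. u n * (2 * pair_term F G n))"
    using higher_deriv_cmult[OF pair_term_deriv(1)[OF F G] half_open_strip open_open_strip]
      pair_term_deriv(2)[OF F G] by simp
  also have "\<dots> = 2 * of_real (\<Sum>n\<in>A. cmod (pair_term F G n))"
    using u2 by (simp add: sum_distrib_left mult.left_commute[of _ 2])
  finally have "cmod ((deriv ^^ 2) h (1/2)) = 2 * (\<Sum>n\<in>A. cmod (pair_term F G n))"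
    by (simp only: norm_mult norm_of_real norm_numeral) (simp add: sum_nonneg)
  \<comment> \<open>Cauchy's inequality at radius 1/4 gives \<open>2 * 16\<close>, halved because
    the second derivative is twice the Taylor coefficient.\<close>
  moreover have "cmod ((deriv ^^ 2) h (1/2)) \<le> fact 2 * (nrm \<C> F * nrm \<C> G) / (1/4)^2"
    using half_ball hM by (intro cmod_higher_deriv_le[where r = "1/2"] holomorphic_on_subset[OF hol]) auto
  ultimately show ?thesis by (simp add: power2_eq_square)
qed

lemma pair_term_summable:
  assumes "F \<in> carr \<C>" "G \<in> carr \<C>"
  shows "summable (\<lambda>n. cmod (pair_term F G n))" "summable (pair_term F G)"
    "(\<Sum>n. cmod (pair_term F G n)) \<le> 16 * (nrm \<C> F * nrm \<C> G)"
proof -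
  show s: "summable (\<lambda>n. cmod (pair_term F G n))"
    by (intro bounded_imp_summable[where B = "16 * (nrm \<C> F * nrm \<C> G)"] norm_ge_zero
        pair_term_sum_le[OF assms finite_atMost])
  then show "summable (pair_term F G)" by (rule summable_norm_cancel)
  show "(\<Sum>n. cmod (pair_term F G n)) \<le> 16 * (nrm \<C> F * nrm \<C> G)"
    using pair_term_sum_le[OF assms finite_lessThan] s by (intro suminf_le_const)
qed

definition pairing :: "(complex \<Rightarrow> nat \<Rightarrow> complex) \<Rightarrow> (complex \<Rightarrow> nat \<Rightarrow> complex) \<Rightarrow> complex" where
  "pairing F G = (\<Sum>n. pair_term F G n)"

lemma pairing_le:
  assumes "F \<in> carr \<C>" "G \<in> carr \<C>"
  shows "cmod (pairing F G) \<le> 16 * (nrm \<C> F * nrm \<C> G)"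
  unfolding pairing_def
  using summable_norm[OF pair_term_summable(1)[OF assms]] pair_term_summable(3)[OF assms] by simp

section \<open>Linearity of the coefficients and bilinearity of the pairing\<close>

lemma \<Delta>_add:
  assumes F: "F \<in> carr \<C>" and G: "G \<in> carr \<C>" and k: "k \<le> 2"
  shows "\<Delta> k (F + G) = \<Delta> k F + \<Delta> k G"
proof
  show "\<Delta> k (F + G) n = (\<Delta> k F + \<Delta> k G) n" for n
    using higher_deriv_add[OF cal_hol[OF F] cal_hol[OF G] open_open_strip half_open_strip, of k n n]
    by (simp add: \<Delta>_eq[OF _ k] F G cal_add add_divide_distrib)
qed

lemma \<Delta>_scale:
  assumes F: "F \<in> carr \<C>" and k: "k \<le> 2"
  shows "\<Delta> k (c *\<^sub>C F) = c *\<^sub>C \<Delta> k F"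
proof
  show "\<Delta> k (c *\<^sub>C F) n = (c *\<^sub>C \<Delta> k F) n" for n
    using higher_deriv_cmult[OF cal_hol[OF F] half_open_strip open_open_strip, of k c n]
    by (simp add: \<Delta>_eq[OF _ k] F cal_scale)
qed

lemma \<Delta>_diff:
  assumes F: "F \<in> carr \<C>" and G: "G \<in> carr \<C>" and k: "k \<le> 2"
  shows "\<Delta> k (F - G) = \<Delta> k F - \<Delta> k G"
  using \<Delta>_add[OF F cal_scale[OF G, of "-1"] k] \<Delta>_scale[OF G k, of "-1"]
  by (simp add: scaleC_minus1)

lemma \<Delta>_zero: "k \<le> 2 \<Longrightarrow> \<Delta> k 0 = 0"
  using \<Delta>_scale[OF cal_zero, of k 0] by simp

lemma pairing_add_left:
  assumes "F \<in> carr \<C>" "F' \<in> carr \<C>" "G \<in> carr \<C>"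
  shows "pairing (F + F') G = pairing F G + pairing F' G"
  unfolding pairing_def
  by (subst suminf_add) (auto simp: assms pair_term_summable pair_term_def \<Delta>_add algebra_simps
      intro!: suminf_cong)

lemma pairing_add_right:
  assumes "F \<in> carr \<C>" "G \<in> carr \<C>" "G' \<in> carr \<C>"
  shows "pairing F (G + G') = pairing F G + pairing F G'"
  unfolding pairing_def
  by (subst suminf_add) (auto simp: assms pair_term_summable pair_term_def \<Delta>_add algebra_simps
      intro!: suminf_cong)

lemma pairing_scale_left:
  assumes "F \<in> carr \<C>" "G \<in> carr \<C>"
  shows "pairing (c *\<^sub>C F) G = c * pairing F G"
  unfolding pairing_def
  by (subst suminf_mult[symmetric]) (auto simp: assms pair_term_summable pair_term_def \<Delta>_scale algebra_simps
      intro!: suminf_cong)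

lemma pairing_scale_right:
  assumes "F \<in> carr \<C>" "G \<in> carr \<C>"
  shows "pairing F (c *\<^sub>C G) = c * pairing F G"
  unfolding pairing_def
  by (subst suminf_mult[symmetric]) (auto simp: assms pair_term_summable pair_term_def \<Delta>_scale algebra_simps
      intro!: suminf_cong)

section \<open>A family of test functions\<close>

text \<open>With \<open>w = z - 1/2\<close> the expansion is \<open>exp (L w + w\<^sup>2) = 1 + L w + (L\<^sup>2/2 + 1) w\<^sup>2 + \<dots>\<close>; the factor
  \<open>exp (w\<^sup>2)\<close> gives the decay on vertical lines.\<close>

definition test_fun :: "real \<Rightarrow> complex \<Rightarrow> complex \<Rightarrow> complex \<Rightarrow> complex \<Rightarrow> complex" where
  "test_fun L a b c z = exp (of_real L * (z - 1/2) + (z - 1/2)\<^sup>2) * (a + b * (z - 1/2) + c * (z - 1/2)\<^sup>2)"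

lemma deriv_test_fun:
  "deriv (test_fun L a b c) =
     (\<lambda>z. exp (of_real L * (z - 1/2) + (z - 1/2)\<^sup>2) *
       ((of_real L + 2 * (z - 1/2)) * (a + b * (z - 1/2) + c * (z - 1/2)\<^sup>2) + b + 2 * c * (z - 1/2)))"
proof
  fix z :: complex
  show "deriv (test_fun L a b c) z = exp (of_real L * (z - 1/2) + (z - 1/2)\<^sup>2) *
       ((of_real L + 2 * (z - 1/2)) * (a + b * (z - 1/2) + c * (z - 1/2)\<^sup>2) + b + 2 * c * (z - 1/2))"
  proof -
    define w where "w = z - 1/2"
    show ?thesis
      unfolding test_fun_def w_def[symmetric]
      by (rule DERIV_imp_deriv)
        (auto intro!: derivative_eq_intros simp: w_def[symmetric], simp add: algebra_simps)
  qed
qed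

text \<open>The coefficients arise from \<open>a\<close>, \<open>b\<close>, \<open>c\<close> by a
  triangular system with unit diagonal, so for any \<open>L\<close> the first three of them can be
  prescribed; the price is that \<open>b\<close> and \<open>c\<close> grow with
  \<open>L\<close>.\<close>

lemma test_fun_taylor:
  "(deriv ^^ 0) (test_fun L a b c) (1/2) = a"
  "(deriv ^^ 1) (test_fun L a b c) (1/2) = b + of_real L * a"
  "(deriv ^^ 2) (test_fun L a b c) (1/2) = 2 * (c + of_real L * b + (of_real L ^ 2 / 2 + 1) * a)"
proof -
  show "(deriv ^^ 0) (test_fun L a b c) (1/2) = a" by (simp add: test_fun_def)
  show "(deriv ^^ 1) (test_fun L a b c) (1/2) = b + of_real L * a" by (simp add: deriv_test_fun)
  have "deriv (deriv (test_fun L a b c)) (1/2) = 2 * (c + of_real L * b + (of_real L ^ 2 / 2 + 1) * a)"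
    unfolding deriv_test_fun
    by (rule DERIV_imp_deriv) (auto intro!: derivative_eq_intros simp: power2_eq_square algebra_simps)
  then show "(deriv ^^ 2) (test_fun L a b c) (1/2) = 2 * (c + of_real L * b + (of_real L ^ 2 / 2 + 1) * a)"
    by (simp add: numeral_2_eq_2)
qed

lemma test_fun_holomorphic: "test_fun L a b c holomorphic_on S"
  unfolding test_fun_def by (intro holomorphic_intros)

text \<open>With \<open>s\<close> the square of \<open>Im z\<close>, the Gaussian contributes at
  most \<open>3 * exp (- s)\<close> and the polynomial at most \<open>Q * (5/4 + s)\<close>; the
  constant 8 comes from \<open>3 * (5/4 + s) * (1 + s) \<le> 8 * (1 + s + s\<^sup>2/2)\<close>. What
  remains is \<open>exp (- L / 2)\<close> on the left edge and \<open>exp (L / 2)\<close> on the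
  right edge: \<open>L\<close> moves size from one edge to the other.\<close>

lemma test_fun_bound:
  assumes "z \<in> strip"
  shows "cmod (test_fun L a b c z) \<le>
    8 * (cmod a + cmod b + cmod c) * exp (L * (Re z - 1/2)) / (1 + (Im z)\<^sup>2)"
proof -
  define w where "w = z - 1/2"
  define s where "s = (Im z)\<^sup>2"
  define Q where "Q = cmod a + cmod b + cmod c"
  have s: "s \<ge> 0" and Q: "Q \<ge> 0" by (simp_all add: s_def Q_def)
  have z: "0 \<le> Re z" "Re z \<le> 1" using assms by (auto simp: strip_def)
  have w': "Im w = Im z" "Re w = Re z - 1/2" by (auto simp: w_def)
  have "\<bar>Re w\<bar> \<le> 1/2" unfolding w' using z by linarith
  note w = this w'
  have w2: "(Re w)\<^sup>2 \<le> 1/4"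
    using power_mono[OF w(1), of 2] by (simp add: power_divide)
  have "cmod (exp (of_real L * w + w\<^sup>2)) = exp (L * (Re z - 1/2)) * exp ((Re w)\<^sup>2) * exp (- s)"
    by (simp add: w s_def power2_eq_square exp_add[symmetric])
  also have "\<dots> \<le> exp (L * (Re z - 1/2)) * 3 * exp (- s)"
    using w2 exp_le by (intro mult_right_mono mult_left_mono) (auto intro: order_trans[of _ "exp 1"])
  finally have e: "cmod (exp (of_real L * w + w\<^sup>2)) \<le> exp (L * (Re z - 1/2)) * 3 * exp (- s)" .
  have cw2: "(cmod w)\<^sup>2 \<le> 1/4 + s"
    using w2 w(2) by (simp add: cmod_power2 s_def)
  have "2 * cmod w \<le> 1 + (cmod w)\<^sup>2"
    using zero_le_power2[of "cmod w - 1"] by (simp add: power2_eq_square algebra_simps)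
  then have cw: "cmod w \<le> 5/4 + s" using cw2 s by simp
  have "cmod (a + b * w + c * w\<^sup>2) \<le> cmod a * 1 + cmod b * cmod w + cmod c * (cmod w)\<^sup>2"
    by (intro norm_triangle_le add_mono) (auto simp: norm_mult norm_power)
  also have "\<dots> \<le> cmod a * (5/4 + s) + cmod b * (5/4 + s) + cmod c * (5/4 + s)"
    using s cw2 cw by (intro add_mono mult_left_mono) auto
  also have "\<dots> = Q * (5/4 + s)" by (simp add: Q_def algebra_simps)
  finally have q: "cmod (a + b * w + c * w\<^sup>2) \<le> Q * (5/4 + s)" .
  have "3 * (5/4 + s) * (1 + s) \<le> 8 * (1 + s + s\<^sup>2/2)"
    using s by (simp add: power2_eq_square algebra_simps)
  also have "\<dots> \<le> 8 * exp s" using exp_lower_Taylor_quadratic[OF s] by simp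
  finally have k: "3 * (5/4 + s) * exp (- s) \<le> 8 / (1 + s)"
    using s by (simp add: exp_minus field_simps)
  have "cmod (test_fun L a b c z) = cmod (exp (of_real L * w + w\<^sup>2)) * cmod (a + b * w + c * w\<^sup>2)"
    by (simp add: test_fun_def w_def norm_mult)
  also have "\<dots> \<le> (exp (L * (Re z - 1/2)) * 3 * exp (- s)) * (Q * (5/4 + s))"
    using e q by (intro mult_mono) auto
  also have "\<dots> = Q * exp (L * (Re z - 1/2)) * (3 * (5/4 + s) * exp (- s))" by simp
  also have "\<dots> \<le> Q * exp (L * (Re z - 1/2)) * (8 / (1 + s))"
    using k Q by (intro mult_left_mono) auto
  also have "\<dots> = 8 * Q * exp (L * (Re z - 1/2)) / (1 + s)" by simp
  finally show ?thesis unfolding Q_def s_def .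
qed

text \<open>The hypotheses are edge conditions: \<open>Q n * exp (- L n / 2)\<close> controls the
  supremum norm on the left and \<open>Q n * exp (L n / 2)\<close> the l_1 norm on the right. As the
  \<open>L n\<close> may be unbounded, the coordinates need not be equicontinuous; convergence to 0
  and summability make the tails uniformly small instead.\<close>

lemma test_family:
  fixes L :: "nat \<Rightarrow> real" and a b c :: "nat \<Rightarrow> complex" and Q :: "nat \<Rightarrow> real"
  assumes Q: "\<And>n. cmod (a n) + cmod (b n) + cmod (c n) \<le> Q n"
    and lim: "(\<lambda>n. Q n * exp (- L n / 2)) \<longlonglongrightarrow> 0"
    and le: "\<And>n. Q n * exp (- L n / 2) \<le> U"
    and sm: "summable (\<lambda>n. Q n * exp (L n / 2))"
    and sum_le: "(\<Sum>n. Q n * exp (L n / 2)) \<le> U"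
  obtains F where "F \<in> carr \<C>" "nrm \<C> F \<le> 8 * U" "\<Delta> 0 F = a"
    "\<Delta> 1 F = (\<lambda>n. b n + of_real (L n) * a n)"
    "\<Delta> 2 F = (\<lambda>n. c n + of_real (L n) * b n + (of_real (L n) ^ 2 / 2 + 1) * a n)"
proof -
  define f where "f n = test_fun (L n) (a n) (b n) (c n)" for n
  define F where "F z = (if z \<in> strip then (\<lambda>n. f n z) else 0)" for z
  \<comment> \<open>The exponential is monotone in \<open>Re z\<close>, so its two edge values
    together dominate it on the whole strip.\<close>
  define v where "v n = 8 * (Q n * exp (- L n / 2) + Q n * exp (L n / 2))" for n
  have Q0: "0 \<le> Q n" for n
    using Q[of n] norm_ge_zero[of "a n"] norm_ge_zero[of "b n"] norm_ge_zero[of "c n"] by linarith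
  have fb: "cmod (f n z) \<le> 8 * (Q n * exp (L n * (Re z - 1/2))) / (1 + (Im z)\<^sup>2)" if "z \<in> strip" for n z
  proof -
    have "0 < 1 + (Im z)\<^sup>2" by (simp add: add_pos_nonneg)
    then have "8 * (cmod (a n) + cmod (b n) + cmod (c n)) * exp (L n * (Re z - 1/2)) / (1 + (Im z)\<^sup>2)
        \<le> 8 * Q n * exp (L n * (Re z - 1/2)) / (1 + (Im z)\<^sup>2)"
      using Q[of n] by (intro divide_right_mono mult_right_mono mult_left_mono) auto
    then show ?thesis
      using test_fun_bound[OF that, of "L n" "a n" "b n" "c n"] by (simp add: f_def)
  qed
  have fv: "cmod (f n z) \<le> v n" if z: "z \<in> strip" for n z
  proof -
    have "exp (L n * (Re z - 1/2)) \<le> exp (- L n / 2) + exp (L n / 2)"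
    proof (cases "L n \<ge> 0")
      case True
      then have "L n * (Re z - 1/2) \<le> L n * (1/2)"
        using z by (intro mult_left_mono) (auto simp: strip_def)
      then have "exp (L n * (Re z - 1/2)) \<le> exp (L n / 2)" by simp
      then show ?thesis using exp_ge_zero[of "- L n / 2"] by linarith
    next
      case False
      then have "L n * (Re z - 1/2) \<le> L n * (- 1/2)"
        using z by (intro mult_left_mono_neg) (auto simp: strip_def)
      then have "exp (L n * (Re z - 1/2)) \<le> exp (- L n / 2)" by simp
      then show ?thesis using exp_ge_zero[of "L n / 2"] by linarith
    qed
    then have "8 * (Q n * exp (L n * (Re z - 1/2))) \<le> v n"
      using mult_left_mono[OF _ Q0[of n]] by (simp add: v_def distrib_left[symmetric])
    moreover have "8 * (Q n * exp (L n * (Re z - 1/2))) / (1 + (Im z)\<^sup>2)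
        \<le> 8 * (Q n * exp (L n * (Re z - 1/2))) / 1"
      using Q0[of n] by (intro divide_left_mono) (auto simp: add_pos_nonneg)
    ultimately show ?thesis using fb[OF z, of n] by simp
  qed
  have v0: "v \<longlonglongrightarrow> 0"
    unfolding v_def using tendsto_mult_right[OF tendsto_add[OF lim summable_LIMSEQ_zero[OF sm]], of 8]
    by (simp add: mult.commute)
  obtain V where V: "\<And>n. v n \<le> V"
    using convergent_imp_Bseq[of v] v0 unfolding convergent_def Bseq_def
    by (metis abs_le_D1 real_norm_def)
  have cf: "isCont (f n) z" for n z
    unfolding f_def
    by (rule holomorphic_on_imp_continuous_on[THEN continuous_on_interior[of UNIV]])
      (auto intro: test_fun_holomorphic)
  have Fcarr: "F z \<in> carr \<Sigma>" for z
  proof -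
    have "cmod (F z n) \<le> max V 0" for n
      using order_trans[OF fv V, of z n] by (auto simp: F_def le_max_iff_disj)
    then show ?thesis using nrm_\<Sigma>_least by blast
  qed
  have contF: "continuous_on_into \<Sigma> strip F"
    unfolding continuous_on_into_def
  proof (intro conjI ballI)
    show "F ` strip \<subseteq> carr \<Sigma>" using Fcarr by auto
    fix z assume z: "z \<in> strip"
    show "tendsto_nrm \<Sigma> F (F z) (at z within strip)"
      unfolding tendsto_nrm_def
    proof (rule tendstoI)
      fix e :: real assume e: "0 < e"
      \<comment> \<open>Beyond \<open>N\<close> all coordinates are small at once; the finitely many
        others are continuous.\<close>
      then obtain N where N: "\<And>n. n \<ge> N \<Longrightarrow> v n < e/4"
        using order_tendstoD(2)[OF v0, of "e/4"] by (auto simp: eventually_sequentially)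
      have "\<forall>\<^sub>F w in at z within strip. \<forall>n\<in>{..<N}. dist (f n w) (f n z) < e/2"
        using cf e by (intro eventually_ball_finite ballI tendstoD[OF tendsto_within_subset])
          (auto simp: isCont_def)
      moreover have "\<forall>\<^sub>F w in at z within strip. w \<in> strip"
        by (simp add: eventually_at_filter)
      ultimately show "\<forall>\<^sub>F w in at z within strip. dist (nrm \<Sigma> (F w - F z)) 0 < e"
      proof eventually_elim
        case (elim w)
        have "cmod ((F w - F z) n) \<le> e/2" for n
        proof (cases "n < N")
          case True
          then show ?thesis using elim z by (auto simp: F_def dist_norm intro!: less_imp_le)
        next
          case False
          have "cmod (f n w - f n z) \<le> v n + v n"
            using fv[OF elim(2)] fv[OF z] by (intro norm_triangle_le_diff add_mono)
          then show ?thesis using False N[of n] elim z by (simp add: F_def)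
        qed
        then have "nrm \<Sigma> (F w - F z) \<le> e/2"
          using nrm_\<Sigma>_least by blast
        moreover have "0 \<le> nrm \<Sigma> (F w - F z)"
          by (intro sn_nonneg[OF seminormed_\<Sigma>] sn_diff[OF seminormed_\<Sigma>] Fcarr)
        ultimately show ?case using e by (simp add: dist_norm)
      qed
    qed
  qed
  have strip0: "Complex 0 t \<in> strip" "Complex 1 t \<in> strip" for t by (auto simp: strip_def)
  have recip0: "((\<lambda>t :: real. K / (1 + t\<^sup>2)) \<longlongrightarrow> 0) at_infinity" for K
  proof (rule Lim_null_comparison[where g = "\<lambda>t. \<bar>K\<bar> * inverse (norm t)"])
    have "norm (K / (1 + t\<^sup>2)) \<le> \<bar>K\<bar> * inverse (norm t)" if "norm t \<ge> 1" for t :: real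
    proof -
      have "norm t * 1 \<le> norm t * norm t" using that by (intro mult_left_mono) auto
      then have "norm t \<le> 1 + t\<^sup>2" by (simp add: power2_eq_square)
      moreover have "0 < 1 + t\<^sup>2" by (simp add: add_pos_nonneg)
      ultimately have "\<bar>K\<bar> * norm t \<le> \<bar>K\<bar> * (1 + t\<^sup>2)" by (intro mult_left_mono) auto
      then show ?thesis using that \<open>0 < 1 + t\<^sup>2\<close> by (simp add: abs_div field_simps abs_mult)
    qed
    then show "\<forall>\<^sub>F t in at_infinity. norm (K / (1 + t\<^sup>2)) \<le> \<bar>K\<bar> * inverse (norm t)"
      unfolding eventually_at_infinity by blast
    show "((\<lambda>t :: real. \<bar>K\<bar> * inverse (norm t)) \<longlongrightarrow> 0) at_infinity"
      by (intro tendsto_mult_right_zero tendsto_inverse_0_at_top filterlim_norm_at_top)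
  qed
  have b0: "cmod (F (Complex 0 t) n) \<le> 8 * U / (1 + t\<^sup>2)" for t n
  proof -
    have "cmod (f n (Complex 0 t)) \<le> 8 * (Q n * exp (- L n / 2)) / (1 + t\<^sup>2)"
      using fb[OF strip0(1), of n t] by simp
    also have "\<dots> \<le> 8 * U / (1 + t\<^sup>2)"
      using le[of n] by (intro divide_right_mono mult_left_mono) (auto simp: add_nonneg_nonneg)
    finally show ?thesis by (simp add: F_def strip0)
  qed
  have F0carr: "F (Complex 0 t) \<in> carr linfty" for t
    using Fcarr[of "Complex 0 t"] by (simp add: carr_\<Sigma>)
  have n0: "nrm linfty (F (Complex 0 t)) \<le> 8 * U / (1 + t\<^sup>2)" for t
    by (rule nrm_linfty_least[OF b0])
  have b1: "cmod (F (Complex 1 t) n) \<le> 8 * (Q n * exp (L n / 2)) / (1 + t\<^sup>2)" for t n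
    using fb[OF strip0(2), of n t] by (simp add: F_def strip0)
  have sm1: "summable (\<lambda>n. 8 * (Q n * exp (L n / 2)) / (1 + t\<^sup>2))" for t
    by (intro summable_divide summable_mult sm)
  have F1carr: "F (Complex 1 t) \<in> carr lone" for t
    unfolding carr_lone by (rule summable_comparison_test'[OF sm1[of t]]) (use b1 in auto)
  have n1: "nrm lone (F (Complex 1 t)) \<le> 8 * U / (1 + t\<^sup>2)" for t
  proof -
    have "nrm lone (F (Complex 1 t)) \<le> (\<Sum>n. 8 * (Q n * exp (L n / 2)) / (1 + t\<^sup>2))"
      unfolding nrm_lone using F1carr[of t] by (intro suminf_le b1 sm1) (simp add: carr_lone)
    also have "\<dots> = 8 * (\<Sum>n. Q n * exp (L n / 2)) / (1 + t\<^sup>2)"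
      using sm by (simp add: suminf_mult suminf_divide summable_mult)
    also have "\<dots> \<le> 8 * U / (1 + t\<^sup>2)"
      using sum_le by (intro divide_right_mono mult_left_mono) (auto simp: add_nonneg_nonneg)
    finally show ?thesis .
  qed
  have U0: "U \<ge> 0" using le[of 0] Q0[of 0] by (intro order_trans[OF _ le[of 0]]) simp
  have U_div: "8 * U / (1 + t\<^sup>2) \<le> 8 * U" for t :: real
    using U0 divide_left_mono[of 1 "1 + t\<^sup>2" "8 * U"] by (simp add: add_pos_nonneg)
  have tn: "((\<lambda>t. nrm X (F (Complex x t))) \<longlongrightarrow> 0) at_infinity"
    if "seminormed X" "\<And>t. F (Complex x t) \<in> carr X" "\<And>t. nrm X (F (Complex x t)) \<le> 8 * U / (1 + t\<^sup>2)"
    for X x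
    using that(3) sn_nonneg[OF that(1,2)]
    by (intro Lim_null_comparison[OF _ recip0[of "8 * U"]] always_eventually) simp
  have FC: "F \<in> carr \<C>"
  proof (rule calderonI[where B = V])
    show "continuous_on_into \<Sigma> strip F" by (rule contF)
    show "cmod (F z n) \<le> V" if "z \<in> strip" for z n
      using order_trans[OF fv[OF that] V] that by (simp add: F_def)
    show "(\<lambda>z. F z n) holomorphic_on open_strip" for n
      using open_strip_subset
      by (subst holomorphic_cong[OF refl, where g = "f n"]) (auto simp: F_def f_def test_fun_holomorphic)
    show "F z = 0" if "z \<notin> strip" for z using that by (simp add: F_def)
    show "boundary_condition linfty (\<lambda>t. F (Complex 0 t))"
      unfolding boundary_condition_def continuous_on_into_def
    proof (intro conjI ballI)
      show "range (\<lambda>t. F (Complex 0 t)) \<subseteq> carr linfty" using F0carr by auto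
      show "tendsto_nrm linfty (\<lambda>t. F (Complex 0 t)) 0 at_infinity"
        using tn[OF seminormed_linfty F0carr n0] by (simp add: tendsto_nrm_def)
      fix s :: real
      \<comment> \<open>The left edge inherits its continuity from the strip, as the norms of the
        sum space and of \<open>linfty\<close> agree.\<close>
      have fl: "filterlim (Complex 0) (at (Complex 0 s) within strip) (at s)"
        unfolding filterlim_at
      proof
        show "((Complex 0) \<longlongrightarrow> Complex 0 s) (at s)"
          using tendsto_Complex[OF tendsto_const[of 0] tendsto_ident_at[of s UNIV]] by simp
        show "\<forall>\<^sub>F t in at s. Complex 0 t \<in> strip \<and> Complex 0 t \<noteq> Complex 0 s"
          by (simp add: strip0 eventually_at_filter)
      qed
      have "((\<lambda>w. nrm \<Sigma> (F w - F (Complex 0 s))) \<longlongrightarrow> 0) (at (Complex 0 s) within strip)"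
        using contF strip0(1)[of s] unfolding continuous_on_into_def tendsto_nrm_def by blast
      from filterlim_compose[OF this fl]
      show "tendsto_nrm linfty (\<lambda>t. F (Complex 0 t)) (F (Complex 0 s)) (at s)"
        by (simp add: tendsto_nrm_def nrm_\<Sigma> sn_diff[OF seminormed_linfty] F0carr)
    qed
    show "boundary_condition lone (\<lambda>t. F (Complex 1 t))"
      unfolding boundary_condition_def continuous_on_into_def
    proof (intro conjI ballI)
      show "range (\<lambda>t. F (Complex 1 t)) \<subseteq> carr lone" using F1carr by auto
      show "tendsto_nrm lone (\<lambda>t. F (Complex 1 t)) 0 at_infinity"
        using tn[OF seminormed_lone F1carr n1] by (simp add: tendsto_nrm_def)
      fix s :: real
      define d where "d n t = cmod (f n (Complex 1 t) - f n (Complex 1 s))" for n t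
      \<comment> \<open>The l_1 distance to the value at \<open>s\<close> is a uniformly convergent
        series of continuous functions of \<open>t\<close>, hence continuous, and it vanishes at
        \<open>t = s\<close>.\<close>
      have "uniform_limit UNIV (\<lambda>k t. \<Sum>n<k. d n t) (\<lambda>t. \<Sum>n. d n t) sequentially"
      proof (rule Weierstrass_m_test)
        show "summable (\<lambda>n. 16 * (Q n * exp (L n / 2)))" by (intro summable_mult sm)
        fix n and t :: real
        have e: "cmod (f n (Complex 1 t)) \<le> 8 * (Q n * exp (L n / 2))" for t
        proof -
          have "cmod (f n (Complex 1 t)) \<le> 8 * (Q n * exp (L n / 2)) / (1 + t\<^sup>2)"
            using fb[OF strip0(2), of n t] by simp
          also have "\<dots> \<le> 8 * (Q n * exp (L n / 2)) / 1"
            using Q0[of n] by (intro divide_left_mono) (auto simp: add_pos_nonneg)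
          finally show ?thesis by simp
        qed
        show "norm (d n t) \<le> 16 * (Q n * exp (L n / 2))"
          using norm_triangle_ineq4[of "f n (Complex 1 t)" "f n (Complex 1 s)"] e[of t] e[of s]
          by (simp add: d_def)
      qed
      moreover have "continuous_on UNIV (\<lambda>t. \<Sum>n<k. d n t)" for k
      proof -
        have "continuous_on UNIV (\<lambda>t. f n (Complex 1 t))" for n
        proof (rule continuous_on_compose2[where t = UNIV and g = "f n" and f = "Complex 1"])
          show "continuous_on UNIV (f n)" using cf by (simp add: continuous_on_eq_continuous_at)
          show "continuous_on UNIV (\<lambda>t. Complex 1 t)"
            unfolding Complex_eq by (intro continuous_intros)
        qed simp
        then show ?thesis unfolding d_def by (intro continuous_intros)
      qed
      ultimately have "continuous_on UNIV (\<lambda>t. \<Sum>n. d n t)"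
        by (intro uniform_limit_theorem[where F = sequentially]) auto
      then have "((\<lambda>t. \<Sum>n. d n t) \<longlongrightarrow> (\<Sum>n. d n s)) (at s)"
        by (simp add: continuous_on_def)
      then show "tendsto_nrm lone (\<lambda>t. F (Complex 1 t)) (F (Complex 1 s)) (at s)"
        by (simp add: tendsto_nrm_def nrm_lone F_def strip0 d_def)
    qed
  qed
  have "nrm \<C> F \<le> 8 * U"
    using order_trans[OF n0 U_div] order_trans[OF n1 U_div] by (rule nrm_cal_le)
  moreover have *: "\<Delta> k F n = (deriv ^^ k) (f n) (1/2) / fact k" if "k \<le> 2" for k n
  proof -
    have "(deriv ^^ k) (\<lambda>z. F z n) (1/2) = (deriv ^^ k) (f n) (1/2)"
      using open_strip_subset
      by (intro higher_deriv_transform_within_open[OF cal_hol[OF FC] _ open_open_strip half_open_strip])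
        (auto simp: F_def f_def test_fun_holomorphic)
    then show ?thesis using \<Delta>_eq[OF FC that] by simp
  qed
  ultimately show ?thesis
    using FC *[of 0] *[of 1] *[of 2] by (intro that[of F]) (simp_all add: f_def test_fun_taylor[simplified] fun_eq_iff test_fun_taylor(3))
qed

section \<open>The Hahn-Banach theorem\<close>

text \<open>Real functionals dominated by the seminorm are handled as graphs, so that a chain of
  extensions is bounded by its union. Being single-valued is automatic: \<open>(0, a)\<close> in the graph forces
  \<open>a \<le> nrm X 0 = 0\<close>, and likewise for \<open>- a\<close>.\<close>

definition dominated_graph :: "'a::complex_vector nspace \<Rightarrow> ('a \<times> real) set \<Rightarrow> bool" where
  "dominated_graph X G \<longleftrightarrow>
     (\<forall>x a. (x, a) \<in> G \<longrightarrow> x \<in> carr X \<and> a \<le> nrm X x) \<and> (0, 0) \<in> G \<and>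
     (\<forall>x a y b. (x, a) \<in> G \<longrightarrow> (y, b) \<in> G \<longrightarrow> (x + y, a + b) \<in> G) \<and>
     (\<forall>t x a. (x, a) \<in> G \<longrightarrow> (of_real t *\<^sub>C x, t * a) \<in> G)"

text \<open>A value \<open>c\<close> at \<open>x0\<close> must satisfy
  \<open>a - nrm X (x - x0) \<le> c \<le> nrm X (y + x0) - b\<close> for all \<open>(x, a)\<close>
  and \<open>(y, b)\<close> in the graph. Subadditivity keeps the lower bounds below the upper ones,
  and \<open>c\<close> is the supremum of the former. Homogeneity reduces a general multiple of
  \<open>x0\<close> to the factors 1 and -1.\<close>

lemma dominated_graph_extend:
  assumes X: "seminormed X" and G: "dominated_graph X G" and x0: "x0 \<in> carr X"
  obtains G' b where "dominated_graph X G'" "G \<subseteq> G'" "(x0, b) \<in> G'"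
proof -
  have Gc: "x \<in> carr X" "a \<le> nrm X x" if "(x, a) \<in> G" for x a
    using G that by (auto simp: dominated_graph_def)
  have G0: "(0, 0) \<in> G" using G by (simp add: dominated_graph_def)
  have Ga: "(x + y, a + b) \<in> G" if "(x, a) \<in> G" "(y, b) \<in> G" for x y a b
    using G that unfolding dominated_graph_def by blast
  have Gs: "(of_real t *\<^sub>C x, t * a) \<in> G" if "(x, a) \<in> G" for t x a
    using G that unfolding dominated_graph_def by blast
  define S where "S = {a - nrm X (x - x0) | x a. (x, a) \<in> G}"
  define c where "c = Sup S"
  have key: "a - nrm X (x - x0) \<le> nrm X (y + x0) - b" if "(x, a) \<in> G" "(y, b) \<in> G" for x y a b
  proof -
    have "a + b \<le> nrm X ((x - x0) + (y + x0))"
      using Gc(2)[OF Ga[OF that]] by simp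
    also have "\<dots> \<le> nrm X (x - x0) + nrm X (y + x0)"
      using that by (intro sn_tri[OF X] sn_diff[OF X] sn_add[OF X] Gc(1) x0)
    finally show ?thesis by simp
  qed
  have Sne: "S \<noteq> {}" using G0 by (auto simp: S_def)
  have bdd: "bdd_above S" using key[OF _ G0] by (auto simp: S_def bdd_above_def)
  have c1: "a - c \<le> nrm X (x - x0)" if "(x, a) \<in> G" for x a
  proof -
    have "a - nrm X (x - x0) \<le> c"
      unfolding c_def using that by (intro cSup_upper bdd) (auto simp: S_def)
    then show ?thesis by simp
  qed
  have c2: "b + c \<le> nrm X (y + x0)" if "(y, b) \<in> G" for y b
  proof -
    have "c \<le> nrm X (y + x0) - b"
      unfolding c_def using key[OF _ that] by (intro cSup_least Sne) (auto simp: S_def)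
    then show ?thesis by simp
  qed
  \<comment> \<open>\<open>x0\<close> may already belong to the domain; then domination, proved
    next, forces \<open>G'\<close> to add nothing new.\<close>
  define G' where "G' = {(x + of_real t *\<^sub>C x0, a + t * c) | x a t. (x, a) \<in> G}"
  have dom: "a + t * c \<le> nrm X (x + of_real t *\<^sub>C x0)" if xa: "(x, a) \<in> G" for x a t
  proof -
    have sc: "of_real s *\<^sub>C (of_real (inverse s) *\<^sub>C x) = x" if "s > 0" for s :: real
      using that by (simp add: scaleC_scaleC scaleC_one flip: of_real_mult)
    consider "t = 0" | "t > 0" | "t < 0" by linarith
    then show ?thesis
    proof cases
      case 1
      then show ?thesis using Gc[OF xa] by simp
    next
      case 2
      let ?y = "of_real (inverse t) *\<^sub>C x"
      have "t * (inverse t * a + c) \<le> t * nrm X (?y + x0)"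
        using 2 c2[OF Gs[OF xa, of "inverse t"]] by (intro mult_left_mono) auto
      also have "\<dots> = nrm X (of_real t *\<^sub>C (?y + x0))"
        using 2 sn_hom[OF X, of "?y + x0" "of_real t"]
        by (simp add: sn_add[OF X] sn_scale[OF X] Gc(1)[OF xa] x0)
      also have "of_real t *\<^sub>C (?y + x0) = x + of_real t *\<^sub>C x0"
        using sc[OF 2] by (simp add: scaleC_add_right)
      finally show ?thesis using 2 by (simp add: distrib_left mult.assoc[symmetric])
    next
      case 3
      let ?s = "- t"
      let ?y = "of_real (inverse ?s) *\<^sub>C x"
      have s: "?s > 0" using 3 by simp
      have "?s * (inverse ?s * a - c) \<le> ?s * nrm X (?y - x0)"
        using s c1[OF Gs[OF xa, of "inverse ?s"]] by (intro mult_left_mono) auto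
      also have "\<dots> = nrm X (of_real ?s *\<^sub>C (?y - x0))"
        using s sn_hom[OF X, of "?y - x0" "of_real ?s"]
        by (simp add: sn_diff[OF X] sn_scale[OF X] Gc(1)[OF xa] x0 del: of_real_minus)
      also have "of_real ?s *\<^sub>C (?y - x0) = x - of_real ?s *\<^sub>C x0"
        using sc[OF s] by (simp add: scaleC_diff_right)
      also have "\<dots> = x + of_real t *\<^sub>C x0"
        using scaleC_add_left[of "of_real t" "- of_real t" x0]
        by (simp add: diff_eq_eq add.assoc)
      finally show ?thesis using 3 by (simp add: right_diff_distrib mult.assoc[symmetric])
    qed
  qed
  have "dominated_graph X G'"
    unfolding dominated_graph_def
  proof (intro conjI allI impI)
    fix x a assume "(x, a) \<in> G'"
    then show "x \<in> carr X" "a \<le> nrm X x"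
      using dom Gc x0 by (auto simp: G'_def intro!: sn_add[OF X] sn_scale[OF X])
  next
    show "(0, 0) \<in> G'"
      unfolding G'_def using G0 by (intro CollectI exI[of _ 0]) auto
  next
    fix x a y b assume "(x, a) \<in> G'" "(y, b) \<in> G'"
    then obtain u d s v e t where
      *: "x = u + of_real s *\<^sub>C x0" "a = d + s * c" "(u, d) \<in> G"
        "y = v + of_real t *\<^sub>C x0" "b = e + t * c" "(v, e) \<in> G"
      by (auto simp: G'_def)
    have "x + y = (u + v) + of_real (s + t) *\<^sub>C x0" "a + b = (d + e) + (s + t) * c"
      by (simp_all add: * scaleC_add_left algebra_simps)
    then show "(x + y, a + b) \<in> G'"
      using Ga[OF *(3,6)] unfolding G'_def by blast
  next
    fix t x a assume "(x, a) \<in> G'"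
    then obtain u d s where *: "x = u + of_real s *\<^sub>C x0" "a = d + s * c" "(u, d) \<in> G"
      by (auto simp: G'_def)
    have "of_real t *\<^sub>C x = of_real t *\<^sub>C u + of_real (t * s) *\<^sub>C x0" "t * a = t * d + (t * s) * c"
      by (simp_all add: * scaleC_add_right scaleC_scaleC algebra_simps)
    then show "(of_real t *\<^sub>C x, t * a) \<in> G'"
      using Gs[OF *(3)] unfolding G'_def by blast
  qed
  moreover have "G \<subseteq> G'"
  proof
    fix p assume "p \<in> G"
    then show "p \<in> G'"
      unfolding G'_def
      by (intro CollectI exI[of _ "fst p"] exI[of _ "snd p"] exI[of _ 0]) auto
  qed
  moreover have "(x0, c) \<in> G'"
    unfolding G'_def using G0 by (intro CollectI exI[of _ 0] exI[of _ 0] exI[of _ 1]) (auto simp: scaleC_one)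
  ultimately show ?thesis by (rule that)
qed

text \<open>Extending a maximal graph at a point of \<open>carr X\<close> gives it back, so it is
  already defined there; for two values at one point both differences are at most
  \<open>nrm X 0 = 0\<close>.\<close>

lemma dominated_graph_total:
  assumes X: "seminormed X" and G: "dominated_graph X G"
  obtains M where "dominated_graph X M" "G \<subseteq> M" "\<And>x. x \<in> carr X \<Longrightarrow> \<exists>!a. (x, a) \<in> M"
proof -
  let ?A = "{H. dominated_graph X H \<and> G \<subseteq> H}"
  have "\<exists>M\<in>?A. \<forall>H\<in>?A. M \<subseteq> H \<longrightarrow> H = M"
  proof (rule subset_Zorn_nonempty)
    show "?A \<noteq> {}" using G by auto
    fix K assume K: "K \<noteq> {}" "subset.chain ?A K"
    then have KA: "K \<subseteq> ?A" and ch: "\<And>H H'. H \<in> K \<Longrightarrow> H' \<in> K \<Longrightarrow> H \<subseteq> H' \<or> H' \<subseteq> H"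
      by (auto simp: subset_chain_def)
    have two: "\<exists>H\<in>K. p \<in> H \<and> q \<in> H" if "p \<in> \<Union>K" "q \<in> \<Union>K" for p q
      using that ch by blast
    have dg: "dominated_graph X H" if "H \<in> K" for H using that KA by blast
    have "dominated_graph X (\<Union>K)"
      unfolding dominated_graph_def
    proof (intro conjI allI impI)
      fix x a assume "(x, a) \<in> \<Union>K"
      then obtain H where "H \<in> K" "(x, a) \<in> H" by blast
      then show "x \<in> carr X" "a \<le> nrm X x" using dg[of H] by (auto simp: dominated_graph_def)
    next
      show "(0, 0) \<in> \<Union>K" using K(1) dg by (auto simp: dominated_graph_def)
    next
      fix x a y b assume "(x, a) \<in> \<Union>K" "(y, b) \<in> \<Union>K"
      then obtain H where H: "H \<in> K" "(x, a) \<in> H" "(y, b) \<in> H" using two by blast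
      then have "(x + y, a + b) \<in> H" using dg[OF H(1)] unfolding dominated_graph_def by blast
      then show "(x + y, a + b) \<in> \<Union>K" using H(1) by blast
    next
      fix t x a assume "(x, a) \<in> \<Union>K"
      then obtain H where H: "H \<in> K" "(x, a) \<in> H" by blast
      then have "(of_real t *\<^sub>C x, t * a) \<in> H" using dg[OF H(1)] unfolding dominated_graph_def by blast
      then show "(of_real t *\<^sub>C x, t * a) \<in> \<Union>K" using H(1) by blast
    qed
    then show "\<Union>K \<in> ?A" using K(1) KA by blast
  qed
  then obtain M where M: "dominated_graph X M" "G \<subseteq> M"
    and max: "\<And>H. dominated_graph X H \<Longrightarrow> M \<subseteq> H \<Longrightarrow> H = M"
    by (auto simp: subset_iff)
  have "\<exists>!a. (x, a) \<in> M" if x: "x \<in> carr X" for x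
  proof -
    obtain H b where H: "dominated_graph X H" "M \<subseteq> H" "(x, b) \<in> H"
      using dominated_graph_extend[OF X M(1) x] by blast
    have "a \<le> a'" if "(x, a) \<in> M" "(x, a') \<in> M" for a a'
    proof -
      have "(of_real (-1) *\<^sub>C x, (-1) * a') \<in> M"
        using that(2) M(1) unfolding dominated_graph_def by blast
      then have "(x + of_real (-1) *\<^sub>C x, a + (-1) * a') \<in> M"
        using that(1) M(1) unfolding dominated_graph_def by blast
      then have "a - a' \<le> nrm X 0"
        using M(1) unfolding dominated_graph_def by (fastforce simp: scaleC_minus1)
      then show ?thesis using sn_nrm_zero[OF X] by simp
    qed
    then show ?thesis using H(3) max[OF H(1,2)] by (auto intro: antisym)
  qed
  then show ?thesis using that M by blast
qed

text \<open>A complex-linear functional is determined by its real part, by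
  \<open>Im (h x) = - Re (h (\<i> *\<^sub>C x))\<close>, so only the real part is extended. The
  bound \<open>N\<close> is absorbed into the seminorm of \<open>Y\<close>.\<close>

lemma hahn_banach:
  assumes X: "seminormed X" and W: "csubspace W" "W \<subseteq> carr X" and f: "clinear_on W f"
    and N: "0 \<le> N" and bound: "\<And>x. x \<in> W \<Longrightarrow> cmod (f x) \<le> N * nrm X x"
  obtains h where "clinear_on (carr X) h" "\<And>x. x \<in> W \<Longrightarrow> h x = f x"
    "\<And>x. x \<in> carr X \<Longrightarrow> cmod (h x) \<le> N * nrm X x"
proof -
  define Y where "Y = \<lparr>carr = carr X, nrm = (\<lambda>x. N * nrm X x)\<rparr>"
  have Y: "seminormed Y"
    using X N unfolding seminormed_def Y_def
    by (auto simp: distrib_left[symmetric] intro!: mult_left_mono)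
  have fadd: "f (x + y) = f x + f y" if "x \<in> W" "y \<in> W" for x y
    using f that by (simp add: clinear_on_def)
  have fsc: "f (c *\<^sub>C x) = c * f x" if "x \<in> W" for x c
    using f that by (simp add: clinear_on_def)
  have W0: "0 \<in> W" using W by (simp add: csubspace_def)
  define G where "G = {(x, Re (f x)) | x. x \<in> W}"
  have "dominated_graph Y G"
    unfolding dominated_graph_def
  proof (intro conjI allI impI)
    fix x a assume "(x, a) \<in> G"
    then have *: "x \<in> W" "a = Re (f x)" by (auto simp: G_def)
    then show "x \<in> carr Y" using W by (auto simp: Y_def)
    show "a \<le> nrm Y x"
      using * bound[OF *(1)] complex_Re_le_cmod[of "f x"] by (simp add: Y_def)
  next
    show "(0, 0) \<in> G" using W0 fsc[OF W0, of 0] by (auto simp: G_def intro!: exI[of _ 0])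
  next
    fix x a y b assume "(x, a) \<in> G" "(y, b) \<in> G"
    then show "(x + y, a + b) \<in> G"
      using W fadd by (auto simp: G_def csubspace_def)
  next
    fix t x a assume "(x, a) \<in> G"
    then show "(of_real t *\<^sub>C x, t * a) \<in> G"
      using W fsc by (auto simp: G_def csubspace_def)
  qed
  then obtain M where M: "dominated_graph Y M" "G \<subseteq> M" "\<And>x. x \<in> carr Y \<Longrightarrow> \<exists>!a. (x, a) \<in> M"
    using dominated_graph_total[OF Y] by blast
  define r where "r x = (THE a. (x, a) \<in> M)" for x
  have rM: "(x, r x) \<in> M" if "x \<in> carr X" for x
    using theI'[OF M(3)] that by (simp add: r_def Y_def)
  have rI: "r x = a" if "(x, a) \<in> M" for x a
  proof -
    have "x \<in> carr Y" using M(1) that unfolding dominated_graph_def by blast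
    then show ?thesis using M(3) that unfolding r_def by (intro the1_equality)
  qed
  have r_le: "r x \<le> N * nrm X x" if "x \<in> carr X" for x
    using rM[OF that] M(1) by (auto simp: dominated_graph_def Y_def)
  have r_add: "r (x + y) = r x + r y" if "x \<in> carr X" "y \<in> carr X" for x y
    using rM[OF that(1)] rM[OF that(2)] M(1) unfolding dominated_graph_def by (intro rI) blast
  have r_sc: "r (of_real t *\<^sub>C x) = t * r x" if "x \<in> carr X" for x t
    using rM[OF that] M(1) unfolding dominated_graph_def by (intro rI) blast
  have r_f: "r x = Re (f x)" if "x \<in> W" for x
    using that M(2) by (intro rI) (auto simp: G_def)
  define h where "h x = Complex (r x) (- r (\<i> *\<^sub>C x))" for x
  have r_c: "r (c *\<^sub>C x) = Re c * r x + Im c * r (\<i> *\<^sub>C x)" if x: "x \<in> carr X" for c x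
  proof -
    have "c *\<^sub>C x = of_real (Re c) *\<^sub>C x + of_real (Im c) *\<^sub>C (\<i> *\<^sub>C x)"
      by (simp add: scaleC_scaleC flip: scaleC_add_left)
        (metis complex_eq mult.commute)
    then show ?thesis using x by (simp add: r_add r_sc sn_scale[OF X])
  qed
  have h_sc: "h (c *\<^sub>C x) = c * h x" if x: "x \<in> carr X" for c x
    using r_c[OF x, of c] r_c[OF x, of "\<i> * c"]
    by (simp add: h_def complex_eq_iff scaleC_scaleC algebra_simps)
  have h_add: "h (x + y) = h x + h y" if "x \<in> carr X" "y \<in> carr X" for x y
    using that by (simp add: h_def complex_eq_iff scaleC_add_right r_add sn_scale[OF X])
  show ?thesis
  proof (rule that)
    show "clinear_on (carr X) h" using h_sc h_add by (simp add: clinear_on_def)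
    show "h x = f x" if "x \<in> W" for x
    proof -
      have "\<i> *\<^sub>C x \<in> W" using W that by (simp add: csubspace_def)
      then show ?thesis using that by (simp add: h_def r_f fsc complex_eq_iff)
    qed
    fix x assume x: "x \<in> carr X"
    \<comment> \<open>Rotation makes the value real and nonnegative, where it is a value of
      \<open>r\<close>; so the complex bound is no worse than the real one.\<close>
    define c where "c = cnj (sgn (h x))"
    have c1: "cmod c \<le> 1" by (simp add: c_def norm_sgn)
    have "c * h x = of_real (cmod (h x))"
      by (simp add: c_def sgn_div_norm scaleR_conv_of_real complex_norm_square[symmetric]
          mult.commute power2_eq_square field_simps)
    then have "cmod (h x) = Re (h (c *\<^sub>C x))" by (simp add: h_sc[OF x])
    also have "\<dots> = r (c *\<^sub>C x)" by (simp add: h_def)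
    also have "\<dots> \<le> N * nrm X (c *\<^sub>C x)" by (intro r_le sn_scale[OF X] x)
    also have "\<dots> \<le> N * (1 * nrm X x)"
      unfolding sn_hom[OF X x] using N c1 sn_nonneg[OF X x] by (intro mult_left_mono mult_right_mono) auto
    finally show "cmod (h x) \<le> N * nrm X x" by simp
  qed
qed

section \<open>Square-summable sequences\<close>

definition l2 :: "(nat \<Rightarrow> complex) \<Rightarrow> bool" where
  "l2 v \<longleftrightarrow> summable (\<lambda>n. (cmod (v n))\<^sup>2)"

definition l2norm :: "(nat \<Rightarrow> complex) \<Rightarrow> real" where
  "l2norm v = sqrt (\<Sum>n. (cmod (v n))\<^sup>2)"

lemma l2_add:
  assumes "l2 u" "l2 v"
  shows "l2 (u + v)"
  unfolding l2_def
proof (rule summable_comparison_test')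
  show "summable (\<lambda>n. 2 * (cmod (u n))\<^sup>2 + 2 * (cmod (v n))\<^sup>2)"
    using assms by (intro summable_add summable_mult) (auto simp: l2_def)
  fix n
  have "(cmod (u n + v n))\<^sup>2 \<le> (cmod (u n) + cmod (v n))\<^sup>2"
    by (intro power_mono norm_triangle_ineq) auto
  also have "\<dots> \<le> 2 * (cmod (u n))\<^sup>2 + 2 * (cmod (v n))\<^sup>2"
    using zero_le_power2[of "cmod (u n) - cmod (v n)"] by (simp add: power2_eq_square algebra_simps)
  finally show "norm ((cmod ((u + v) n))\<^sup>2) \<le> 2 * (cmod (u n))\<^sup>2 + 2 * (cmod (v n))\<^sup>2" by simp
qed

lemma l2_scale: "l2 v \<Longrightarrow> l2 (c *\<^sub>C v)"
  using summable_mult[of "\<lambda>n. (cmod (v n))\<^sup>2" "(cmod c)\<^sup>2"]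
  by (simp add: l2_def norm_mult power_mult_distrib)

lemma l2_finite:
  assumes "\<And>n. n \<ge> N \<Longrightarrow> v n = 0"
  shows "l2 v" "(\<Sum>n. (cmod (v n))\<^sup>2) = (\<Sum>n<N. (cmod (v n))\<^sup>2)"
  using summable_finite[of "{..<N}" "\<lambda>n. (cmod (v n))\<^sup>2"] suminf_finite[of "{..<N}" "\<lambda>n. (cmod (v n))\<^sup>2"] assms
  by (auto simp: l2_def)

lemma l2norm_le:
  assumes "l2 v" "\<And>N. (\<Sum>n<N. (cmod (v n))\<^sup>2) \<le> M\<^sup>2" "0 \<le> M"
  shows "l2norm v \<le> M"
  unfolding l2norm_def using assms
  by (intro real_le_lsqrt suminf_le_const) (auto simp: l2_def suminf_nonneg)

text \<open>Closes the duality estimates: testing a truncated sequence against its own conjugate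
  gives the square sum on the left, and its root times a bound on the right.\<close>

lemma sqrt_le_if_le_mult_sqrt:
  assumes "s \<le> M * sqrt s" "0 \<le> s" "0 \<le> M"
  shows "sqrt s \<le> M"
proof (cases "s = 0")
  case False
  then have "sqrt s * sqrt s \<le> M * sqrt s" "0 < sqrt s" using assms by simp_all
  then show ?thesis by (rule mult_right_le_imp_le)
qed (use assms in simp)

text \<open>The representation is bilinear, without conjugation, to match \<open>pair_term\<close>.
  The coefficients are the values on unit vectors; their norm is read off from the truncated
  conjugate of \<open>\<alpha>\<close>, and convergence holds because the norm of a truncation error
  is the root of a tail.\<close>

lemma l2_riesz:
  assumes add: "\<And>u v. l2 u \<Longrightarrow> l2 v \<Longrightarrow> \<phi> (u + v) = \<phi> u + \<phi> v"
    and sc: "\<And>c v. l2 v \<Longrightarrow> \<phi> (c *\<^sub>C v) = c * \<phi> v"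
    and bd: "\<And>v. l2 v \<Longrightarrow> cmod (\<phi> v) \<le> M * l2norm v" and M: "0 \<le> M"
  obtains \<alpha> where "l2 \<alpha>" "l2norm \<alpha> \<le> M" "\<And>v. l2 v \<Longrightarrow> (\<lambda>n. \<alpha> n * v n) sums \<phi> v"
proof -
  define e :: "nat \<Rightarrow> nat \<Rightarrow> complex" where "e k = (\<lambda>n. if n = k then 1 else 0)" for k
  define \<alpha> where "\<alpha> k = \<phi> (e k)" for k
  define trunc :: "nat \<Rightarrow> (nat \<Rightarrow> complex) \<Rightarrow> nat \<Rightarrow> complex"
    where "trunc N v = (\<lambda>n. if n < N then v n else 0)" for N v
  have l2e: "l2 (e k)" for k by (rule l2_finite[of "Suc k"]) (simp add: e_def)
  have l2t: "l2 (trunc N v)" for N v by (rule l2_finite[of N]) (simp add: trunc_def)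
  have \<phi>t: "\<phi> (trunc N v) = (\<Sum>n<N. \<alpha> n * v n)" for N v
  proof (induction N)
    case 0
    have "trunc 0 v = 0" by (simp add: trunc_def fun_eq_iff)
    then show ?case using sc[OF l2e[of 0], of 0] by (simp add: zero_fun_def)
  next
    case (Suc N)
    have "trunc (Suc N) v = trunc N v + v N *\<^sub>C e N"
      by (auto simp: trunc_def e_def fun_eq_iff less_Suc_eq)
    then have "\<phi> (trunc (Suc N) v) = \<phi> (trunc N v) + v N * \<alpha> N"
      by (simp only: add[OF l2t l2_scale[OF l2e]] sc[OF l2e] \<alpha>_def)
    then show ?case by (simp add: Suc)
  qed
  have \<alpha>_le: "(\<Sum>n<N. (cmod (\<alpha> n))\<^sup>2) \<le> M\<^sup>2" for N
  proof -
    define s where "s = (\<Sum>n<N. (cmod (\<alpha> n))\<^sup>2)"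
    have s0: "s \<ge> 0" by (simp add: s_def sum_nonneg)
    let ?v = "trunc N (\<lambda>n. cnj (\<alpha> n))"
    have "\<phi> ?v = of_real s"
      unfolding \<phi>t s_def by (simp only: of_real_sum complex_norm_square)
    moreover have "l2norm ?v = sqrt s"
      unfolding l2norm_def s_def
      by (subst l2_finite(2)[of N]) (auto simp: trunc_def intro!: sum.cong arg_cong[of _ _ sqrt])
    ultimately have "s \<le> M * sqrt s" using bd[OF l2t, of N "\<lambda>n. cnj (\<alpha> n)"] s0 by simp
    then have "sqrt s \<le> M" using M s0 by (intro sqrt_le_if_le_mult_sqrt)
    then show ?thesis using power_mono[of "sqrt s" M 2] s0 by (simp add: s_def)
  qed
  have l2\<alpha>: "l2 \<alpha>"
    unfolding l2_def using \<alpha>_le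
    by (intro summableI_nonneg_bounded[where x = "M\<^sup>2"]) auto
  have "(\<lambda>n. \<alpha> n * v n) sums \<phi> v" if v: "l2 v" for v
    unfolding sums_def
  proof (rule LIM_zero_cancel, rule Lim_null_comparison)
    let ?S = "\<lambda>N. \<Sum>n<N. (cmod (v n))\<^sup>2"
    let ?s = "\<Sum>n. (cmod (v n))\<^sup>2"
    have "(\<lambda>N. M * sqrt (?s - ?S N)) \<longlonglongrightarrow> M * sqrt (?s - ?s)"
      using v by (intro tendsto_intros summable_LIMSEQ) (simp add: l2_def)
    then show "(\<lambda>N. M * sqrt (?s - ?S N)) \<longlonglongrightarrow> 0" by simp
    have "norm ((\<Sum>n<N. \<alpha> n * v n) - \<phi> v) \<le> M * sqrt (?s - ?S N)" for N
    proof -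
      define w where "w = v + (-1) *\<^sub>C trunc N v"
      have w: "l2 w" unfolding w_def by (intro l2_add l2_scale v l2t)
      have "\<phi> w = \<phi> v - (\<Sum>n<N. \<alpha> n * v n)"
        unfolding w_def using add[OF v l2_scale[OF l2t]] sc[OF l2t] by (simp add: \<phi>t)
      moreover have "l2norm w = sqrt (?s - ?S N)"
      proof -
        have eq: "(cmod (w n))\<^sup>2 = (cmod (v n))\<^sup>2 - (cmod (trunc N v n))\<^sup>2" for n
          by (simp add: w_def trunc_def)
        have "(\<Sum>n. (cmod (w n))\<^sup>2) = ?s - (\<Sum>n. (cmod (trunc N v n))\<^sup>2)"
          unfolding eq using v l2t by (intro suminf_diff[symmetric]) (auto simp: l2_def)
        also have "(\<Sum>n. (cmod (trunc N v n))\<^sup>2) = ?S N"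
          by (subst l2_finite(2)[of N]) (auto simp: trunc_def)
        finally show ?thesis by (simp add: l2norm_def)
      qed
      ultimately show ?thesis using bd[OF w] by (simp add: norm_minus_commute)
    qed
    then show "\<forall>\<^sub>F N in sequentially. norm ((\<Sum>n<N. \<alpha> n * v n) - \<phi> v) \<le> M * sqrt (?s - ?S N)"
      by simp
  qed
  then show ?thesis using that[OF l2\<alpha> l2norm_le[OF l2\<alpha> \<alpha>_le M]] by blast
qed

section \<open>Unbounded weights\<close>

text \<open>Multiplying the moduli by weights tending to infinity makes the boundary values of the test
  functions vanish at infinity in the coordinate, so that their unbounded frequencies do not
  spoil norm continuity. The weights are the inverse roots of the tails of \<open>\<Sum> a n + 2\<^bsup>-n-1\<^esup>\<close>.\<close>

lemma unbounded_weights: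
  fixes a :: "nat \<Rightarrow> real"
  assumes a0: "\<And>n. 0 \<le> a n" and sa: "summable a" and a1: "suminf a \<le> 1"
  obtains w where "\<And>n. 1/2 \<le> w n" "\<And>n. (w n)\<^sup>2 * a n \<le> 1" "(\<lambda>n. inverse (w n)) \<longlonglongrightarrow> 0"
    "summable (\<lambda>n. w n * a n)" "(\<Sum>n. w n * a n) \<le> 3"
proof -
  \<comment> \<open>The geometric summand keeps all tails positive, even if \<open>a\<close> is
    eventually 0, and adds only 1 to the total, so \<open>r 0 \<le> 2\<close>.\<close>
  define b where "b n = a n + (1/2) ^ Suc n" for n
  have sb: "summable b" unfolding b_def
    by (intro summable_add sa summable_Suc_iff[THEN iffD2] summable_geometric) auto
  have b0: "0 < b n" "a n \<le> b n" for n using a0[of n] by (auto simp: b_def add_nonneg_pos)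
  define r where "r n = (\<Sum>k. b (k + n))" for n
  have sbn: "summable (\<lambda>k. b (k + n))" for n by (rule summable_ignore_initial_segment[OF sb])
  have r_pos: "0 < r n" for n unfolding r_def using b0 by (intro suminf_pos sbn)
  have r_step: "r n = b n + r (Suc n)" for n
    unfolding r_def using suminf_split_head[OF sbn[of n]] by simp
  have r_b: "b n \<le> r n" for n using r_step[of n] r_pos[of "Suc n"] by simp
  have r0: "r 0 \<le> 2"
  proof -
    have "r 0 = suminf a + (\<Sum>n. (1/2) ^ Suc n)"
      unfolding r_def b_def using suminf_add[OF sa, of "\<lambda>n. (1/2) ^ Suc n"]
      by (simp add: summable_Suc_iff[of "\<lambda>n. (1/2::real) ^ n"] del: power_Suc)
    also have "(\<Sum>n. (1/2::real) ^ Suc n) = 1" using power_half_series by (simp add: sums_iff)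
    finally show ?thesis using a1 by simp
  qed
  have r_dec: "r n \<le> 2" for n
  proof (induction n)
    case (Suc n)
    then show ?case using r_step[of n] b0(1)[of n] by linarith
  qed (rule r0)
  have r_lim: "r \<longlonglongrightarrow> 0"
    unfolding r_def using suminf_exist_split2[OF sb] by simp
  define w where "w n = 1 / sqrt (r n)" for n
  \<comment> \<open>Telescoping by \<open>(r N - r (Suc N)) / sqrt (r N) \<le> 2 * (sqrt (r N) -
    sqrt (r (Suc N)))\<close>; since \<open>r 0 \<le> 2\<close>, the total stays below 3.\<close>
  have part: "(\<Sum>n<N. w n * a n) \<le> 2 * sqrt (r 0) - 2 * sqrt (r N)" for N
  proof (induction N)
    case 0
    then show ?case by simp
  next
    case (Suc N)
    let ?x = "sqrt (r N)" and ?y = "sqrt (r (Suc N))"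
    have x: "?x > 0" using r_pos by simp
    have y: "0 \<le> ?y" "?y \<le> ?x" using r_pos[of "Suc N"] r_step[of N] b0(1)[of N] by simp_all
    have "w N * a N \<le> b N / ?x"
      using b0[of N] x by (simp add: w_def divide_right_mono)
    also have "b N = ?x\<^sup>2 - ?y\<^sup>2"
      using r_step[of N] real_sqrt_pow2[of "r N"] real_sqrt_pow2[of "r (Suc N)"]
        r_pos[of N] r_pos[of "Suc N"] by linarith
    also have "(?x\<^sup>2 - ?y\<^sup>2) / ?x = (?x - ?y) * ((?x + ?y) / ?x)"
      by (simp add: power2_eq_square algebra_simps)
    also have "\<dots> \<le> (?x - ?y) * 2"
      using x y by (intro mult_left_mono) (auto simp: field_simps)
    finally show ?case using Suc by simp
  qed
  have part3: "(\<Sum>n<N. w n * a n) \<le> 3" for N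
  proof -
    have "sqrt (r 0) \<le> sqrt ((3/2)\<^sup>2)"
      using r0 by (intro real_sqrt_le_mono) (simp add: power2_eq_square)
    then have "sqrt (r 0) \<le> 3/2" by simp
    moreover have "0 \<le> sqrt (r N)" using r_pos[of N] by simp
    ultimately show ?thesis using part[of N] by linarith
  qed
  have wpos: "0 < w n" for n using r_pos by (simp add: w_def)
  show ?thesis
  proof (rule that)
    show "1/2 \<le> w n" for n
    proof -
      have "sqrt (r n) \<le> sqrt (2\<^sup>2)" using r_dec[of n] by (intro real_sqrt_le_mono) simp
      then show ?thesis using r_pos[of n] by (simp add: w_def field_simps)
    qed
    show "(w n)\<^sup>2 * a n \<le> 1" for n
      using r_pos[of n] r_b[of n] b0[of n] by (simp add: w_def power_divide)
    show "(\<lambda>n. inverse (w n)) \<longlonglongrightarrow> 0"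
      using tendsto_real_sqrt[OF r_lim] by (simp add: w_def)
    show sw: "summable (\<lambda>n. w n * a n)"
      using part3 wpos a0 by (intro summableI_nonneg_bounded[where x = 3] mult_nonneg_nonneg) (auto intro: less_imp_le)
    show "(\<Sum>n. w n * a n) \<le> 3" by (rule suminf_le_const[OF sw part3])
  qed
qed

section \<open>Functionals on the Calderon space\<close>

lemma l2norm_eq_0:
  assumes "l2 v" "l2norm v = 0"
  shows "v = 0"
proof
  fix n
  have "(\<Sum>n. (cmod (v n))\<^sup>2) = 0" using assms(2) by (simp add: l2norm_def)
  then show "v n = 0 n"
    using assms(1) suminf_eq_zero_iff[of "\<lambda>n. (cmod (v n))\<^sup>2"] by (simp add: l2_def)
qed

text \<open>For the normalised moduli \<open>t\<close>, the choice
  \<open>exp (L n / 2) = w n * t n\<close> balances the edges: where \<open>t n > 0\<close>, the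
  left one gets \<open>inverse (w n)\<close>, which is at most 2 and tends to 0, the right one
  \<open>w n * (t n)\<^sup>2\<close>, with sum at most 3. Placing the sequence at level
  \<open>j\<close> of the polynomial leaves the lower levels empty; the higher ones come out as they
  may. The constant is \<open>8 * 3\<close>.\<close>

lemma l2_lift:
  assumes v: "l2 v" and j: "j \<le> 2"
  obtains F where "F \<in> carr \<C>" "nrm \<C> F \<le> 24 * l2norm v" "\<Delta> j F = v" "\<And>i. i < j \<Longrightarrow> \<Delta> i F = 0"
proof (cases "l2norm v = 0")
  case True
  then have "v = 0" using v by (rule l2norm_eq_0[rotated])
  then show ?thesis
    using True cal_zero sn_nrm_zero[OF seminormed_cal] \<Delta>_zero j by (intro that[of 0]) auto
next
  case False
  define s where "s = l2norm v"
  have s: "s > 0" using False by (simp add: s_def l2norm_def less_le suminf_nonneg v[unfolded l2_def])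
  have s2: "s\<^sup>2 = (\<Sum>n. (cmod (v n))\<^sup>2)"
    by (simp add: s_def l2norm_def suminf_nonneg v[unfolded l2_def])
  define t where "t n = cmod (v n) / s" for n
  have t0: "0 \<le> t n" for n using s by (simp add: t_def)
  have ts: "summable (\<lambda>n. (t n)\<^sup>2)" "(\<Sum>n. (t n)\<^sup>2) \<le> 1"
    using v s by (simp_all add: t_def power_divide l2_def suminf_divide s2[symmetric])
  obtain w where w: "\<And>n. 1/2 \<le> w n" "\<And>n. (w n)\<^sup>2 * (t n)\<^sup>2 \<le> 1"
    "(\<lambda>n. inverse (w n)) \<longlonglongrightarrow> 0" "summable (\<lambda>n. w n * (t n)\<^sup>2)" "(\<Sum>n. w n * (t n)\<^sup>2) \<le> 3"
    by (rule unbounded_weights[OF zero_le_power2 ts]) (rule that)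
  have w0: "0 < w n" for n using w(1)[of n] by linarith
  define L where "L n = 2 * ln (w n * t n)" for n
  have eL: "exp (L n / 2) = w n * t n" "exp (- L n / 2) = inverse (w n * t n)" if "t n > 0" for n
    using that w0[of n] by (simp_all add: L_def exp_minus)
  have m: "t n * exp (- L n / 2) \<le> inverse (w n)" and p: "t n * exp (L n / 2) = w n * (t n)\<^sup>2" for n
    using w0[of n] t0[of n] eL[of n] by (cases "t n = 0"; simp add: power2_eq_square)+
  have iw: "inverse (w n) \<le> 2" for n
    using w(1)[of n] w0[of n] by (simp add: field_simps)
  define c where "c i n = (if i = j then v n / of_real s else 0)" for i n
  obtain F where F: "F \<in> carr \<C>" "nrm \<C> F \<le> 8 * 3" "\<Delta> 0 F = c 0"
    "\<Delta> 1 F = (\<lambda>n. c 1 n + of_real (L n) * c 0 n)"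
    "\<Delta> 2 F = (\<lambda>n. c 2 n + of_real (L n) * c 1 n + (of_real (L n) ^ 2 / 2 + 1) * c 0 n)"
  proof (rule test_family[of "c 0" "c 1" "c 2" t L 3])
    show "cmod (c 0 n) + cmod (c 1 n) + cmod (c 2 n) \<le> t n" for n
      using j s by (simp add: c_def t_def norm_divide)
    show "(\<lambda>n. t n * exp (- L n / 2)) \<longlonglongrightarrow> 0"
      by (rule Lim_null_comparison[OF _ w(3)]) (use m t0 in \<open>simp add: abs_mult\<close>)
    show "t n * exp (- L n / 2) \<le> 3" for n
      using m[of n] iw[of n] by linarith
    show "summable (\<lambda>n. t n * exp (L n / 2))" "(\<Sum>n. t n * exp (L n / 2)) \<le> 3"
      unfolding p by (rule w)+
  qed (rule that)
  have \<Delta>F: "\<Delta> i F = c i" if "i \<le> j" for i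
  proof -
    have "i = 0 \<or> i = 1 \<or> i = 2" using that j by linarith
    then show ?thesis using that F(3-5) j by (auto simp: c_def fun_eq_iff)
  qed
  show ?thesis
  proof (rule that)
    show "of_real s *\<^sub>C F \<in> carr \<C>" by (rule cal_scale[OF F(1)])
    show "nrm \<C> (of_real s *\<^sub>C F) \<le> 24 * l2norm v"
      using sn_hom[OF seminormed_cal F(1), of "of_real s"] F(2) s by (simp add: s_def)
    show "\<Delta> j (of_real s *\<^sub>C F) = v"
      using \<Delta>_scale[OF F(1) j] \<Delta>F[of j] s by (simp add: c_def fun_eq_iff)
    show "\<Delta> i (of_real s *\<^sub>C F) = 0" if "i < j" for i
      using \<Delta>_scale[OF F(1), of i] \<Delta>F[of i] that j by (simp add: c_def fun_eq_iff)
  qed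
qed

text \<open>The levels add up to 2, so only one of the three products survives: on leading
  coefficients the pairing is, up to sign, the bilinear l_2 pairing.\<close>

lemma pair_term_lowest:
  assumes "j \<le> 2" "\<And>i. i < j \<Longrightarrow> \<Delta> i F = 0" "\<And>i. i < 2 - j \<Longrightarrow> \<Delta> i G = 0"
  shows "pair_term F G n = (-1) ^ j * (\<Delta> j F n * \<Delta> (2 - j) G n)"
proof -
  consider "j = 0" | "j = 1" | "j = 2" using assms(1) by linarith
  then show ?thesis
    by cases (use assms(2)[of 0] assms(2)[of 1] assms(3)[of 0] assms(3)[of 1] in
      \<open>simp_all add: pair_term_def\<close>)
qed

text \<open>Duality with \<open>l2_lift\<close>: the conjugate of the truncated coefficient is
  lifted at the complementary level \<open>2 - j\<close> and paired with \<open>F\<close>. The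
  constant is \<open>16 * 24\<close>, from the pairing and from the lift.\<close>

lemma lowest_coefficient_l2:
  assumes F: "F \<in> carr \<C>" and j: "j \<le> 2" and low: "\<And>i. i < j \<Longrightarrow> \<Delta> i F = 0"
  shows "l2 (\<Delta> j F)" "l2norm (\<Delta> j F) \<le> 384 * nrm \<C> F"
proof -
  let ?x = "\<Delta> j F" and ?M = "384 * nrm \<C> F"
  have nF: "0 \<le> nrm \<C> F" by (rule sn_nonneg[OF seminormed_cal F])
  have S: "(\<Sum>n<N. (cmod (?x n))\<^sup>2) \<le> ?M\<^sup>2" for N
  proof -
    define S where "S = (\<Sum>n<N. (cmod (?x n))\<^sup>2)"
    have S0: "0 \<le> S" by (simp add: S_def sum_nonneg)
    define v where "v n = (if n < N then cnj (?x n) else 0)" for n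
    have v: "l2 v" "l2norm v = sqrt S"
      using l2_finite[of N v] by (auto simp: l2norm_def S_def v_def)
    obtain G where G: "G \<in> carr \<C>" "nrm \<C> G \<le> 24 * sqrt S" "\<Delta> (2 - j) G = v"
      "\<And>i. i < 2 - j \<Longrightarrow> \<Delta> i G = 0"
      using l2_lift[OF v(1), of "2 - j"] unfolding v(2) by auto
    have "S = (\<Sum>n<N. cmod (pair_term F G n))"
      unfolding S_def
    proof (intro sum.cong refl)
      fix n assume "n \<in> {..<N}"
      moreover have "pair_term F G n = (-1) ^ j * (\<Delta> j F n * \<Delta> (2 - j) G n)"
        by (intro pair_term_lowest j low G(4))
      ultimately show "(cmod (?x n))\<^sup>2 = cmod (pair_term F G n)"
        by (simp add: G(3) v_def norm_mult norm_power power2_eq_square)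
    qed
    also have "\<dots> \<le> 16 * (nrm \<C> F * nrm \<C> G)" by (intro pair_term_sum_le F G) simp
    also have "\<dots> \<le> 16 * (nrm \<C> F * (24 * sqrt S))"
      using nF G(2) by (intro mult_left_mono) auto
    finally have "S \<le> ?M * sqrt S" by simp
    then have "sqrt S \<le> ?M" using nF S0 by (intro sqrt_le_if_le_mult_sqrt) auto
    then have "(sqrt S)\<^sup>2 \<le> ?M\<^sup>2" using S0 by (intro power_mono) auto
    then show ?thesis using S0 by (simp add: S_def)
  qed
  show l: "l2 ?x"
    unfolding l2_def using S by (intro summableI_nonneg_bounded[where x = "?M\<^sup>2"]) auto
  show "l2norm ?x \<le> ?M" by (rule l2norm_le[OF l S]) (use nF in simp)
qed

lemma clinear_on_diff:
  assumes "clinear_on V T" "csubspace V" "x \<in> V" "y \<in> V"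
  shows "T (x - y) = T x - T y"
proof -
  have "(-1) *\<^sub>C y \<in> V" using assms by (simp add: csubspace_def)
  then have "T (x + (-1) *\<^sub>C y) = T x + (-1) *\<^sub>C T y"
    using assms by (simp add: clinear_on_def)
  then show ?thesis by (simp add: scaleC_minus1)
qed

lemma csubspace_cal: "csubspace (carr \<C>)"
  using seminormed_cal by (simp add: seminormed_def)

lemma cal_diff: "F \<in> carr \<C> \<Longrightarrow> G \<in> carr \<C> \<Longrightarrow> F - G \<in> carr \<C>"
  by (rule csubspace_diff[OF csubspace_cal])

text \<open>By \<open>van\<close>, the value of the functional on functions starting at level
  \<open>j\<close> depends only on their leading coefficient, an arbitrary l_2 sequence. Riesz
  representation turns it into an l_2 sequence, which is lifted at level \<open>2 - j\<close> to
  give \<open>G\<close>. Each of the two lifts costs a factor 24, hence 576. The formula is claimed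
  only for functions starting at level \<open>j\<close>.\<close>

lemma functional_step:
  assumes j: "j \<le> 2" and lin: "clinear_on (carr \<C>) \<psi>"
    and N: "0 \<le> N" and bd: "\<And>F. F \<in> carr \<C> \<Longrightarrow> cmod (\<psi> F) \<le> N * nrm \<C> F"
    and van: "\<And>F. F \<in> carr \<C> \<Longrightarrow> (\<And>i. i \<le> j \<Longrightarrow> \<Delta> i F = 0) \<Longrightarrow> \<psi> F = 0"
  obtains G where "G \<in> carr \<C>" "nrm \<C> G \<le> 576 * N"
    "\<And>F. F \<in> carr \<C> \<Longrightarrow> (\<And>i. i < j \<Longrightarrow> \<Delta> i F = 0) \<Longrightarrow> \<psi> F = pairing F G"
proof -
  define lifts where "lifts v F \<longleftrightarrow>
    F \<in> carr \<C> \<and> nrm \<C> F \<le> 24 * l2norm v \<and> \<Delta> j F = v \<and> (\<forall>i<j. \<Delta> i F = 0)" for v F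
  define W where "W v = (SOME F. lifts v F)" for v
  have "\<exists>F. lifts v F" if "l2 v" for v
    using l2_lift[OF that j] unfolding lifts_def by metis
  then have lifts_W: "lifts v (W v)" if "l2 v" for v
    using that someI_ex[of "lifts v"] by (simp add: W_def)
  have W: "W v \<in> carr \<C>" "nrm \<C> (W v) \<le> 24 * l2norm v" "\<Delta> j (W v) = v"
    "\<And>i. i < j \<Longrightarrow> \<Delta> i (W v) = 0" if "l2 v" for v
    using lifts_W[OF that] by (auto simp: lifts_def)
  have same: "\<psi> F = \<psi> F'"
    if "F \<in> carr \<C>" "F' \<in> carr \<C>" "\<And>i. i < j \<Longrightarrow> \<Delta> i F = \<Delta> i F'" "\<Delta> j F = \<Delta> j F'" for F F'
  proof -
    have "\<Delta> i F = \<Delta> i F'" if "i \<le> j" for i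
      using \<open>\<And>i. i < j \<Longrightarrow> \<Delta> i F = \<Delta> i F'\<close> \<open>\<Delta> j F = \<Delta> j F'\<close> that by (cases "i = j") auto
    then have "\<psi> (F - F') = 0"
      using that j by (intro van cal_diff) (simp_all add: \<Delta>_diff)
    then show ?thesis using clinear_on_diff[OF lin csubspace_cal that(1,2)] by simp
  qed
  define \<phi> where "\<phi> v = \<psi> (W v)" for v
  obtain \<alpha> where \<alpha>: "l2 \<alpha>" "l2norm \<alpha> \<le> 24 * N" "\<And>v. l2 v \<Longrightarrow> (\<lambda>n. \<alpha> n * v n) sums \<phi> v"
  proof (rule l2_riesz[of \<phi> "24 * N"])
    fix u v assume uv: "l2 u" "l2 v"
    have "\<psi> (W (u + v)) = \<psi> (W u + W v)"
      using W[OF uv(1)] W[OF uv(2)] W[OF l2_add[OF uv]] j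
      by (intro same cal_add) (simp_all add: \<Delta>_add)
    then show "\<phi> (u + v) = \<phi> u + \<phi> v"
      using lin W(1)[OF uv(1)] W(1)[OF uv(2)] by (simp add: \<phi>_def clinear_on_def)
  next
    fix c v assume v: "l2 v"
    have "\<psi> (W (c *\<^sub>C v)) = \<psi> (c *\<^sub>C W v)"
      using W[OF v] W[OF l2_scale[OF v, of c]] j
      by (intro same cal_scale) (simp_all add: \<Delta>_scale)
    then show "\<phi> (c *\<^sub>C v) = c * \<phi> v"
      using lin W(1)[OF v] by (simp add: \<phi>_def clinear_on_def)
  next
    fix v assume v: "l2 v"
    have "cmod (\<phi> v) \<le> N * nrm \<C> (W v)" unfolding \<phi>_def by (intro bd W v)
    also have "\<dots> \<le> N * (24 * l2norm v)" using N W(2)[OF v] by (rule mult_left_mono[rotated])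
    finally show "cmod (\<phi> v) \<le> 24 * N * l2norm v" by simp
  qed (use N in auto)
  have l2s: "l2norm ((-1) ^ j *\<^sub>C \<alpha>) = l2norm \<alpha>"
    by (simp add: l2norm_def norm_mult norm_power)
  \<comment> \<open>The sign cancels the one in \<open>pair_term_lowest\<close>.\<close>
  obtain G where G: "G \<in> carr \<C>" "nrm \<C> G \<le> 24 * l2norm \<alpha>" "\<Delta> (2 - j) G = (-1) ^ j *\<^sub>C \<alpha>"
    "\<And>i. i < 2 - j \<Longrightarrow> \<Delta> i G = 0"
    using l2_lift[OF l2_scale[OF \<alpha>(1), of "(-1) ^ j"], of "2 - j"] unfolding l2s by auto
  show ?thesis
  proof (rule that[OF G(1)])
    show "nrm \<C> G \<le> 576 * N" using G(2) \<alpha>(2) by linarith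
    fix F assume F: "F \<in> carr \<C>" and low: "\<And>i. i < j \<Longrightarrow> \<Delta> i F = 0"
    have l: "l2 (\<Delta> j F)" by (rule lowest_coefficient_l2[OF F j low])
    have "\<psi> F = \<phi> (\<Delta> j F)"
      unfolding \<phi>_def using F low W[OF l] by (intro same) simp_all
    also have "\<dots> = (\<Sum>n. \<alpha> n * \<Delta> j F n)" using \<alpha>(3)[OF l] by (simp add: sums_iff)
    also have "\<dots> = pairing F G"
    proof -
      have sq: "(-1) ^ j * ((-1) ^ j * z) = z" for z :: complex
        by (simp add: mult.assoc[symmetric] flip: power_mult_distrib)
      have "pair_term F G n = \<alpha> n * \<Delta> j F n" for n
      proof -
        have "pair_term F G n = (-1) ^ j * (\<Delta> j F n * \<Delta> (2 - j) G n)"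
          by (intro pair_term_lowest j low G(4))
        also have "\<dots> = \<alpha> n * \<Delta> j F n"
          using sq[of "\<alpha> n * \<Delta> j F n"] by (simp add: G(3) mult_ac)
        finally show ?thesis .
      qed
      then show ?thesis by (simp add: pairing_def)
    qed
    finally show "\<psi> F = pairing F G" .
  qed
qed

text \<open>The levels are treated in the order 2, 1, 0: after the step at level j, the functional
  minus the pairing vanishes where all coefficients below j vanish, which is the hypothesis of the
  step at level j - 1. Each subtraction multiplies the bound by \<open>1 + 16 * 576 = 9217\<close>,
  and \<open>576 * (1 + 9217 + 9217^2)\<close> is below \<open>10 ^ 11\<close>.\<close>

lemma functional_representation:
  assumes lin: "clinear_on (carr \<C>) \<psi>"
    and N: "0 \<le> N" and bd: "\<And>F. F \<in> carr \<C> \<Longrightarrow> cmod (\<psi> F) \<le> N * nrm \<C> F"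
    and van: "\<And>F. F \<in> carr \<C> \<Longrightarrow> \<Delta> 0 F = 0 \<Longrightarrow> \<Delta> 1 F = 0 \<Longrightarrow> \<Delta> 2 F = 0 \<Longrightarrow> \<psi> F = 0"
  obtains G where "G \<in> carr \<C>" "nrm \<C> G \<le> 10 ^ 11 * N" "\<And>F. F \<in> carr \<C> \<Longrightarrow> \<psi> F = pairing F G"
proof -
  have lin_diff: "clinear_on (carr \<C>) (\<lambda>F. \<phi> F - pairing F G)"
    if "clinear_on (carr \<C>) \<phi>" "G \<in> carr \<C>" for \<phi> G
    using that by (auto simp: clinear_on_def pairing_add_left pairing_scale_left algebra_simps)
  have bd_diff: "cmod (\<phi> F - pairing F G) \<le> 9217 * M * nrm \<C> F"
    if "\<And>F. F \<in> carr \<C> \<Longrightarrow> cmod (\<phi> F) \<le> M * nrm \<C> F" "G \<in> carr \<C>" "nrm \<C> G \<le> 576 * M" "F \<in> carr \<C>"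
    for \<phi> G F M
  proof -
    have "cmod (\<phi> F - pairing F G) \<le> M * nrm \<C> F + 16 * (nrm \<C> F * nrm \<C> G)"
      by (intro norm_triangle_le_diff add_mono that pairing_le)
    also have "\<dots> \<le> M * nrm \<C> F + 16 * (nrm \<C> F * (576 * M))"
      using that sn_nonneg[OF seminormed_cal] by (intro add_left_mono mult_left_mono) auto
    finally show ?thesis by (simp add: algebra_simps)
  qed
  obtain G2 where G2: "G2 \<in> carr \<C>" "nrm \<C> G2 \<le> 576 * N"
    "\<And>F. F \<in> carr \<C> \<Longrightarrow> (\<And>i. i < 2 \<Longrightarrow> \<Delta> i F = 0) \<Longrightarrow> \<psi> F = pairing F G2"
    using functional_step[of 2 \<psi> N, OF _ lin N bd] van by auto
  define \<psi>1 where "\<psi>1 F = \<psi> F - pairing F G2" for F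
  obtain G1 where G1: "G1 \<in> carr \<C>" "nrm \<C> G1 \<le> 576 * (9217 * N)"
    "\<And>F. F \<in> carr \<C> \<Longrightarrow> (\<And>i. i < 1 \<Longrightarrow> \<Delta> i F = 0) \<Longrightarrow> \<psi>1 F = pairing F G1"
  proof (rule functional_step[of 1 \<psi>1 "9217 * N"])
    show "clinear_on (carr \<C>) \<psi>1" unfolding \<psi>1_def by (rule lin_diff[OF lin G2(1)])
    show "cmod (\<psi>1 F) \<le> 9217 * N * nrm \<C> F" if "F \<in> carr \<C>" for F
      unfolding \<psi>1_def by (rule bd_diff[OF bd G2(1,2) that])
    show "\<psi>1 F = 0" if "F \<in> carr \<C>" "\<And>i. i \<le> 1 \<Longrightarrow> \<Delta> i F = 0" for F
      using G2(3)[OF that(1)] that(2) by (simp add: \<psi>1_def)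
  qed (use N that in auto)
  define \<psi>2 where "\<psi>2 F = \<psi>1 F - pairing F G1" for F
  have lin1: "clinear_on (carr \<C>) \<psi>1" unfolding \<psi>1_def by (rule lin_diff[OF lin G2(1)])
  have bd1: "cmod (\<psi>1 F) \<le> 9217 * N * nrm \<C> F" if "F \<in> carr \<C>" for F
      unfolding \<psi>1_def by (rule bd_diff[OF bd G2(1,2) that])
  obtain G0 where G0: "G0 \<in> carr \<C>" "nrm \<C> G0 \<le> 576 * (9217 * (9217 * N))"
    "\<And>F. F \<in> carr \<C> \<Longrightarrow> (\<And>i. i < 0 \<Longrightarrow> \<Delta> i F = 0) \<Longrightarrow> \<psi>2 F = pairing F G0"
  proof (rule functional_step[of 0 \<psi>2 "9217 * (9217 * N)"])
    show "clinear_on (carr \<C>) \<psi>2" unfolding \<psi>2_def by (rule lin_diff[OF lin1 G1(1)])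
    show "cmod (\<psi>2 F) \<le> 9217 * (9217 * N) * nrm \<C> F" if "F \<in> carr \<C>" for F
      unfolding \<psi>2_def by (rule bd_diff[OF bd1 G1(1,2) that])
    show "\<psi>2 F = 0" if "F \<in> carr \<C>" "\<And>i. i \<le> 0 \<Longrightarrow> \<Delta> i F = 0" for F
      using G1(3)[OF that(1)] that(2) by (simp add: \<psi>2_def)
  qed (use N that in auto)
  show ?thesis
  proof (rule that)
    show c: "G2 + (G1 + G0) \<in> carr \<C>" by (intro cal_add G0 G1 G2)
    have "nrm \<C> (G2 + (G1 + G0)) \<le> nrm \<C> G2 + (nrm \<C> G1 + nrm \<C> G0)"
      using nrm_cal_add[OF G2(1) cal_add[OF G1(1) G0(1)]] nrm_cal_add[OF G1(1) G0(1)] by linarith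
    then show "nrm \<C> (G2 + (G1 + G0)) \<le> 10 ^ 11 * N"
      using G0(2) G1(2) G2(2) N by simp
    show "\<psi> F = pairing F (G2 + (G1 + G0))" if "F \<in> carr \<C>" for F
      using G0(3)[OF that] G0(1) G1(1) G2(1) that
      by (simp add: pairing_add_right cal_add \<psi>1_def \<psi>2_def algebra_simps)
  qed
qed

section \<open>Duality of quotients and subspaces\<close>

text \<open>Norms defined as infima need not be attained, so estimates are proved for each
  \<open>s\<close> above the norm; this also keeps \<open>s\<close> positive where it is divided
  by.\<close>

lemma le_mult_of_greater:
  assumes "\<And>s. s > n \<Longrightarrow> c \<le> B * s"
  shows "c \<le> B * (n :: real)"
proof (rule tendsto_lowerbound)
  show "((\<lambda>s. B * s) \<longlongrightarrow> B * n) (at_right n)" by (intro tendsto_intros)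
  show "\<forall>\<^sub>F s in at_right n. c \<le> B * s" using assms by (auto simp: eventually_at_filter)
qed simp

lemma pairing_diff_left:
  assumes "F \<in> carr \<C>" "F' \<in> carr \<C>" "G \<in> carr \<C>"
  shows "pairing (F - F') G = pairing F G - pairing F' G"
  using pairing_add_left[OF assms(1) cal_scale[OF assms(2), of "-1"] assms(3)]
    pairing_scale_left[OF assms(2,3), of "-1"] by (simp add: scaleC_minus1)

lemma pairing_diff_right:
  assumes "F \<in> carr \<C>" "G \<in> carr \<C>" "G' \<in> carr \<C>"
  shows "pairing F (G - G') = pairing F G - pairing F G'"
  using pairing_add_right[OF assms(1,2) cal_scale[OF assms(3), of "-1"]]
    pairing_scale_right[OF assms(1,3), of "-1"] by (simp add: scaleC_minus1)

lemma clinear_on_0: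
  assumes "clinear_on V T" "csubspace V"
  shows "T 0 = 0"
  using clinear_on_diff[OF assms, of 0 0] assms(2) by (simp add: csubspace_def)

text \<open>The isomorphism sends \<open>Q G\<close> to the functional
  \<open>\<tau> F \<mapsto> pairing F G\<close>. \<open>\<tau>_wd\<close> and \<open>Q_wd\<close>
  make it independent of representatives, and \<open>nondeg\<close> makes it injective. For
  surjectivity, \<open>ker\<close> ensures that the extension of a pulled-back functional vanishes
  on the common kernel, so that it is represented by some \<open>G\<close>. The constants
  \<open>c1\<close> and \<open>c2\<close> ask only that the norm of \<open>Y\<close> be equivalent
  to the quotient norm, which leaves room for a Luxemburg norm.\<close>

lemma quotient_isomorphic_dual:
  fixes Y :: "'b::complex_vector nspace" and \<tau> :: "(complex \<Rightarrow> nat \<Rightarrow> complex) \<Rightarrow> 'b"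
    and Q :: "(complex \<Rightarrow> nat \<Rightarrow> complex) \<Rightarrow> 'c::complex_vector"
  assumes K: "csubspace K" "K \<subseteq> carr \<C>"
    and \<tau>: "clinear_on (carr \<C>) \<tau>" and Q: "clinear_on (carr \<C>) Q"
    and Y: "carr Y = \<tau> ` K" and Y0: "\<And>y. y \<in> carr Y \<Longrightarrow> 0 \<le> nrm Y y"
    and c1: "c1 > 0" "\<And>F. F \<in> K \<Longrightarrow> nrm Y (\<tau> F) \<le> c1 * nrm \<C> F"
    and c2: "c2 > 0" "\<And>y s. y \<in> carr Y \<Longrightarrow> nrm Y y < s \<Longrightarrow> \<exists>F\<in>K. \<tau> F = y \<and> nrm \<C> F \<le> c2 * s"
    and ker: "\<And>F. F \<in> carr \<C> \<Longrightarrow> \<Delta> 0 F = 0 \<Longrightarrow> \<Delta> 1 F = 0 \<Longrightarrow> \<Delta> 2 F = 0 \<Longrightarrow> F \<in> K \<and> \<tau> F = 0"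
    and \<tau>_wd: "\<And>F G. F \<in> K \<Longrightarrow> \<tau> F = 0 \<Longrightarrow> G \<in> carr \<C> \<Longrightarrow> pairing F G = 0"
    and Q_wd: "\<And>F G. F \<in> K \<Longrightarrow> G \<in> carr \<C> \<Longrightarrow> Q G = 0 \<Longrightarrow> pairing F G = 0"
    and nondeg: "\<And>G. G \<in> carr \<C> \<Longrightarrow> (\<And>F. F \<in> K \<Longrightarrow> pairing F G = 0) \<Longrightarrow> Q G = 0"
  shows "isomorphic (quotient_image \<C> Q (carr \<C>)) (dual Y)"
proof -
  let ?X = "quotient_image \<C> Q (carr \<C>)"
  have KC: "F \<in> K \<Longrightarrow> F \<in> carr \<C>" for F using K by blast
  have K_ops: "F \<in> K \<Longrightarrow> F' \<in> K \<Longrightarrow> F + F' \<in> K" "F \<in> K \<Longrightarrow> c *\<^sub>C F \<in> K" for F F' c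
    using K by (auto simp: csubspace_def)
  have \<tau>_ops: "\<tau> (F + F') = \<tau> F + \<tau> F'" "\<tau> (c *\<^sub>C F) = c *\<^sub>C \<tau> F"
    if "F \<in> carr \<C>" "F' \<in> carr \<C>" for F F' c using \<tau> that by (auto simp: clinear_on_def)
  have Q_ops: "Q (F + F') = Q F + Q F'" "Q (c *\<^sub>C F) = c *\<^sub>C Q F"
    if "F \<in> carr \<C>" "F' \<in> carr \<C>" for F F' c using Q that by (auto simp: clinear_on_def)
  have nn: "F \<in> carr \<C> \<Longrightarrow> 0 \<le> nrm \<C> F" for F by (rule sn_nonneg[OF seminormed_cal])
  have K0: "0 \<in> K" using K by (simp add: csubspace_def)
  have \<tau>0: "\<tau> 0 = 0" by (rule clinear_on_0[OF \<tau> csubspace_cal])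
  have Y_zero: "0 \<in> carr Y" "nrm Y 0 \<le> 1"
    using K0 \<tau>0 c1(2)[OF K0] sn_nrm_zero[OF seminormed_cal] by (auto simp: Y image_iff)

  \<comment> \<open>Representatives are chosen on both sides; \<open>T_eq\<close> shows that the
    choice does not matter. Off \<open>carr Y\<close> the value 0 is the one that
    \<open>dual\<close> prescribes.\<close>
  define T where "T q y = (if y \<in> carr Y
    then pairing (SOME F. F \<in> K \<and> \<tau> F = y) (SOME G. G \<in> carr \<C> \<and> Q G = q) else 0)" for q y
  have T_eq: "T (Q G) (\<tau> F) = pairing F G" if F: "F \<in> K" and G: "G \<in> carr \<C>" for F G
  proof -
    define F' where "F' = (SOME F'. F' \<in> K \<and> \<tau> F' = \<tau> F)"
    define G' where "G' = (SOME G'. G' \<in> carr \<C> \<and> Q G' = Q G)"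
    have F': "F' \<in> K" "\<tau> F' = \<tau> F"
      using someI[of "\<lambda>F'. F' \<in> K \<and> \<tau> F' = \<tau> F" F] F by (auto simp: F'_def)
    have G': "G' \<in> carr \<C>" "Q G' = Q G"
      using someI[of "\<lambda>G'. G' \<in> carr \<C> \<and> Q G' = Q G" G] G by (auto simp: G'_def)
    have "pairing (F' - F) G' = 0"
      using F' F G' by (intro \<tau>_wd csubspace_diff K)
        (simp_all add: clinear_on_diff[OF \<tau> csubspace_cal] KC)
    moreover have "pairing F (G' - G) = 0"
      using F G' G by (intro Q_wd cal_diff) (simp_all add: clinear_on_diff[OF Q csubspace_cal])
    ultimately have "pairing F' G' = pairing F G"
      using F F' G G' by (simp add: pairing_diff_left pairing_diff_right KC)
    then show ?thesis using F by (simp add: T_def F'_def G'_def Y)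
  qed
  have T_off: "T q y = 0" if "y \<notin> carr Y" for q y using that by (simp add: T_def)
  have T_eqI: "T (Q G) = f" if "G \<in> carr \<C>" "\<And>F. F \<in> K \<Longrightarrow> f (\<tau> F) = pairing F G"
    "\<And>y. y \<notin> carr Y \<Longrightarrow> f y = 0" for G f
  proof
    show "T (Q G) y = f y" for y
      using that T_eq[OF _ that(1)] T_off[of y] Y by (cases "y \<in> carr Y") auto
  qed

  have T_le: "cmod (T (Q G) y) \<le> 16 * c2 * nrm \<C> G * nrm Y y" if G: "G \<in> carr \<C>" and y: "y \<in> carr Y" for G y
  proof (rule le_mult_of_greater)
    fix s assume "nrm Y y < s"
    then obtain F where F: "F \<in> K" "\<tau> F = y" "nrm \<C> F \<le> c2 * s" using c2(2)[OF y] by blast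
    have "cmod (pairing F G) \<le> 16 * (nrm \<C> F * nrm \<C> G)" by (intro pairing_le KC F G)
    also have "\<dots> \<le> 16 * ((c2 * s) * nrm \<C> G)"
      using F nn[OF G] by (intro mult_left_mono mult_right_mono) auto
    finally show "cmod (T (Q G) y) \<le> 16 * c2 * nrm \<C> G * s"
      using T_eq[OF F(1) G] F(2) by (simp add: mult_ac)
  qed
  have T_dual: "T (Q G) \<in> carr (dual Y)" if G: "G \<in> carr \<C>" for G
  proof -
    have "clinear_on (carr Y) (T (Q G))"
      unfolding clinear_on_def Y
    proof (intro conjI ballI allI)
      fix y y' assume "y \<in> \<tau> ` K" "y' \<in> \<tau> ` K"
      then obtain F F' where F: "F \<in> K" "F' \<in> K" "y = \<tau> F" "y' = \<tau> F'" by auto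
      then have "y + y' = \<tau> (F + F')" by (simp add: \<tau>_ops KC)
      then show "T (Q G) (y + y') = T (Q G) y + T (Q G) y'"
        using F T_eq[OF _ G] K_ops by (simp add: pairing_add_left KC G)
    next
      fix c y assume "y \<in> \<tau> ` K"
      then obtain F where F: "F \<in> K" "y = \<tau> F" by auto
      then have "c *\<^sub>C y = \<tau> (c *\<^sub>C F)" using \<tau>_ops(2)[OF KC KC] by simp
      then show "T (Q G) (c *\<^sub>C y) = c *\<^sub>C T (Q G) y"
        using F T_eq[OF _ G] K_ops by (simp add: pairing_scale_left KC G)
    qed
    then show ?thesis using T_le[OF G] T_off by (auto simp: dual_def)
  qed
  have nrm_dual: "nrm (dual Y) f = Sup {cmod (f y) | y. y \<in> carr Y \<and> nrm Y y \<le> 1}" for f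
    by (simp add: dual_def)
  have X_carr: "carr ?X = Q ` carr \<C>" and X_nrm: "nrm ?X q = Inf {nrm \<C> G | G. G \<in> carr \<C> \<and> Q G = q}" for q
    by (simp_all add: quotient_image_def)
  have T_upper: "nrm (dual Y) (T q) \<le> 16 * c2 * nrm ?X q" if q: "q \<in> carr ?X" for q
    unfolding nrm_dual
  proof (rule cSup_least)
    show "{cmod (T q y) | y. y \<in> carr Y \<and> nrm Y y \<le> 1} \<noteq> {}" using Y_zero by auto
    fix r assume "r \<in> {cmod (T q y) | y. y \<in> carr Y \<and> nrm Y y \<le> 1}"
    then obtain y where y: "r = cmod (T q y)" "y \<in> carr Y" "nrm Y y \<le> 1" by auto
    have "r / (16 * c2) \<le> nrm ?X q"
      unfolding X_nrm
    proof (rule cInf_greatest)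
      show "{nrm \<C> G | G. G \<in> carr \<C> \<and> Q G = q} \<noteq> {}" using q by (auto simp: X_carr)
      fix u assume "u \<in> {nrm \<C> G | G. G \<in> carr \<C> \<and> Q G = q}"
      then obtain G where G: "u = nrm \<C> G" "G \<in> carr \<C>" "Q G = q" by auto
      have "r \<le> 16 * c2 * u * nrm Y y" using T_le[OF G(2) y(2)] G y by simp
      also have "\<dots> \<le> 16 * c2 * u * 1"
        using y c2(1) nn[OF G(2)] G by (intro mult_left_mono) auto
      finally show "r / (16 * c2) \<le> u" using c2(1) by (simp add: field_simps)
    qed
    then show "r \<le> 16 * c2 * nrm ?X q" using c2(1) by (simp add: field_simps)
  qed

  have rep: "\<exists>G\<in>carr \<C>. (\<forall>F\<in>K. pairing F G = f (\<tau> F)) \<and> nrm \<C> G \<le> 10 ^ 11 * c1 * nrm (dual Y) f"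
    if f: "f \<in> carr (dual Y)" for f
  proof -
    define M where "M = nrm (dual Y) f"
    obtain B where lin: "clinear_on (carr Y) f" and B: "\<And>y. y \<in> carr Y \<Longrightarrow> cmod (f y) \<le> B * nrm Y y"
      using f by (auto simp: dual_def)
    have le_M: "cmod (f y) \<le> M" if "y \<in> carr Y" "nrm Y y \<le> 1" for y
      unfolding M_def nrm_dual
    proof (rule cSup_upper)
      show "cmod (f y) \<in> {cmod (f y) | y. y \<in> carr Y \<and> nrm Y y \<le> 1}" using that by auto
      have "cmod (f y) \<le> \<bar>B\<bar>" if y: "y \<in> carr Y" "nrm Y y \<le> 1" for y
      proof -
        have "B * nrm Y y \<le> \<bar>B\<bar> * 1" using y Y0 by (intro mult_mono) auto
        then show ?thesis using B[OF y(1)] by simp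
      qed
      then show "bdd_above {cmod (f y) | y. y \<in> carr Y \<and> nrm Y y \<le> 1}" by (auto simp: bdd_above_def)
    qed
    have M0: "0 \<le> M" using le_M[OF Y_zero] norm_ge_zero order_trans by blast
    have f_ops: "f (\<tau> F + \<tau> F') = f (\<tau> F) + f (\<tau> F')" "f (c *\<^sub>C \<tau> F) = c * f (\<tau> F)"
      if "F \<in> K" "F' \<in> K" for F F' c
      using lin that by (auto simp: clinear_on_def Y)
    have f_le: "cmod (f (\<tau> F)) \<le> c1 * M * nrm \<C> F" if F: "F \<in> K" for F
    proof (rule le_mult_of_greater)
      fix s assume s: "nrm \<C> F < s"
      then have s0: "0 < s" using nn[OF KC[OF F]] by linarith
      \<comment> \<open>The dual norm is a supremum over the unit ball, so \<open>F\<close> is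
        scaled until its image under \<open>\<tau>\<close> falls into that ball.\<close>
      define k where "k = inverse (c1 * s)"
      have k: "k > 0" using s0 c1(1) by (simp add: k_def)
      let ?F = "of_real k *\<^sub>C F"
      have F': "?F \<in> K" by (intro K_ops F)
      have "nrm Y (\<tau> ?F) \<le> c1 * nrm \<C> ?F" by (rule c1(2)[OF F'])
      also have "\<dots> = c1 * (k * nrm \<C> F)" using sn_hom[OF seminormed_cal KC[OF F]] k by simp
      also have "\<dots> \<le> c1 * (k * s)" using s k c1(1) by (intro mult_left_mono) auto
      also have "\<dots> = 1" using s0 c1(1) by (simp add: k_def field_simps)
      finally have "cmod (f (\<tau> ?F)) \<le> M" using F' by (intro le_M) (auto simp: Y)
      then have "k * cmod (f (\<tau> F)) \<le> M"
        using k f_ops(2)[OF F F] \<tau>_ops(2)[OF KC KC, OF F F] by (simp add: norm_mult)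
      then show "cmod (f (\<tau> F)) \<le> c1 * M * s" using s0 c1(1) by (simp add: k_def field_simps)
    qed
    have "clinear_on K (\<lambda>F. f (\<tau> F))"
      unfolding clinear_on_def
      using f_ops(1) f_ops(2)[OF _ K0] \<tau>_ops(1) \<tau>_ops(2)[OF _ cal_zero] KC by simp
    then obtain h where h: "clinear_on (carr \<C>) h" "\<And>F. F \<in> K \<Longrightarrow> h F = f (\<tau> F)"
      "\<And>F. F \<in> carr \<C> \<Longrightarrow> cmod (h F) \<le> c1 * M * nrm \<C> F"
      using hahn_banach[OF seminormed_cal K, of "\<lambda>F. f (\<tau> F)" "c1 * M"] f_le M0 c1(1) by auto
    have h0: "h F = 0" if "F \<in> carr \<C>" "\<Delta> 0 F = 0" "\<Delta> 1 F = 0" "\<Delta> 2 F = 0" for F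
      using ker[OF that] h(2)[of F] f_ops(2)[OF K0 K0, of 0] by (simp add: \<tau>0)
    have "0 \<le> c1 * M" using M0 c1(1) by simp
    then obtain G where G: "G \<in> carr \<C>" "nrm \<C> G \<le> 10 ^ 11 * (c1 * M)"
      "\<And>F. F \<in> carr \<C> \<Longrightarrow> h F = pairing F G"
      using functional_representation[OF h(1) _ h(3) h0] by blast
    then show ?thesis using h(2) KC by (intro bexI[of _ G]) (auto simp: M_def mult.assoc)
  qed
  have eq_if: "q = Q G" if "q \<in> carr ?X" "G \<in> carr \<C>" "\<And>F. F \<in> K \<Longrightarrow> pairing F G = T q (\<tau> F)" for q G
  proof -
    obtain G' where G': "G' \<in> carr \<C>" "q = Q G'" using \<open>q \<in> carr ?X\<close> by (auto simp: X_carr)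
    have "Q (G' - G) = 0"
      using that(2,3) G' T_eq by (intro nondeg cal_diff) (simp_all add: pairing_diff_right KC)
    then show ?thesis using clinear_on_diff[OF Q csubspace_cal G'(1) that(2)] G'(2) by simp
  qed
  have T_lower: "nrm ?X q \<le> 10 ^ 11 * c1 * nrm (dual Y) (T q)" if q: "q \<in> carr ?X" for q
  proof -
    have "T q \<in> carr (dual Y)" using q T_dual by (auto simp: X_carr)
    then obtain G where G: "G \<in> carr \<C>" "\<And>F. F \<in> K \<Longrightarrow> pairing F G = T q (\<tau> F)"
      "nrm \<C> G \<le> 10 ^ 11 * c1 * nrm (dual Y) (T q)" using rep by blast
    \<comment> \<open>Any \<open>G\<close> representing \<open>T q\<close> lies in the fibre of
      \<open>q\<close>, so its norm bounds the quotient norm of \<open>q\<close>.\<close>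
    have "nrm ?X q \<le> nrm \<C> G"
      unfolding X_nrm using G eq_if[OF q G(1,2)] nn by (intro cInf_lower bdd_belowI[of _ 0]) auto
    then show ?thesis using G(3) by linarith
  qed
  have "bij_betw T (carr ?X) (carr (dual Y))"
    unfolding bij_betw_def
  proof
    show "inj_on T (carr ?X)"
    proof (rule inj_onI)
      fix q q' assume q: "q \<in> carr ?X" "q' \<in> carr ?X" "T q = T q'"
      obtain G where "G \<in> carr \<C>" "q' = Q G" using q(2) by (auto simp: X_carr)
      then show "q = q'" using eq_if[OF q(1), of G] T_eq q(3) by simp
    qed
    show "T ` carr ?X = carr (dual Y)"
    proof
      show "T ` carr ?X \<subseteq> carr (dual Y)" using T_dual by (auto simp: X_carr)
      show "carr (dual Y) \<subseteq> T ` carr ?X"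
      proof
        fix f assume f: "f \<in> carr (dual Y)"
        then obtain G where G: "G \<in> carr \<C>" "\<And>F. F \<in> K \<Longrightarrow> pairing F G = f (\<tau> F)" using rep by blast
        have "T (Q G) = f" using f G by (intro T_eqI) (auto simp: dual_def)
        then show "f \<in> T ` carr ?X" using G(1) by (auto simp: X_carr)
      qed
    qed
  qed
  moreover have "clinear_on (carr ?X) T"
    unfolding clinear_on_def X_carr
  proof (intro conjI ballI allI)
    fix q q' assume "q \<in> Q ` carr \<C>" "q' \<in> Q ` carr \<C>"
    then obtain G G' where G: "G \<in> carr \<C>" "G' \<in> carr \<C>" "q = Q G" "q' = Q G'" by auto
    have "T (Q (G + G')) = T q + T q'"
      using G by (intro T_eqI cal_add) (simp_all add: T_eq T_off pairing_add_right KC)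
    then show "T (q + q') = T q + T q'" using G by (simp add: Q_ops)
  next
    fix c q assume "q \<in> Q ` carr \<C>"
    then obtain G where G: "G \<in> carr \<C>" "q = Q G" by auto
    have "T (Q (c *\<^sub>C G)) = c *\<^sub>C T q"
      using G by (intro T_eqI cal_scale) (simp_all add: T_eq T_off pairing_scale_right KC)
    then show "T (c *\<^sub>C q) = c *\<^sub>C T q" using G Q_ops(2)[OF G(1) G(1)] by simp
  qed
  moreover have "\<forall>q\<in>carr ?X. inverse (10 ^ 11 * c1) * nrm ?X q \<le> nrm (dual Y) (T q) \<and>
      nrm (dual Y) (T q) \<le> 16 * c2 * nrm ?X q"
  proof
    fix q assume q: "q \<in> carr ?X"
    have "0 < 10 ^ 11 * c1" using c1(1) by simp
    then have "nrm ?X q / (10 ^ 11 * c1) \<le> nrm (dual Y) (T q)"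
      using T_lower[OF q] by (subst pos_divide_le_eq) (simp_all only: mult.commute)
    then have "inverse (10 ^ 11 * c1) * nrm ?X q \<le> nrm (dual Y) (T q)"
      by (simp only: divide_inverse mult.commute)
    then show "inverse (10 ^ 11 * c1) * nrm ?X q \<le> nrm (dual Y) (T q) \<and>
      nrm (dual Y) (T q) \<le> 16 * c2 * nrm ?X q" using T_upper[OF q] by blast
  qed
  moreover have "0 < inverse (10 ^ 11 * c1)" "0 < 16 * c2" using c1 c2 by auto
  ultimately show ?thesis unfolding isomorphic_def by blast
qed

section \<open>Separation of coordinates and the duality for the pair of coefficients\<close>

lemma single_coordinate:
  obtains F where "F \<in> carr \<C>" "\<Delta> 0 F = (\<lambda>n. if n = k then p else 0)"
    "\<Delta> 1 F = (\<lambda>n. if n = k then q else 0)" "\<Delta> 2 F = (\<lambda>n. if n = k then r else 0)"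
proof -
  define e :: "complex \<Rightarrow> nat \<Rightarrow> complex" where "e z = (\<lambda>n. if n = k then z else 0)" for z
  define U where "U = cmod p + cmod q + cmod (r - p)"
  define u where "u = (\<lambda>n. if n = k then U else 0)"
  have U: "0 \<le> U" by (simp add: U_def)
  have us: "u sums U" using sums_single[of k "\<lambda>_. U"] by (simp add: u_def)
  obtain F where "F \<in> carr \<C>" "\<Delta> 0 F = e p" "\<Delta> 1 F = (\<lambda>n. e q n + of_real 0 * e p n)"
    "\<Delta> 2 F = (\<lambda>n. e (r - p) n + of_real 0 * e q n + (of_real 0 ^ 2 / 2 + 1) * e p n)"
  \<comment> \<open>With frequency 0 the second coefficient is \<open>c + a\<close>, hence the
    choice \<open>r - p\<close> for \<open>c\<close>.\<close>
  proof (rule test_family[of "e p" "e q" "e (r - p)" u "\<lambda>_. 0" U])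
    show "(\<lambda>n. u n * exp (- 0 / 2)) \<longlonglongrightarrow> 0" using summable_LIMSEQ_zero[of u] us by (simp add: sums_iff)
  qed (use us U that in \<open>auto simp: e_def u_def U_def sums_iff\<close>)
  then show ?thesis by (intro that[of F]) (auto simp: e_def fun_eq_iff)
qed

lemma pairing_single:
  assumes "\<Delta> 0 F = (\<lambda>n. if n = k then p else 0)"
    "\<Delta> 1 F = (\<lambda>n. if n = k then q else 0)" "\<Delta> 2 F = (\<lambda>n. if n = k then r else 0)"
  shows "pairing F G = r * \<Delta> 0 G k - q * \<Delta> 1 G k + p * \<Delta> 2 G k"
  unfolding pairing_def pair_term_def assms by (subst suminf_finite[of "{k}"]) auto

lemma clinear_on_\<Delta>: "k \<le> 2 \<Longrightarrow> clinear_on (carr \<C>) (\<Delta> k)"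
  by (simp add: clinear_on_def \<Delta>_add \<Delta>_scale)

lemma clinear_on_\<Delta>_pair: "j \<le> 2 \<Longrightarrow> k \<le> 2 \<Longrightarrow> clinear_on (carr \<C>) (\<Delta>_pair j k)"
  by (simp add: clinear_on_def \<Delta>_pair_def \<Delta>_add \<Delta>_scale scaleC_prod_def del: scaleC_fun_apply)

lemma csubspace_ker:
  assumes "clinear_on V T" "csubspace V"
  shows "csubspace {x \<in> V. T x = 0}"
  using assms clinear_on_0[OF assms] by (auto simp: csubspace_def clinear_on_def)

text \<open>If the second coefficient of \<open>F\<close> vanishes, the pairing is the sum of
  \<open>- F_1 G_1 + F_0 G_2\<close>: it sees exactly the coefficients 0 and 1 of \<open>F\<close>
  and the coefficients 1 and 2 of \<open>G\<close>. Both constants are 1 because the predual carries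
  the quotient norm itself.\<close>

lemma \<Delta>12_dual:
  "isomorphic (quotient_image \<C> (\<Delta>_pair 1 2) (carr \<C>))
     (dual (quotient_image \<C> (\<Delta>_pair 0 1) (ker_\<Delta> 2)))"
proof (rule quotient_isomorphic_dual[where K = "ker_\<Delta> 2" and \<tau> = "\<Delta>_pair 0 1" and ?c1.0 = 1 and ?c2.0 = 1])
  let ?Y = "quotient_image \<C> (\<Delta>_pair 0 1) (ker_\<Delta> 2)"
  have K: "F \<in> ker_\<Delta> 2 \<longleftrightarrow> F \<in> carr \<C> \<and> \<Delta> 2 F = 0" for F by (simp add: ker_\<Delta>_def)
  have nY: "nrm ?Y y = Inf {nrm \<C> F | F. F \<in> ker_\<Delta> 2 \<and> \<Delta>_pair 0 1 F = y}" for y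
    by (simp add: quotient_image_def)
  have nn: "0 \<le> nrm \<C> F" if "F \<in> ker_\<Delta> 2" for F
    using that K sn_nonneg[OF seminormed_cal] by blast
  show "csubspace (ker_\<Delta> 2)"
    unfolding ker_\<Delta>_def by (intro csubspace_ker clinear_on_\<Delta> csubspace_cal) simp
  show "ker_\<Delta> 2 \<subseteq> carr \<C>" using K by blast
  show "clinear_on (carr \<C>) (\<Delta>_pair 0 1)" "clinear_on (carr \<C>) (\<Delta>_pair 1 2)"
    by (auto intro: clinear_on_\<Delta>_pair)
  show "carr ?Y = \<Delta>_pair 0 1 ` ker_\<Delta> 2" by (simp add: quotient_image_def)
  show "0 \<le> nrm ?Y y" if "y \<in> carr ?Y" for y
    unfolding nY using that nn by (intro cInf_greatest) (auto simp: quotient_image_def)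
  show "nrm ?Y (\<Delta>_pair 0 1 F) \<le> 1 * nrm \<C> F" if "F \<in> ker_\<Delta> 2" for F
  proof -
    have "nrm ?Y (\<Delta>_pair 0 1 F) \<le> nrm \<C> F"
      unfolding nY using that nn by (intro cInf_lower bdd_belowI[of _ 0]) auto
    then show ?thesis by simp
  qed
  show "\<exists>F\<in>ker_\<Delta> 2. \<Delta>_pair 0 1 F = y \<and> nrm \<C> F \<le> 1 * s" if "y \<in> carr ?Y" "nrm ?Y y < s" for y s
  proof -
    have "{nrm \<C> F | F. F \<in> ker_\<Delta> 2 \<and> \<Delta>_pair 0 1 F = y} \<noteq> {}"
      using that(1) by (auto simp: quotient_image_def)
    from cInf_lessD[OF this] show ?thesis
      using that(2) unfolding nY by force
  qed
  show "F \<in> ker_\<Delta> 2 \<and> \<Delta>_pair 0 1 F = 0"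
    if "F \<in> carr \<C>" "\<Delta> 0 F = 0" "\<Delta> 1 F = 0" "\<Delta> 2 F = 0" for F
    using that by (simp add: K \<Delta>_pair_def zero_prod_def)
  show "pairing F G = 0" if "F \<in> ker_\<Delta> 2" "\<Delta>_pair 0 1 F = 0" for F G
    using that by (simp add: K \<Delta>_pair_def zero_prod_def pairing_def pair_term_def)
  show "pairing F G = 0" if "F \<in> ker_\<Delta> 2" "\<Delta>_pair 1 2 G = 0" for F G
    using that by (simp add: K \<Delta>_pair_def zero_prod_def pairing_def pair_term_def)
  show "\<Delta>_pair 1 2 G = 0" if "G \<in> carr \<C>" "\<And>F. F \<in> ker_\<Delta> 2 \<Longrightarrow> pairing F G = 0" for G
  proof -
    have "\<Delta> 2 G k = 0" for k
    proof -
      obtain F where F: "F \<in> carr \<C>" "\<Delta> 0 F = (\<lambda>n. if n = k then 1 else 0)"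
        "\<Delta> 1 F = (\<lambda>n. if n = k then 0 else 0)" "\<Delta> 2 F = (\<lambda>n. if n = k then 0 else 0)"
        using single_coordinate by blast
      then show ?thesis using that(2)[of F] pairing_single[OF F(2-4), of G] by (simp add: K fun_eq_iff)
    qed
    moreover have "\<Delta> 1 G k = 0" for k
    proof -
      obtain F where F: "F \<in> carr \<C>" "\<Delta> 0 F = (\<lambda>n. if n = k then 0 else 0)"
        "\<Delta> 1 F = (\<lambda>n. if n = k then 1 else 0)" "\<Delta> 2 F = (\<lambda>n. if n = k then 0 else 0)"
        using single_coordinate by blast
      then show ?thesis using that(2)[of F] pairing_single[OF F(2-4), of G] by (simp add: K fun_eq_iff)
    qed
    ultimately show ?thesis by (simp add: \<Delta>_pair_def zero_prod_def fun_eq_iff)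
  qed
qed auto

section \<open>The Orlicz space\<close>

text \<open>With \<open>b = - L x\<close> and \<open>c = (L^2/2 - 1) x\<close> the coefficients 1
  and 2 cancel. This raises the size from \<open>t = |x|\<close> to at most
  \<open>4 t (ln t)^2\<close>, and \<open>exp (L / 2) = w t (ln t)^2\<close> balances the edges
  again: for nonzero entries the left one gets \<open>4 / w\<close>, the right one
  \<open>4 w t^2 (ln t)^4\<close>, with sum at most 12. The factor 8 of \<open>test_family\<close>
  makes this 96.\<close>

lemma log_sequence_lift:
  fixes x :: "nat \<Rightarrow> complex"
  assumes small: "\<And>n. cmod (x n) \<le> exp (- 2)"
    and sm: "summable (\<lambda>n. (cmod (x n))\<^sup>2 * ln (cmod (x n)) ^ 4)"
      "(\<Sum>n. (cmod (x n))\<^sup>2 * ln (cmod (x n)) ^ 4) \<le> 1"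
  obtains F where "F \<in> carr \<C>" "nrm \<C> F \<le> 96" "\<Delta> 0 F = x" "\<Delta> 1 F = 0" "\<Delta> 2 F = 0"
proof -
  define t where "t n = cmod (x n)" for n
  define a where "a n = (t n)\<^sup>2 * ln (t n) ^ 4" for n
  have t0: "0 \<le> t n" for n by (simp add: t_def)
  have lnt: "ln (t n) \<le> - 2" if "t n \<noteq> 0" for n
  proof -
    have "ln (t n) \<le> ln (exp (- 2))"
      using small[of n] t0[of n] that by (subst ln_le_cancel_iff) (auto simp: t_def)
    then show ?thesis by simp
  qed
  have a0: "0 \<le> a n" for n by (simp add: a_def)
  have sa: "summable a" "suminf a \<le> 1"
    using sm by (simp_all add: a_def[abs_def] t_def)
  obtain w where w: "\<And>n. 1/2 \<le> w n" "\<And>n. (w n)\<^sup>2 * a n \<le> 1"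
    "(\<lambda>n. inverse (w n)) \<longlonglongrightarrow> 0" "summable (\<lambda>n. w n * a n)" "(\<Sum>n. w n * a n) \<le> 3"
    by (rule unbounded_weights[OF a0 sa]) (rule that)
  have w0: "0 < w n" for n using w(1)[of n] by linarith
  define L where "L n = 2 * ln (w n * (t n * (ln (t n))\<^sup>2))" for n
  define Q where "Q n = 4 * (t n * (ln (t n))\<^sup>2)" for n
  have iw: "inverse (w n) \<le> 2" for n
    using w(1)[of n] w0[of n] by (simp add: field_simps)
  have m: "Q n * exp (- L n / 2) \<le> 4 * inverse (w n)" and p: "Q n * exp (L n / 2) = 4 * (w n * a n)" for n
  proof -
    have "Q n * exp (- L n / 2) \<le> 4 * inverse (w n) \<and> Q n * exp (L n / 2) = 4 * (w n * a n)"
    proof (cases "t n = 0")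
      case True
      then show ?thesis using w0[of n] by (simp add: Q_def a_def)
    next
      case False
      then have "t n > 0" "(ln (t n))\<^sup>2 > 0" using t0[of n] lnt[of n] by auto
      define z where "z = t n * (ln (t n))\<^sup>2"
      have z: "0 < z" using \<open>t n > 0\<close> \<open>(ln (t n))\<^sup>2 > 0\<close> by (simp add: z_def)
      have "exp (L n / 2) = w n * z"
        using w0[of n] z by (simp add: L_def flip: z_def)
      moreover from this have "exp (- L n / 2) = inverse (w n * z)"
        using exp_minus[of "L n / 2"] by simp
      moreover have "a n = z\<^sup>2" by (simp add: a_def z_def power_mult_distrib flip: power_mult)
      moreover have "Q n = 4 * z" by (simp add: Q_def z_def)
      ultimately show ?thesis
        using z w0[of n] by (simp add: power2_eq_square field_simps)
    qed
    then show "Q n * exp (- L n / 2) \<le> 4 * inverse (w n)" "Q n * exp (L n / 2) = 4 * (w n * a n)"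
      by auto
  qed
  \<comment> \<open>For nonzero entries \<open>2 * ln t \<le> L \<le> 0\<close>: the upper bound
    comes from \<open>w^2 * a \<le> 1\<close>, the lower one from \<open>w \<ge> 1/2\<close> and
    \<open>(ln t)^2 \<ge> 4\<close>, which is where \<open>exp (- 2)\<close> enters. The same
    \<open>l \<ge> 2\<close> absorbs the lower-order terms into \<open>4 * l^2\<close>.\<close>
  have Q_le: "t n * (1 + \<bar>L n\<bar> + \<bar>(L n)\<^sup>2 / 2 - 1\<bar>) \<le> Q n" for n
  proof (cases "t n = 0")
    case True
    then show ?thesis by (simp add: Q_def)
  next
    case False
    define l where "l = - ln (t n)"
    have l: "l \<ge> 2" using lnt[OF False] by (simp add: l_def)
    have tp: "t n > 0" using False t0[of n] by simp
    have Ll: "L n = 2 * ln (w n * (t n * l\<^sup>2))" by (simp add: L_def l_def)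
    have l4: "4 \<le> l\<^sup>2" using power_mono[OF l, of 2] by simp
    have "(w n * (t n * l\<^sup>2))\<^sup>2 \<le> 1\<^sup>2"
      using w(2)[of n] by (simp add: a_def l_def power_mult_distrib flip: power_mult)
    then have "w n * (t n * l\<^sup>2) \<le> 1" by (rule power2_le_imp_le) simp
    then have L0: "L n \<le> 0" using w0[of n] tp l by (simp add: Ll)
    have "1 \<le> w n * l\<^sup>2" using mult_mono[OF w(1)[of n] l4] w0[of n] by simp
    then have "t n \<le> w n * (t n * l\<^sup>2)"
      using mult_left_mono[of 1 "w n * l\<^sup>2" "t n"] tp by (simp add: mult_ac)
    then have "ln (t n) \<le> ln (w n * (t n * l\<^sup>2))"
      using tp w0[of n] l by (subst ln_le_cancel_iff) auto
    then have L1: "\<bar>L n\<bar> \<le> 2 * l" using L0 by (simp add: Ll l_def)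
    have "(L n)\<^sup>2 \<le> (2 * l)\<^sup>2" using power_mono[OF L1, of 2] by simp
    then have "(L n)\<^sup>2 \<le> 4 * l\<^sup>2" by (simp add: power_mult_distrib)
    moreover have "\<bar>(L n)\<^sup>2 / 2 - 1\<bar> \<le> (L n)\<^sup>2 / 2 + 1"
      using zero_le_power2[of "L n"] by linarith
    ultimately have "1 + \<bar>L n\<bar> + \<bar>(L n)\<^sup>2 / 2 - 1\<bar> \<le> 2 + 2 * l + 2 * l\<^sup>2"
      using L1 by linarith
    also have "\<dots> \<le> 4 * l\<^sup>2"
    proof -
      have "2 * l \<le> l * l" using l by (intro mult_right_mono) auto
      then show ?thesis using l unfolding power2_eq_square by linarith
    qed
    finally have "t n * (1 + \<bar>L n\<bar> + \<bar>(L n)\<^sup>2 / 2 - 1\<bar>) \<le> t n * (4 * l\<^sup>2)"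
      using tp by (intro mult_left_mono) auto
    then show ?thesis by (simp add: Q_def l_def)
  qed
  have Q0: "0 \<le> Q n" for n using t0 by (simp add: Q_def)
  obtain F where F: "F \<in> carr \<C>" "nrm \<C> F \<le> 8 * 12" "\<Delta> 0 F = x"
    "\<Delta> 1 F = (\<lambda>n. - of_real (L n) * x n + of_real (L n) * x n)"
    "\<Delta> 2 F = (\<lambda>n. of_real ((L n)\<^sup>2 / 2 - 1) * x n + of_real (L n) * (- of_real (L n) * x n) +
      (of_real (L n) ^ 2 / 2 + 1) * x n)"
  proof (rule test_family[of x "\<lambda>n. - of_real (L n) * x n" "\<lambda>n. of_real ((L n)\<^sup>2 / 2 - 1) * x n" Q L 12])
    show "cmod (x n) + cmod (- of_real (L n) * x n) + cmod (of_real ((L n)\<^sup>2 / 2 - 1) * x n) \<le> Q n" for n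
      using Q_le[of n] unfolding norm_mult norm_minus_cancel norm_of_real
      by (simp add: t_def algebra_simps)
    show "(\<lambda>n. Q n * exp (- L n / 2)) \<longlonglongrightarrow> 0"
    proof (rule Lim_null_comparison)
      show "(\<lambda>n. 4 * inverse (w n)) \<longlonglongrightarrow> 0" using tendsto_mult_right_zero[OF w(3)] .
      show "\<forall>\<^sub>F n in sequentially. norm (Q n * exp (- L n / 2)) \<le> 4 * inverse (w n)"
        using m Q0 by (simp add: abs_mult)
    qed
    show "Q n * exp (- L n / 2) \<le> 12" for n using m[of n] iw[of n] by linarith
    show "summable (\<lambda>n. Q n * exp (L n / 2))" unfolding p by (intro summable_mult w)
    show "(\<Sum>n. Q n * exp (L n / 2)) \<le> 12" unfolding p using w(5) by (simp add: suminf_mult w(4))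
  qed (rule that)
  show ?thesis
    by (rule that[OF F(1)]) (use F(2-5) in \<open>auto simp: fun_eq_iff power2_eq_square algebra_simps\<close>)
qed

text \<open>The converse estimate tests \<open>F\<close> against the extremal function of the normalised sequence
  \<open>x ln\<^sup>2 |x|\<close>, whose logarithm is comparable to that of \<open>x\<close>.\<close>

lemma log_sequence_bound:
  assumes F: "F \<in> carr \<C>" "\<Delta> 1 F = 0" "\<Delta> 2 F = 0" "nrm \<C> F \<le> 1"
    and small: "\<And>n. cmod (\<Delta> 0 F n) \<le> exp (- 216)"
  shows "(\<Sum>n<N. (cmod (\<Delta> 0 F n))\<^sup>2 * ln (cmod (\<Delta> 0 F n)) ^ 4) \<le> 65536"
proof -
  define x where "x = \<Delta> 0 F"
  define t where "t n = cmod (x n)" for n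
  define S where "S = (\<Sum>n<N. (t n)\<^sup>2 * ln (t n) ^ 4)"
  have t0: "0 \<le> t n" for n by (simp add: t_def)
  have "S \<le> 65536"
  proof (cases "S \<le> 1")
    case False
    \<comment> \<open>Here \<open>s \<ge> 1\<close>, so normalising by \<open>s\<close> can only
      decrease the moduli, as the comparison of logarithms below requires.\<close>
    define s where "s = sqrt S"
    have s: "1 \<le> s" "s\<^sup>2 = S" using False by (simp_all add: s_def)
    define v where "v n = (if n < N then of_real ((ln (t n))\<^sup>2 / s) * x n else 0)" for n
    define u where "u n = cmod (v n)" for n
    \<comment> \<open>The extremal frequency without weights: only finitely many entries are
      nonzero, so the left-edge sequence is eventually 0 anyway.\<close>
    define L where "L n = 2 * ln (u n)" for n
    have u_eq: "u n = (ln (t n))\<^sup>2 / s * t n" if "n < N" for n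
      using that s by (simp add: u_def v_def norm_mult t_def norm_divide norm_power)
    have u_off: "u n = 0" if "n \<ge> N" for n using that by (simp add: u_def v_def)
    have u0: "0 \<le> u n" for n by (simp add: u_def)
    have uL: "u n * exp (- L n / 2) \<le> 1" "u n * exp (L n / 2) = (u n)\<^sup>2" for n
      using u0[of n] by (cases "u n = 0"; simp add: L_def exp_minus power2_eq_square)+
    have sum_u: "(\<Sum>n<N. (u n)\<^sup>2) = 1"
    proof -
      have "(u n)\<^sup>2 = (t n)\<^sup>2 * ln (t n) ^ 4 / S" if "n < N" for n
        using u_eq[OF that] s(2) by (simp add: power_divide power_mult_distrib mult.commute flip: power_mult)
      then have "(\<Sum>n<N. (u n)\<^sup>2) = (\<Sum>n<N. (t n)\<^sup>2 * ln (t n) ^ 4 / S)" by simp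
      then have "(\<Sum>n<N. (u n)\<^sup>2) = S / S" by (simp only: sum_divide_distrib[symmetric] S_def)
      then show ?thesis using False by simp
    qed
    have sums_u: "(\<lambda>n. (u n)\<^sup>2) sums 1"
      unfolding sum_u[symmetric] by (rule sums_finite) (use u_off in auto)
    obtain G where G: "G \<in> carr \<C>" "nrm \<C> G \<le> 8 * 1"
      "\<Delta> 2 G = (\<lambda>n. 0 + of_real (L n) * 0 + (of_real (L n) ^ 2 / 2 + 1) * v n)"
    proof (rule test_family[of v "\<lambda>_. 0" "\<lambda>_. 0" u L 1])
      have "\<forall>\<^sub>F n in sequentially. 0 = u n * exp (- L n / 2)"
        using u_off by (auto simp: eventually_sequentially intro!: exI[of _ N])
      then show "(\<lambda>n. u n * exp (- L n / 2)) \<longlonglongrightarrow> 0"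
        by (rule Lim_transform_eventually[OF tendsto_const])
    qed (use uL sums_u in \<open>auto simp: u_def sums_iff intro: that\<close>)
    have estimate: "(t n)\<^sup>2 * ln (t n) ^ 4 / s \<le> 2 * cmod (pair_term F G n)" if n: "n < N" for n
    proof (cases "t n = 0")
      case True
      then show ?thesis by simp
    next
      case False
      define l where "l = - ln (t n)"
      have tp: "0 < t n" using False t0[of n] by simp
      have "ln (t n) \<le> ln (exp (- 216))"
        using small[of n] tp by (subst ln_le_cancel_iff) (auto simp: t_def x_def)
      then have l: "216 \<le> l" by (simp add: l_def)
      have u_l: "u n = l\<^sup>2 / s * t n" using u_eq[OF n] by (simp add: l_def)
      have up: "0 < u n" using u_l l s tp by simp
      \<comment> \<open>The threshold is \<open>216 = 6^3\<close>: it gives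
        \<open>l^2 \<le> (l / 6)^3 \<le> exp (l / 2)\<close>, so \<open>u n\<close> is at most the
        root of \<open>t n\<close> and \<open>L n \<le> - l\<close>.\<close>
      have "l\<^sup>2 \<le> exp (l / 2)"
      proof -
        have "l\<^sup>2 \<le> l\<^sup>2 * (l / 216)" using l mult_left_mono[of 1 "l/216" "l\<^sup>2"] by simp
        also have "\<dots> = (l / 6) ^ 3" by (simp add: power2_eq_square power3_eq_cube)
        also have "\<dots> \<le> exp (l / 6) ^ 3"
        proof (rule power_mono)
          show "l / 6 \<le> exp (l / 6)" using exp_ge_add_one_self[of "l / 6"] by linarith
        qed (use l in simp)
        also have "\<dots> = exp (l / 2)" by (simp flip: exp_of_nat_mult)
        finally show ?thesis .
      qed
      moreover have "u n \<le> l\<^sup>2 * t n"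
        using u_l s(1) tp l divide_left_mono[of 1 s "l\<^sup>2 * t n"] by simp
      ultimately have "u n \<le> exp (l / 2) * t n"
        using tp by (meson mult_right_mono order_trans less_imp_le)
      then have "ln (u n) \<le> ln (exp (l / 2) * t n)"
        using up tp by (subst ln_le_cancel_iff) auto
      also have "\<dots> = - l / 2" using tp by (simp add: ln_mult l_def)
      finally have "l \<le> - L n" by (simp add: L_def)
      then have "l\<^sup>2 \<le> (L n)\<^sup>2" using l power_mono[of l "- L n" 2] by simp
      then have "t n * (l\<^sup>2 / 2 * u n) \<le> t n * (((L n)\<^sup>2 / 2 + 1) * u n)"
        using tp up by (intro mult_left_mono mult_right_mono) auto
      also have "\<dots> = cmod (pair_term F G n)"
      proof -
        have "pair_term F G n = x n * (of_real ((L n)\<^sup>2 / 2 + 1) * v n)"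
          by (simp add: pair_term_def F(2)[simplified] F(3) x_def G(3))
        moreover have "\<bar>(L n)\<^sup>2 / 2 + 1\<bar> = (L n)\<^sup>2 / 2 + 1" by (simp add: add_nonneg_nonneg)
        ultimately show ?thesis by (simp only: norm_mult norm_of_real t_def u_def)
      qed
      finally show ?thesis
        by (simp add: u_l l_def power2_eq_square power4_eq_xxxx mult_ac)
    qed
    \<comment> \<open>Here \<open>S / s = s\<close>, and the pairing bound
      \<open>2 * 16 * 8 = 256\<close> yields \<open>S \<le> 256^2 = 65536\<close>.\<close>
    have "S / s \<le> (\<Sum>n<N. 2 * cmod (pair_term F G n))"
      unfolding S_def sum_divide_distrib using estimate by (intro sum_mono) auto
    also have "\<dots> = 2 * (\<Sum>n<N. cmod (pair_term F G n))" by (simp add: sum_distrib_left)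
    also have "\<dots> \<le> 2 * (16 * (nrm \<C> F * nrm \<C> G))"
      by (intro mult_left_mono pair_term_sum_le F G) auto
    also have "\<dots> \<le> 2 * (16 * (1 * 8))"
      using F(4) G sn_nonneg[OF seminormed_cal] by (intro mult_left_mono mult_mono) auto
    finally have "s \<le> 256" using s by (simp add: power2_eq_square flip: s(2))
    then have "s\<^sup>2 \<le> 256\<^sup>2" using s(1) by (intro power_mono) auto
    then show ?thesis by (simp add: s(2))
  qed simp
  then show ?thesis by (simp add: S_def t_def x_def)
qed

section \<open>The Orlicz space of a function with the prescribed germ at 0\<close>

lemma l2_cmod_le: "l2 v \<Longrightarrow> cmod (v n) \<le> l2norm v"
  using sum_le_suminf[of "\<lambda>n. (cmod (v n))\<^sup>2" "{n}"]
  by (auto simp: l2_def l2norm_def intro: real_le_rsqrt)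

text \<open>Only the germ of \<open>g\<close> at 0 is prescribed, so sequences are scaled until all
  entries lie where the formula holds; the general properties of Orlicz functions have to pay for
  the scaling.\<close>

locale log_orlicz =
  fixes g :: "real \<Rightarrow> real"
  assumes orl: "orlicz_function g"
    and near_0: "\<forall>\<^sub>F t in at_right 0. g t = t\<^sup>2 * (ln t) ^ 4"
begin

lemma g_0: "g 0 = 0"
  and g_mono: "0 \<le> s \<Longrightarrow> s \<le> t \<Longrightarrow> g s \<le> g t"
  and g_at_top: "filterlim g at_top at_top"
  using orl by (auto simp: orlicz_function_def mono_on_def)

lemma g_nonneg: "0 \<le> t \<Longrightarrow> 0 \<le> g t"
  using g_mono[of 0 t] g_0 by simp

text \<open>Convexity together with \<open>g 0 = 0\<close>. It does the work of a doubling
  condition: a larger modular is paid for by enlarging the radius by the same factor.\<close>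

lemma g_div:
  assumes "0 \<le> t" "1 \<le> M"
  shows "g (t / M) \<le> g t / M"
proof -
  have "convex_on {0..} g" using orl by (simp add: orlicz_function_def)
  then have "g ((1 - 1 / M) *\<^sub>R 0 + (1 / M) *\<^sub>R t) \<le> (1 - 1 / M) * g 0 + (1 / M) * g t"
    using assms by (intro convex_onD) auto
  then show ?thesis by (simp add: g_0)
qed

lemma g_small:
  obtains \<delta> where "0 < \<delta>" "\<delta> \<le> exp (- 216)" "\<And>t. 0 \<le> t \<Longrightarrow> t \<le> \<delta> \<Longrightarrow> g t = t\<^sup>2 * ln t ^ 4"
proof -
  obtain b where b: "b > 0" "\<And>t. 0 < t \<Longrightarrow> t < b \<Longrightarrow> g t = t\<^sup>2 * ln t ^ 4"
    using near_0 by (auto simp: eventually_at_right[of 0 1])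
  show ?thesis
  proof (rule that[of "min (b / 2) (exp (- 216))"])
    fix t :: real assume t: "0 \<le> t" "t \<le> min (b / 2) (exp (- 216))"
    then have "t < b" using b(1) by simp
    then show "g t = t\<^sup>2 * ln t ^ 4" using b(2)[of t] t(1) g_0 by (cases "t = 0") auto
  qed (use b in auto)
qed

text \<open>The Luxemburg norm is the infimum of these \<open>r\<close>; stating both comparisons
  for the radii themselves avoids the infimum.\<close>

definition unit_modular :: "(nat \<Rightarrow> complex) \<Rightarrow> real \<Rightarrow> bool" where
  "unit_modular x r \<longleftrightarrow>
     r > 0 \<and> summable (\<lambda>n. g (cmod (x n) / r)) \<and> (\<Sum>n. g (cmod (x n) / r)) \<le> 1"

lemma carr_orlicz: "x \<in> carr (orlicz_space g) \<longleftrightarrow> (\<exists>r>0. summable (\<lambda>n. g (cmod (x n) / r)))"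
  by (simp add: orlicz_space_def)

lemma nrm_orlicz: "nrm (orlicz_space g) x = Inf {r. unit_modular x r}"
  by (simp add: orlicz_space_def unit_modular_def)

lemma unit_modular_shrink:
  assumes "r > 0" "summable (\<lambda>n. g (cmod (x n) / r))" "1 \<le> M" "(\<Sum>n. g (cmod (x n) / r)) \<le> M"
  shows "unit_modular x (r * M)"
proof -
  have le: "g (cmod (x n) / (r * M)) \<le> g (cmod (x n) / r) / M" for n
    using g_div[of "cmod (x n) / r" M] assms by simp
  have sm: "summable (\<lambda>n. g (cmod (x n) / (r * M)))"
    using le assms by (intro summable_comparison_test'[OF summable_divide[OF assms(2), of M]])
      (simp add: g_nonneg)
  have "(\<Sum>n. g (cmod (x n) / (r * M))) \<le> (\<Sum>n. g (cmod (x n) / r) / M)"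
    by (intro suminf_le le sm summable_divide assms)
  also have "\<dots> = (\<Sum>n. g (cmod (x n) / r)) / M" by (intro suminf_divide assms)
  also have "\<dots> \<le> 1" using assms by simp
  finally show ?thesis using sm assms by (simp add: unit_modular_def)
qed

lemma carr_orlicz_iff: "x \<in> carr (orlicz_space g) \<longleftrightarrow> (\<exists>r. unit_modular x r)"
proof
  assume "x \<in> carr (orlicz_space g)"
  then obtain r where "r > 0" "summable (\<lambda>n. g (cmod (x n) / r))" by (auto simp: carr_orlicz)
  then have "unit_modular x (r * max 1 (\<Sum>n. g (cmod (x n) / r)))"
    by (intro unit_modular_shrink) auto
  then show "\<exists>r. unit_modular x r" by blast
next
  assume "\<exists>r. unit_modular x r"
  then show "x \<in> carr (orlicz_space g)" by (auto simp: unit_modular_def carr_orlicz)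
qed

text \<open>Written as an iterated kernel so that \<open>csubspace_ker\<close> applies
  twice.\<close>

definition K :: "(complex \<Rightarrow> nat \<Rightarrow> complex) set" where
  "K = {F \<in> {F \<in> carr \<C>. \<Delta> 1 F = 0}. \<Delta> 2 F = 0}"

lemma K_iff: "F \<in> K \<longleftrightarrow> F \<in> carr \<C> \<and> \<Delta> 1 F = 0 \<and> \<Delta> 2 F = 0"
  by (simp add: K_def)

lemma K_sub: "csubspace K"
proof -
  have 1: "csubspace {F \<in> carr \<C>. \<Delta> 1 F = 0}"
    by (intro csubspace_ker clinear_on_\<Delta> csubspace_cal) simp
  have "clinear_on {F \<in> carr \<C>. \<Delta> 1 F = 0} (\<Delta> 2)"
    by (simp add: clinear_on_def \<Delta>_add \<Delta>_scale)
  then show ?thesis unfolding K_def by (intro csubspace_ker 1)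
qed

text \<open>Scaling \<open>F\<close> by \<open>\<eta> / s\<close> brings all entries of
  \<open>\<Delta> 0 F\<close> below \<open>\<delta>\<close>, through the l_2 bound with constant 384
  at level 0. There \<open>log_sequence_bound\<close> limits the modular to 65536, which
  \<open>unit_modular_shrink\<close> turns into a factor of the radius.\<close>

lemma \<Delta>0_unit_modular:
  obtains C where "C > 0" "\<And>F s. F \<in> K \<Longrightarrow> 0 < s \<Longrightarrow> nrm \<C> F \<le> s \<Longrightarrow> unit_modular (\<Delta> 0 F) (C * s)"
proof -
  obtain \<delta> where \<delta>: "0 < \<delta>" "\<delta> \<le> exp (- 216)" "\<And>t. 0 \<le> t \<Longrightarrow> t \<le> \<delta> \<Longrightarrow> g t = t\<^sup>2 * ln t ^ 4"
    using g_small by blast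
  define \<eta> where "\<eta> = \<delta> / 384"
  have "exp (- 216) \<le> (1 :: real)" by simp
  then have \<eta>: "0 < \<eta>" "\<eta> \<le> 1" using \<delta> unfolding \<eta>_def by linarith+
  have "unit_modular (\<Delta> 0 F) (65536 / \<eta> * s)" if F: "F \<in> K" and s: "0 < s" "nrm \<C> F \<le> s" for F s
  proof -
    define k where "k = \<eta> / s"
    have k: "0 < k" using \<eta> s by (simp add: k_def)
    have FC: "F \<in> carr \<C>" "\<Delta> 1 F = 0" "\<Delta> 2 F = 0" using F by (auto simp: K_iff)
    let ?F = "of_real k *\<^sub>C F"
    have F': "?F \<in> carr \<C>" "\<Delta> 0 ?F = of_real k *\<^sub>C \<Delta> 0 F" "\<Delta> 1 ?F = 0" "\<Delta> 2 ?F = 0"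
      using FC by (simp_all add: \<Delta>_scale cal_scale del: scaleC_fun_apply)
    have "nrm \<C> ?F = k * nrm \<C> F" using sn_hom[OF seminormed_cal FC(1)] k by simp
    also have "\<dots> \<le> k * s" using k s by (intro mult_left_mono) auto
    also have "\<dots> = \<eta>" using s by (simp add: k_def)
    finally have nF: "nrm \<C> ?F \<le> \<eta>" .
    have x_le: "cmod (\<Delta> 0 ?F n) \<le> \<delta>" for n
    proof -
      have "cmod (\<Delta> 0 ?F n) \<le> l2norm (\<Delta> 0 ?F)"
        by (intro l2_cmod_le lowest_coefficient_l2 F') auto
      also have "\<dots> \<le> 384 * nrm \<C> ?F" by (intro lowest_coefficient_l2 F') auto
      also have "\<dots> \<le> \<delta>" using nF by (simp add: \<eta>_def)
      finally show ?thesis .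
    qed
    have nF1: "nrm \<C> ?F \<le> 1" using nF \<eta> by simp
    have x_small: "cmod (\<Delta> 0 ?F n) \<le> exp (- 216)" for n using x_le[of n] \<delta>(2) by simp
    have part: "(\<Sum>n<N. g (cmod (\<Delta> 0 ?F n))) \<le> 65536" for N
      using log_sequence_bound[OF F'(1,3,4) nF1 x_small, of N] \<delta>(3)[OF norm_ge_zero x_le] by simp
    have sm: "summable (\<lambda>n. g (cmod (\<Delta> 0 ?F n)))"
      using part by (intro summableI_nonneg_bounded[where x = 65536]) (auto intro: g_nonneg)
    have eq: "cmod (\<Delta> 0 ?F n) = cmod (\<Delta> 0 F n) / (s / \<eta>)" for n
    proof -
      have "\<Delta> 0 ?F n = of_real k * \<Delta> 0 F n" by (simp only: F'(2) scaleC_fun_apply scaleC_complex)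
      then have "cmod (\<Delta> 0 ?F n) = k * cmod (\<Delta> 0 F n)" using k by (simp only: norm_mult norm_of_real)
      then show ?thesis by (simp add: k_def)
    qed
    have "unit_modular (\<Delta> 0 F) (s / \<eta> * 65536)"
      using sm suminf_le_const[OF sm part] s \<eta> unfolding eq by (intro unit_modular_shrink) auto
    then show ?thesis by (simp add: mult.commute)
  qed
  then show ?thesis using \<eta>(1) by (intro that[of "65536 / \<eta>"]) auto
qed

text \<open>A modular of at most 1 forces \<open>g (cmod (x n) / r) \<le> 1 < g T\<close>, so the
  entries are at most \<open>T * r\<close>. A further division by
  \<open>M \<ge> T / \<delta>\<close> puts them where the formula for \<open>g\<close> holds, with
  modular still at most 1, and \<open>log_sequence_lift\<close> applies.\<close>

lemma unit_modular_lift: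
  obtains C where "C > 0" "\<And>x r. unit_modular x r \<Longrightarrow> \<exists>F\<in>K. \<Delta> 0 F = x \<and> nrm \<C> F \<le> C * r"
proof -
  obtain \<delta> where \<delta>: "0 < \<delta>" "\<delta> \<le> exp (- 216)" "\<And>t. 0 \<le> t \<Longrightarrow> t \<le> \<delta> \<Longrightarrow> g t = t\<^sup>2 * ln t ^ 4"
    using g_small by blast
  have "\<forall>\<^sub>F t in at_top. 1 < g t \<and> 0 < t"
    using g_at_top by (intro eventually_conj eventually_gt_at_top) (simp add: filterlim_at_top_dense)
  then obtain T where T: "1 < g T" "0 < T" by (auto simp: eventually_at_top_linorder)
  define M where "M = max 1 (T / \<delta>)"
  have M: "1 \<le> M" "T \<le> \<delta> * M" using \<delta>(1) by (auto simp: M_def max_def field_simps)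
  have "\<exists>F\<in>K. \<Delta> 0 F = x \<and> nrm \<C> F \<le> 96 * M * r" if "unit_modular x r" for x r
  proof -
    have r: "r > 0" and sm: "summable (\<lambda>n. g (cmod (x n) / r))" and le1: "(\<Sum>n. g (cmod (x n) / r)) \<le> 1"
      using that by (auto simp: unit_modular_def)
    define k where "k = r * M"
    have k: "k > 0" using r M by (simp add: k_def)
    have "unit_modular x k" unfolding k_def using r sm M le1 by (intro unit_modular_shrink) auto
    then have smk: "summable (\<lambda>n. g (cmod (x n) / k))" "(\<Sum>n. g (cmod (x n) / k)) \<le> 1"
      by (auto simp: unit_modular_def)
    define y where "y = of_real (inverse k) *\<^sub>C x"
    have yk: "cmod (y n) = cmod (x n) / k" for n
      using k by (simp add: y_def norm_mult norm_inverse norm_divide field_simps)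
    have y_le: "cmod (y n) \<le> \<delta>" for n
    proof -
      have "g (cmod (x n) / r) \<le> 1"
        using sum_le_suminf[OF sm, of "{n}"] le1 r by (simp add: g_nonneg)
      then have "cmod (x n) / r \<le> T" using T g_mono[of T "cmod (x n) / r"] by linarith
      then have "cmod (x n) / r \<le> \<delta> * M" using M by simp
      then show ?thesis using r k by (simp add: yk k_def field_simps)
    qed
    have g_y: "(cmod (y n))\<^sup>2 * ln (cmod (y n)) ^ 4 = g (cmod (x n) / k)" for n
      using \<delta>(3)[OF norm_ge_zero y_le] yk by simp
    have "exp (- 216) \<le> exp (- 2 :: real)" by simp
    then have "cmod (y n) \<le> exp (- 2)" for n using y_le[of n] \<delta>(2) by linarith
    then obtain F where F: "F \<in> carr \<C>" "nrm \<C> F \<le> 96" "\<Delta> 0 F = y" "\<Delta> 1 F = 0" "\<Delta> 2 F = 0"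
      using log_sequence_lift[of y] smk unfolding g_y by blast
    let ?F = "of_real k *\<^sub>C F"
    have "?F \<in> K" using F by (simp add: K_iff cal_scale \<Delta>_scale del: scaleC_fun_apply)
    moreover have "\<Delta> 0 ?F = x"
      using F k by (simp add: \<Delta>_scale y_def fun_eq_iff)
    moreover have "nrm \<C> ?F \<le> 96 * M * r"
    proof -
      have "nrm \<C> ?F = k * nrm \<C> F"
        using sn_hom[OF seminormed_cal F(1), of "of_real k"] k by simp
      also have "\<dots> \<le> k * 96" using F(2) k by (intro mult_left_mono) auto
      finally show ?thesis by (simp add: k_def mult_ac)
    qed
    ultimately show ?thesis by blast
  qed
  then show ?thesis using M by (intro that[of "96 * M"]) auto
qed

text \<open>On \<open>K\<close> the pairing reduces to the sum of \<open>F_0 G_2\<close>, so it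
  pairs the Orlicz space with the second coefficients. The two comparisons between radii and
  Calderon norms supply the constants of \<open>quotient_isomorphic_dual\<close>.\<close>

lemma \<Delta>2_dual: "isomorphic (quotient_image \<C> (\<Delta> 2) (carr \<C>)) (dual (orlicz_space g))"
proof -
  let ?Y = "orlicz_space g"
  obtain c1 where c1: "c1 > 0"
    "\<And>F s. F \<in> K \<Longrightarrow> 0 < s \<Longrightarrow> nrm \<C> F \<le> s \<Longrightarrow> unit_modular (\<Delta> 0 F) (c1 * s)"
    using \<Delta>0_unit_modular by blast
  obtain c2 where c2: "c2 > 0" "\<And>x r. unit_modular x r \<Longrightarrow> \<exists>F\<in>K. \<Delta> 0 F = x \<and> nrm \<C> F \<le> c2 * r"
    using unit_modular_lift by blast
  have nn: "0 \<le> nrm \<C> F" if "F \<in> K" for F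
    using that K_iff sn_nonneg[OF seminormed_cal] by blast
  have um_pos: "0 < r" if "unit_modular x r" for x r using that by (simp add: unit_modular_def)
  show ?thesis
  proof (rule quotient_isomorphic_dual[where K = K and \<tau> = "\<Delta> 0", OF K_sub _ _ _ _ _ c1(1) _ c2(1)])
    show "K \<subseteq> carr \<C>" using K_iff by blast
    show "clinear_on (carr \<C>) (\<Delta> 0)" "clinear_on (carr \<C>) (\<Delta> 2)" by (auto intro: clinear_on_\<Delta>)
    show "carr ?Y = \<Delta> 0 ` K"
    proof
      show "carr ?Y \<subseteq> \<Delta> 0 ` K" using c2(2) by (force simp: carr_orlicz_iff)
      have "\<Delta> 0 F \<in> carr ?Y" if "F \<in> K" for F
        using c1(2)[OF that, of "nrm \<C> F + 1"] nn[OF that] carr_orlicz_iff by force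
      then show "\<Delta> 0 ` K \<subseteq> carr ?Y" by blast
    qed
    show "0 \<le> nrm ?Y y" if "y \<in> carr ?Y" for y
      unfolding nrm_orlicz using that um_pos
      by (intro cInf_greatest) (auto simp: carr_orlicz_iff intro: less_imp_le)
    show "nrm ?Y (\<Delta> 0 F) \<le> c1 * nrm \<C> F" if F: "F \<in> K" for F
    proof (rule le_mult_of_greater)
      fix s assume s: "nrm \<C> F < s"
      then have "unit_modular (\<Delta> 0 F) (c1 * s)" using nn[OF F] by (intro c1 F) auto
      then show "nrm ?Y (\<Delta> 0 F) \<le> c1 * s"
        unfolding nrm_orlicz using um_pos by (intro cInf_lower bdd_belowI[of _ 0]) (auto intro: less_imp_le)
    qed
    show "\<exists>F\<in>K. \<Delta> 0 F = y \<and> nrm \<C> F \<le> c2 * s" if y: "y \<in> carr ?Y" and s: "nrm ?Y y < s" for y s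
    proof -
      have "{r. unit_modular y r} \<noteq> {}" using y by (auto simp: carr_orlicz_iff)
      from cInf_lessD[OF this] obtain r where r: "unit_modular y r" "r < s"
        using s unfolding nrm_orlicz by blast
      obtain F where "F \<in> K" "\<Delta> 0 F = y" "nrm \<C> F \<le> c2 * r" using c2(2)[OF r(1)] by blast
      moreover have "c2 * r \<le> c2 * s" using r(2) c2(1) by simp
      ultimately show ?thesis by (intro bexI[of _ F]) auto
    qed
    show "F \<in> K \<and> \<Delta> 0 F = 0" if "F \<in> carr \<C>" "\<Delta> 0 F = 0" "\<Delta> 1 F = 0" "\<Delta> 2 F = 0" for F
      using that by (simp add: K_iff)
    show "pairing F G = 0" if "F \<in> K" "\<Delta> 0 F = 0" for F G
      using that by (simp add: K_iff pairing_def pair_term_def)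
    show "pairing F G = 0" if "F \<in> K" "\<Delta> 2 G = 0" for F G
      using that by (simp add: K_iff pairing_def pair_term_def)
    show "\<Delta> 2 G = 0" if "G \<in> carr \<C>" "\<And>F. F \<in> K \<Longrightarrow> pairing F G = 0" for G
    proof
      fix k
      obtain F where F: "F \<in> carr \<C>" "\<Delta> 0 F = (\<lambda>n. if n = k then 1 else 0)"
        "\<Delta> 1 F = (\<lambda>n. if n = k then 0 else 0)" "\<Delta> 2 F = (\<lambda>n. if n = k then 0 else 0)"
        using single_coordinate by blast
      then show "\<Delta> 2 G k = 0 k"
        using that(2)[of F] pairing_single[OF F(2-4), of G] by (simp add: K_iff fun_eq_iff)
    qed
  qed
qed

end

theorem proposition6p1:
  fixes g :: "real \<Rightarrow> real"
  assumes "orlicz_function g"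
    and "\<forall>\<^sub>F t in at_right 0. g t = t\<^sup>2 * (ln t) ^ 4"
  shows "isomorphic (quotient_image \<C> (\<Delta> 2) (carr \<C>)) (dual (orlicz_space g)) \<and>
    isomorphic (quotient_image \<C> (\<Delta>_pair 1 2) (carr \<C>))
      (dual (quotient_image \<C> (\<Delta>_pair 0 1) (ker_\<Delta> 2)))"
proof -
  interpret log_orlicz g using assms by unfold_locales
  show ?thesis using \<Delta>2_dual \<Delta>12_dual by blast
qed

end
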